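(* Consider Problem 3 and Problem 2 as defined in the context, with all data and definitions given there. Define functions $J_t$ on $\mathbb{R}^{n_t}$ by $J_N:=c_N$ and, for each $t=N-1,\dots,0$, $$J_t(\eta):=\inf_{u\in\mathbb{R}^m}\Big(c_t(\eta,u)+\mathbb{E}\big(J_{t+1}(f_t(\eta,u,w_t))\big)\Big).\qquad(\ast)$$ Then $J_t$ is convex quadratic for every $t\in\{0,\dots,N\}$, and an affine function $\mu_t^*:\mathbb{R}^{n_t}\to\mathbb{R}^m$ attains the infimum in $(\ast)$ for every $t\in\{0,\dots,N-1\}$. In addition, $\mathbf{u}^*:=(u_0^*,\dots,u_{N-1}^* )$ with $u_t^*:=\mu_t^*\circ\eta_t$ is an optimal controller for Problem 3, and the optimal value of Problem 3 is $\mathcal{J}_\lambda^*(\mathbf{x}_0)=J_0(\mathbf{x}_0)$, where $\mathcal{J}_\lambda^*(\mathbf{x}_0)$ denotes the optimal value of Problem 2. Particularly, for every $t\in\{0,\dots,N-1\}$ and $\eta\in\mathbb{R}^{n_t}$, $$J_t(\eta)=\eta^\top P_t\eta+q_t^\top\eta+r_t\quad\text{and}\quad\mu_t^*(\eta)=K_t\eta+\kappa_t,$$ where $P_t\in\mathcal{S}_{n_t}$, $q_t$, $r_t$, $K_t$, $\kappa_t$ satisfy the recursion \begin{align*} P_t&:=\mathcal{Q}_{\lambda,t}+\tilde A_t^\top P_{t+1}\tilde A_t-\tilde A_t^\top P_{t+1}\tilde B_t(\tilde B_t^\top P_{t+1}\tilde B_t+R)^{-1}\tilde B_t^\top P_{t+1}\tilde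 A_t,\\ q_t&:=\lambda\zeta_t+(\tilde A_t+\tilde B_tK_t)^\top(q_{t+1}+2P_{t+1}\tilde C_t\bar w),\\ r_t&:=r_{t+1}+\mathrm{tr}\big((\Sigma+\bar w\bar w^\top)\tilde C_t^\top P_{t+1}\tilde C_t\big)+q_{t+1}^\top\tilde C_t\bar w-\kappa_t^\top(\tilde B_t^\top P_{t+1}\tilde B_t+R)\kappa_t,\\ K_t&:=-(\tilde B_t^\top P_{t+1}\tilde B_t+R)^{-1}\tilde B_t^\top P_{t+1}\tilde A_t,\\ \kappa_t&:=-\tfrac12(\tilde B_t^\top P_{t+1}\tilde B_t+R)^{-1}\tilde B_t^\top(q_{t+1}+2P_{t+1}\tilde C_t\bar w), \end{align*} with $P_N:=\mathcal{Q}_{\lambda,N}$, $q_N:=\lambda\zeta_N$, and $r_N:=0$.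
   Context: Notation: $\mathcal{S}_n$ ($\mathcal{S}_n^+$) is the set of $n\times n$ real symmetric positive semidefinite (definite) matrices; $I_n$ is the identity; $0_{n\times m}$ is the $n\times m$ zero matrix; $y\in\mathcal{L}^2(\mathcal{F})$ means $y$ is an $\mathcal{F}$-measurable random vector with $\mathbb{E}(|y|^2)<\infty$; $\sigma(\cdot)$ is the $\sigma$-algebra generated by a random vector; a.s. means almost surely; $\mathbf{u}$ is shorthand for $(u_0,\dots,u_{N-1})$. Parameters: $\lambda\in[0,\infty)$, $R\in\mathcal{S}_m^+$. System: fix $N\in\mathbb{N}=\{1,2,\dots\}$ and deterministic $A\in\mathbb{R}^{n\times n}$, $B\in\mathbb{R}^{n\times m}$. On a probability space $(\Omega,\mathcal{G},\mathbb{P})$, consider $$x_{t+1}=Ax_t+Bu_t+w_t,\quad t\in\{0,\dots,N-1\},\qquad (\mathrm{S})$$ where $x_t,w_t$ are $\mathbb{R}^n$-valued and $u_t$ is $\mathbb{R}^m$-valued. The vectors $x_0,w_0,\dots,w_{N-1}$ are independent, $w_0,\dots,w_{N-1}$ are identically distributed with $\mathbb{E}(|w_t|^4)<\infty$, and $x_0=\mathbf{x}_0$ a.s. for an arbitrary deterministic $\mathbf{x}_0\in\mathbb{R}^n$. Let $\mathcal{F}_t:=\sigma(h_t)$, $h_0:=x_0$, $h_t:=[x_0^\top,u_0^\top,\dots,x_{t-1}^\top,u_{t-1}^\top,x_t^\top]^\top$ for $t\in\{1,\dots,N\}$. Temporal coupling: fix $\mathbf{k}\in\{0,\dots,N\}$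 and $\mathcal{Q}\in\mathcal{S}_{n(\mathbf{k}+1)}$ partitioned into $n\times n$ blocks $Q_{ij}$, $i,j\in\{0,\dots,\mathbf{k}\}$ (block row $i$, block column $j$). For $t\in\{0,\dots,N\}$ let $\mathbf{k}_t:=\min\{\mathbf{k},t\}$, $n_t:=n(\mathbf{k}_t+1)$, $\eta_t:=[x_t^\top\;\cdots\;x_{t-\mathbf{k}_t}^\top]^\top$, and let $\mathcal{Q}_t$ be formed by the first $n_t$ rows and columns of $\mathcal{Q}$. Noise statistics (independent of $t$): $\bar w:=\mathbb{E}(w_{t-1})$, $d_t:=w_{t-1}-\bar w$ for $t\in\{1,\dots,N\}$, $\Sigma:=\mathbb{E}(d_td_t^\top)$, $\gamma:=\mathbb{E}(d_td_t^\top Q_{00}d_t)$. Cost functions: for $t\in\{0,\dots,N\}$ let $\zeta_t:=4[Q_{00}^\top\;\cdots\;Q_{\mathbf{k}_t0}^\top]^\top\gamma$, let $H_t$ be the $n_t\times n_t$ block matrix with $(i,j)$ block $4Q_{i0}\Sigma Q_{0j}$, $i,j\in\{0,\dots,\mathbf{k}_t\}$, and let $\mathcal{Q}_{\lambda,t}:=\mathcal{Q}_t+\lambda H_t$. Define $c_N(\eta):=\eta^\top\mathcal{Q}_{\lambda,N}\eta+\lambda\zeta_N^\top\eta$ on $\mathbb{R}^{n_N}$ and $c_t(\eta,u):=\eta^\top\mathcal{Q}_{\lambda,t}\eta+\lambda\zeta_t^\top\eta+u^\top Ru$ on $\mathbb{R}^{n_t}\times\mathbb{R}^m$ for $t\in\{0,\dots,N-1\}$.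 Augmented dynamics: for $t\in\{0,\dots,N-1\}$, $$\eta_{t+1}=f_t(\eta_t,u_t,w_t),\quad f_t:\mathbb{R}^{n_t}\times\mathbb{R}^m\times\mathbb{R}^n\to\mathbb{R}^{n_{t+1}},\quad f_t(\eta,u,w):=\tilde A_t\eta+\tilde B_tu+\tilde C_tw,\qquad(\mathrm{AS})$$ where, if $\mathbf{k}=0$, $\tilde A_t:=A$, $\tilde B_t:=B$, $\tilde C_t:=I_n$; and if $\mathbf{k}\ge1$, $$\tilde A_t:=\begin{bmatrix}A_t \\ D_t\end{bmatrix},\quad\tilde B_t:=\begin{bmatrix}B \\ 0_{n\mathbf{k}_{t+1}\times m}\end{bmatrix},\quad\tilde C_t:=\begin{bmatrix}I_n \\ 0_{n\mathbf{k}_{t+1}\times n}\end{bmatrix},$$ with $A_t:=[A\;\;0_{n\times n\mathbf{k}_t}]$ if $\mathbf{k}_t\ge1$, $A_t:=A$ if $\mathbf{k}_t=0$; $D_t:=[I_{n\mathbf{k}}\;\;0_{n\mathbf{k}\times n}]$ if $t\ge\mathbf{k}$, $D_t:=I_{n(t+1)}$ if $t<\mathbf{k}$. Let $\mathcal{G}_t:=\sigma(g_t)$, $g_0:=\eta_0$, $g_t:=[\eta_0^\top,u_0^\top,\dots,\eta_{t-1}^\top,u_{t-1}^\top,\eta_t^\top]^\top$ for $t\in\{1,\dots,N\}$. Problem 2: minimize over $\mathbf{u}$ $$\mathbb{E}\Big(c_N(\eta_N)+\sum_{t=0}^{N-1}c_t(\eta_t,u_t)\Big)$$ subject to (S), $x_0=\mathbf{x}_0$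 a.s., and $u_t\in\mathcal{L}^2(\mathcal{F}_t)$ for $t\in\{0,\dots,N-1\}$; its optimal value (infimum) is denoted $\mathcal{J}_\lambda^*(\mathbf{x}_0)$. Problem 3: minimize over $\mathbf{u}$ the same objective, subject to (AS), $\eta_0=\mathbf{x}_0$ a.s., and $u_t\in\mathcal{L}^2(\mathcal{G}_t)$ for $t\in\{0,\dots,N-1\}$. "Optimal" means feasible and attaining the infimum. In $u_t^*=\mu_t^*\circ\eta_t$, $\eta_t$ is the augmented state generated by (AS) under the controls $u_0^*,\dots,u_{t-1}^*$. *)

theory Defs
  imports
    "HOL-Probability.Probability"
    "Jordan_Normal_Form.Gauss_Jordan_Elimination"
begin

unbundle no inner_syntax
unbundle no vec_syntax
hide_const (open) Finite_Cartesian_Product.vec Finite_Cartesian_Product.row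
  Determinants.det Determinants.trace

section \<open>Matrices and functions on spaces of vectors\<close>

definition psd_mat :: "nat \<Rightarrow> real mat \<Rightarrow> bool" where
  "psd_mat d M \<longleftrightarrow> M \<in> carrier_mat d d \<and> transpose_mat M = M \<and>
     (\<forall>v\<in>carrier_vec d. 0 \<le> v \<bullet> (M *\<^sub>v v))"

definition pd_mat :: "nat \<Rightarrow> real mat \<Rightarrow> bool" where
  "pd_mat d M \<longleftrightarrow> M \<in> carrier_mat d d \<and> transpose_mat M = M \<and>
     (\<forall>v\<in>carrier_vec d. v \<noteq> 0\<^sub>v d \<longrightarrow> 0 < v \<bullet> (M *\<^sub>v v))"

text \<open>Unspecified except for matrices satisfying \<^const>\<open>invertible_mat\<close>.\<close>
definition mat_inv :: "real mat \<Rightarrow> real mat" where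
  "mat_inv M = the (mat_inverse M)"

definition mat_trace :: "real mat \<Rightarrow> real" where
  "mat_trace M = (\<Sum>i<dim_row M. M $$ (i, i))"

definition append_cols :: "real mat \<Rightarrow> real mat \<Rightarrow> real mat"  (infixr \<open>@\<^sub>c\<close> 65) where
  "M @\<^sub>c L = transpose_mat (transpose_mat M @\<^sub>r transpose_mat L)"

text \<open>The \<open>p \<times> q\<close> block matrix whose blocks \<open>F i j\<close> (indices from 0) are all of size \<open>d \<times> d\<close>.\<close>
definition block_mat :: "nat \<Rightarrow> nat \<Rightarrow> nat \<Rightarrow> (nat \<Rightarrow> nat \<Rightarrow> real mat) \<Rightarrow> real mat" where
  "block_mat d p q F =
     mat (d * p) (d * q) (\<lambda>(a, b). F (a div d) (b div d) $$ (a mod d, b mod d))"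

definition convex_fun :: "nat \<Rightarrow> (real vec \<Rightarrow> real) \<Rightarrow> bool" where
  "convex_fun d f \<longleftrightarrow> (\<forall>v\<in>carrier_vec d. \<forall>w\<in>carrier_vec d. \<forall>a\<in>{0..1}.
     f (a \<cdot>\<^sub>v v + (1 - a) \<cdot>\<^sub>v w) \<le> a * f v + (1 - a) * f w)"

text \<open>Degree at most two: the quadratic part may vanish.\<close>
definition quadratic_fun :: "nat \<Rightarrow> (real vec \<Rightarrow> real) \<Rightarrow> bool" where
  "quadratic_fun d f \<longleftrightarrow> (\<exists>P\<in>carrier_mat d d. \<exists>q\<in>carrier_vec d. \<exists>r.
     \<forall>v\<in>carrier_vec d. f v = v \<bullet> (P *\<^sub>v v) + q \<bullet> v + r)"

definition affine_fun :: "nat \<Rightarrow> nat \<Rightarrow> (real vec \<Rightarrow> real vec) \<Rightarrow> bool" where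
  "affine_fun d e g \<longleftrightarrow> (\<exists>K\<in>carrier_mat e d. \<exists>k\<in>carrier_vec e.
     \<forall>v\<in>carrier_vec d. g v = K *\<^sub>v v + k)"

section \<open>Random vectors\<close>

text \<open>The Borel \<open>\<sigma>\<close>-algebra of \<open>d\<close>-dimensional space, transported from the product of \<open>d\<close> real lines.\<close>
definition vec_borel :: "nat \<Rightarrow> real vec measure" where
  "vec_borel d = vimage_algebra (carrier_vec d) (\<lambda>v. \<lambda>i\<in>{..<d}. v $ i)
     (PiM {..<d} (\<lambda>_. borel))"

definition gen_sigma :: "'w measure \<Rightarrow> nat \<Rightarrow> ('w \<Rightarrow> real vec) \<Rightarrow> 'w measure" where
  "gen_sigma M d Y = vimage_algebra (space M) Y (vec_borel d)"

text \<open>\<open>F\<close> carries a sub-\<open>\<sigma>\<close>-algebra; expectations are taken with respect to \<open>M\<close>.\<close>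
definition L2_vec :: "'w measure \<Rightarrow> 'w measure \<Rightarrow> nat \<Rightarrow> ('w \<Rightarrow> real vec) set" where
  "L2_vec M F d = {y. y \<in> F \<rightarrow>\<^sub>M vec_borel d \<and> integrable M (\<lambda>\<omega>. y \<omega> \<bullet> y \<omega>)}"

definition mean_vec :: "'w measure \<Rightarrow> nat \<Rightarrow> ('w \<Rightarrow> real vec) \<Rightarrow> real vec" where
  "mean_vec M d X = vec d (\<lambda>i. \<integral>\<omega>. X \<omega> $ i \<partial>M)"

text \<open>\<open>history z u t\<close> is the vector \<open>[z\<^sub>0, u\<^sub>0, \<dots>, z\<^sub>t\<^sub>-\<^sub>1, u\<^sub>t\<^sub>-\<^sub>1, z\<^sub>t]\<close>.\<close>
primrec history ::
  "(nat \<Rightarrow> 'w \<Rightarrow> real vec) \<Rightarrow> (nat \<Rightarrow> 'w \<Rightarrow> real vec) \<Rightarrow> nat \<Rightarrow> 'w \<Rightarrow> real vec" where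
  "history z u 0 \<omega> = z 0 \<omega>"
| "history z u (Suc t) \<omega> = history z u t \<omega> @\<^sub>v u t \<omega> @\<^sub>v z (Suc t) \<omega>"

section \<open>Problem data\<close>

record 'w lq_data =
  pr :: "'w measure"
  nx :: nat
  nu :: nat
  hor :: nat
  sysA :: "real mat"
  sysB :: "real mat"
  x_init :: "'w \<Rightarrow> real vec"
  noise :: "nat \<Rightarrow> 'w \<Rightarrow> real vec"
  mem :: nat \<comment> \<open>the memory length \<open>k\<close> of the temporal coupling\<close>
  wtQ :: "real mat"
  wtR :: "real mat"
  lam :: real

definition mem_at :: "'w lq_data \<Rightarrow> nat \<Rightarrow> nat" where
  "mem_at S t = min (mem S) t"

definition naug :: "'w lq_data \<Rightarrow> nat \<Rightarrow> nat" where
  "naug S t = nx S * (mem_at S t + 1)"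

definition Qblk :: "'w lq_data \<Rightarrow> nat \<Rightarrow> nat \<Rightarrow> real mat" where
  "Qblk S i j = mat (nx S) (nx S) (\<lambda>(a, b). wtQ S $$ (i * nx S + a, j * nx S + b))"

definition Qlead :: "'w lq_data \<Rightarrow> nat \<Rightarrow> real mat" where
  "Qlead S t = mat (naug S t) (naug S t) (\<lambda>(a, b). wtQ S $$ (a, b))"

text \<open>The noise is identically distributed, so its statistics may be read off at time 0.\<close>

definition wbar :: "'w lq_data \<Rightarrow> real vec" where
  "wbar S = mean_vec (pr S) (nx S) (noise S 0)"

definition dev :: "'w lq_data \<Rightarrow> 'w \<Rightarrow> real vec" where
  "dev S \<omega> = noise S 0 \<omega> - wbar S"

definition Sig :: "'w lq_data \<Rightarrow> real mat" where
  "Sig S = mat (nx S) (nx S) (\<lambda>(i, j). \<integral>\<omega>. dev S \<omega> $ i * dev S \<omega> $ j \<partial>pr S)"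

definition gam :: "'w lq_data \<Rightarrow> real vec" where
  "gam S = mean_vec (pr S) (nx S) (\<lambda>\<omega>. (dev S \<omega> \<bullet> (Qblk S 0 0 *\<^sub>v dev S \<omega>)) \<cdot>\<^sub>v dev S \<omega>)"

section \<open>Costs\<close>

definition zeta :: "'w lq_data \<Rightarrow> nat \<Rightarrow> real vec" where
  "zeta S t = 4 \<cdot>\<^sub>v (block_mat (nx S) (mem_at S t + 1) 1 (\<lambda>i _. Qblk S i 0) *\<^sub>v gam S)"

definition Hmat :: "'w lq_data \<Rightarrow> nat \<Rightarrow> real mat" where
  "Hmat S t = block_mat (nx S) (mem_at S t + 1) (mem_at S t + 1)
     (\<lambda>i j. 4 \<cdot>\<^sub>m (Qblk S i 0 * Sig S * Qblk S 0 j))"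

definition Qlam :: "'w lq_data \<Rightarrow> nat \<Rightarrow> real mat" where
  "Qlam S t = Qlead S t + lam S \<cdot>\<^sub>m Hmat S t"

definition final_cost :: "'w lq_data \<Rightarrow> real vec \<Rightarrow> real" where
  "final_cost S \<eta> = \<eta> \<bullet> (Qlam S (hor S) *\<^sub>v \<eta>) + lam S * (zeta S (hor S) \<bullet> \<eta>)"

definition stage_cost :: "'w lq_data \<Rightarrow> nat \<Rightarrow> real vec \<Rightarrow> real vec \<Rightarrow> real" where
  "stage_cost S t \<eta> v = \<eta> \<bullet> (Qlam S t *\<^sub>v \<eta>) + lam S * (zeta S t \<bullet> \<eta>) + v \<bullet> (wtR S *\<^sub>v v)"

definition total_cost ::
  "'w lq_data \<Rightarrow> (nat \<Rightarrow> 'w \<Rightarrow> real vec) \<Rightarrow> (nat \<Rightarrow> 'w \<Rightarrow> real vec) \<Rightarrow> real" where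
  "total_cost S \<eta> u =
     (\<integral>\<omega>. final_cost S (\<eta> (hor S) \<omega>) + (\<Sum>t<hor S. stage_cost S t (\<eta> t \<omega>) (u t \<omega>)) \<partial>pr S)"

section \<open>Original and augmented dynamics\<close>

primrec state :: "'w lq_data \<Rightarrow> (nat \<Rightarrow> 'w \<Rightarrow> real vec) \<Rightarrow> nat \<Rightarrow> 'w \<Rightarrow> real vec" where
  "state S u 0 \<omega> = x_init S \<omega>"
| "state S u (Suc t) \<omega> = sysA S *\<^sub>v state S u t \<omega> + sysB S *\<^sub>v u t \<omega> + noise S t \<omega>"

text \<open>\<open>[x\<^sub>t, x\<^sub>t\<^sub>-\<^sub>1, \<dots>]\<close>, most recent state first.\<close>
definition stacked_state ::
  "'w lq_data \<Rightarrow> (nat \<Rightarrow> 'w \<Rightarrow> real vec) \<Rightarrow> nat \<Rightarrow> 'w \<Rightarrow> real vec" where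
  "stacked_state S u t \<omega> =
     vec (naug S t) (\<lambda>a. state S u (t - a div nx S) \<omega> $ (a mod nx S))"

definition Arow :: "'w lq_data \<Rightarrow> nat \<Rightarrow> real mat" where
  "Arow S t = (if mem_at S t \<ge> 1 then sysA S @\<^sub>c 0\<^sub>m (nx S) (nx S * mem_at S t) else sysA S)"

definition Dshift :: "'w lq_data \<Rightarrow> nat \<Rightarrow> real mat" where
  "Dshift S t = (if t \<ge> mem S then 1\<^sub>m (nx S * mem S) @\<^sub>c 0\<^sub>m (nx S * mem S) (nx S)
     else 1\<^sub>m (nx S * (t + 1)))"

definition Aaug :: "'w lq_data \<Rightarrow> nat \<Rightarrow> real mat" where
  "Aaug S t = (if mem S = 0 then sysA S else Arow S t @\<^sub>r Dshift S t)"

definition Baug :: "'w lq_data \<Rightarrow> nat \<Rightarrow> real mat" where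
  "Baug S t = (if mem S = 0 then sysB S
     else sysB S @\<^sub>r 0\<^sub>m (nx S * mem_at S (t + 1)) (nu S))"

definition Caug :: "'w lq_data \<Rightarrow> nat \<Rightarrow> real mat" where
  "Caug S t = (if mem S = 0 then 1\<^sub>m (nx S)
     else 1\<^sub>m (nx S) @\<^sub>r 0\<^sub>m (nx S * mem_at S (t + 1)) (nx S))"

definition aug_dyn :: "'w lq_data \<Rightarrow> nat \<Rightarrow> real vec \<Rightarrow> real vec \<Rightarrow> real vec \<Rightarrow> real vec" where
  "aug_dyn S t \<eta> v w = Aaug S t *\<^sub>v \<eta> + Baug S t *\<^sub>v v + Caug S t *\<^sub>v w"

primrec aug_state :: "'w lq_data \<Rightarrow> (nat \<Rightarrow> 'w \<Rightarrow> real vec) \<Rightarrow> nat \<Rightarrow> 'w \<Rightarrow> real vec" where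
  "aug_state S u 0 \<omega> = x_init S \<omega>"
| "aug_state S u (Suc t) \<omega> = aug_dyn S t (aug_state S u t \<omega>) (u t \<omega>) (noise S t \<omega>)"

section \<open>The two control problems\<close>

definition filtF :: "'w lq_data \<Rightarrow> (nat \<Rightarrow> 'w \<Rightarrow> real vec) \<Rightarrow> nat \<Rightarrow> 'w measure" where
  "filtF S u t = gen_sigma (pr S) ((t + 1) * nx S + t * nu S) (history (state S u) u t)"

definition filtG :: "'w lq_data \<Rightarrow> (nat \<Rightarrow> 'w \<Rightarrow> real vec) \<Rightarrow> nat \<Rightarrow> 'w measure" where
  "filtG S u t = gen_sigma (pr S) ((\<Sum>s\<le>t. naug S s) + t * nu S) (history (aug_state S u) u t)"

text \<open>Only the components \<open>u\<^sub>t\<close> with \<open>t < hor S\<close> of a control sequence are relevant.\<close>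

definition feasible2 :: "'w lq_data \<Rightarrow> real vec \<Rightarrow> (nat \<Rightarrow> 'w \<Rightarrow> real vec) set" where
  "feasible2 S x0 = {u. (AE \<omega> in pr S. state S u 0 \<omega> = x0) \<and>
     (\<forall>t<hor S. u t \<in> L2_vec (pr S) (filtF S u t) (nu S))}"

definition feasible3 :: "'w lq_data \<Rightarrow> real vec \<Rightarrow> (nat \<Rightarrow> 'w \<Rightarrow> real vec) set" where
  "feasible3 S x0 = {u. (AE \<omega> in pr S. aug_state S u 0 \<omega> = x0) \<and>
     (\<forall>t<hor S. u t \<in> L2_vec (pr S) (filtG S u t) (nu S))}"

definition opt_value2 :: "'w lq_data \<Rightarrow> real vec \<Rightarrow> ereal" where
  "opt_value2 S x0 = (INF u\<in>feasible2 S x0. ereal (total_cost S (stacked_state S u) u))"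

definition opt_value3 :: "'w lq_data \<Rightarrow> real vec \<Rightarrow> ereal" where
  "opt_value3 S x0 = (INF u\<in>feasible3 S x0. ereal (total_cost S (aug_state S u) u))"

definition optimal3 :: "'w lq_data \<Rightarrow> real vec \<Rightarrow> (nat \<Rightarrow> 'w \<Rightarrow> real vec) \<Rightarrow> bool" where
  "optimal3 S x0 u \<longleftrightarrow> u \<in> feasible3 S x0 \<and>
     ereal (total_cost S (aug_state S u) u) = opt_value3 S x0"

section \<open>Dynamic programming\<close>

definition bellman_cost ::
  "'w lq_data \<Rightarrow> nat \<Rightarrow> (real vec \<Rightarrow> real) \<Rightarrow> real vec \<Rightarrow> real vec \<Rightarrow> real" where
  "bellman_cost S t V \<eta> v =
     stage_cost S t \<eta> v + (\<integral>\<omega>. V (aug_dyn S t \<eta> v (noise S t \<omega>)) \<partial>pr S)"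

text \<open>The infimum is taken in the reals, so it is meaningful only where it is finite.\<close>
function J :: "'w lq_data \<Rightarrow> nat \<Rightarrow> real vec \<Rightarrow> real" where
  "J S t = (if t < hor S
     then (\<lambda>\<eta>. INF v\<in>carrier_vec (nu S). bellman_cost S t (J S (Suc t)) \<eta> v)
     else final_cost S)"
  by pat_completeness auto
termination
  by (relation "Wellfounded.measure (\<lambda>(S, t). hor S - t)") auto

declare J.simps [simp del]

definition gain_mat :: "'w lq_data \<Rightarrow> nat \<Rightarrow> real mat \<Rightarrow> real mat" where
  "gain_mat S t X = transpose_mat (Baug S t) * X * Baug S t + wtR S"

end

theory Submission
  imports Defs "Jordan_Normal_Form.Determinant"
begin

text \<open>Completing the square in the control gives, for every admissible \<open>u\<close> and with
  \<open>G\<^sub>t = B\<^sub>t\<^sup>T P\<^sub>t\<^sub>+\<^sub>1 B\<^sub>t + R\<close>, the exact identity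
  cost \<open>= J\<^sub>0(x\<^sub>0) + (\<Sum>t. E ((u\<^sub>t - \<mu>\<^sub>t(\<eta>\<^sub>t))\<^sup>T G\<^sub>t (u\<^sub>t - \<mu>\<^sub>t(\<eta>\<^sub>t))))\<close>.
  The only probabilistic input is that \<open>w\<^sub>t\<close> is uncorrelated with everything determined by
  \<open>x\<^sub>0, w\<^sub>0, \<dots>, w\<^sub>t\<^sub>-\<^sub>1\<close>. Since the controls feasible for either problem are of this kind, and since
  the optimal feedback is feasible for both, the two problems are treated at once, without comparing
  the \<open>\<sigma>\<close>-algebras generated by the two histories.\<close>

section \<open>Quadratic forms\<close>

text \<open>No conditional expectation occurs. The value function is quadratic and the noise enters
  additively, so the mean of \<open>V (Suc t)\<close> at the next state involves only first and
  second moments; uncorrelatedness turns the mixed moment into a product, and a nonrandom quadratic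
  identity can then be integrated along the trajectory. The mean of the noise is absorbed into the
  linear coefficient \<open>s t\<close>, which leaves a noise-free completion of the square at each
  stage. The obstacle is circularity: the information available at time t is generated by states and
  controls that themselves depend on earlier controls. It is broken by \<open>past t\<close>, which
  is generated by the exogenous data alone and does not mention the control. Attainment needs the
  opposite direction: the optimal feedback must be measurable for its own history. \<open>J\<close>
  is a real-valued infimum and is meaningful only once a lower bound is known; the proof therefore
  works with an explicit quadratic \<open>V\<close> and identifies it with \<open>J\<close> by
  backward induction.\<close>

lemma transpose_scalar_prod:
  fixes A :: "real mat"
  assumes "A \<in> carrier_mat nr nc" "x \<in> carrier_vec nc" "y \<in> carrier_vec nr"
  shows "x \<bullet> (transpose_mat A *\<^sub>v y) = (A *\<^sub>v x) \<bullet> y"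
proof -
  have "x \<bullet> (transpose_mat A *\<^sub>v y) = (transpose_mat A *\<^sub>v y) \<bullet> x"
    using assms by (intro comm_scalar_prod[of _ nc]) auto
  also have "\<dots> = y \<bullet> (A *\<^sub>v x)" using assms by (rule transpose_vec_mult_scalar)
  also have "\<dots> = (A *\<^sub>v x) \<bullet> y" using assms by (intro comm_scalar_prod[of _ nr]) auto
  finally show ?thesis .
qed

lemma symmetric_mat_scalar_prod_commute:
  fixes M :: "real mat"
  assumes "M \<in> carrier_mat d d" "transpose_mat M = M" "x \<in> carrier_vec d" "y \<in> carrier_vec d"
  shows "x \<bullet> (M *\<^sub>v y) = y \<bullet> (M *\<^sub>v x)"
  using transpose_scalar_prod[of M d d x y] assms comm_scalar_prod[of "M *\<^sub>v x" d y] by auto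

lemma quadratic_form_add:
  fixes M :: "real mat"
  assumes "M \<in> carrier_mat d d" "transpose_mat M = M" "x \<in> carrier_vec d" "y \<in> carrier_vec d"
  shows "(x + y) \<bullet> (M *\<^sub>v (x + y)) = x \<bullet> (M *\<^sub>v x) + 2 * (y \<bullet> (M *\<^sub>v x)) + y \<bullet> (M *\<^sub>v y)"
proof -
  have "(x + y) \<bullet> (M *\<^sub>v (x + y))
      = (x \<bullet> (M *\<^sub>v x) + x \<bullet> (M *\<^sub>v y)) + (y \<bullet> (M *\<^sub>v x) + y \<bullet> (M *\<^sub>v y))"
    using assms
    by (simp add: mult_add_distrib_mat_vec[of _ d d] add_scalar_prod_distrib[of _ d]
        scalar_prod_add_distrib[of _ d])
  then show ?thesis using symmetric_mat_scalar_prod_commute[OF assms] by simp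
qed

lemma quadratic_form_diff:
  fixes M :: "real mat"
  assumes "M \<in> carrier_mat d d" "transpose_mat M = M" "x \<in> carrier_vec d" "y \<in> carrier_vec d"
  shows "(x - y) \<bullet> (M *\<^sub>v (x - y)) = x \<bullet> (M *\<^sub>v x) - 2 * (x \<bullet> (M *\<^sub>v y)) + y \<bullet> (M *\<^sub>v y)"
proof -
  have "(x - y) \<bullet> (M *\<^sub>v (x - y))
      = (x \<bullet> (M *\<^sub>v x) - x \<bullet> (M *\<^sub>v y)) - (y \<bullet> (M *\<^sub>v x) - y \<bullet> (M *\<^sub>v y))"
    using assms
    by (simp add: mult_minus_distrib_mat_vec[of _ d d] minus_scalar_prod_distrib[of _ d]
        scalar_prod_minus_distrib[of _ d])
  then show ?thesis using symmetric_mat_scalar_prod_commute[OF assms] by simp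
qed

lemma mult3_mat_vec:
  fixes X Y Z :: "real mat"
  assumes "X \<in> carrier_mat n1 n2" "Y \<in> carrier_mat n2 n3" "Z \<in> carrier_mat n3 n4" "v \<in> carrier_vec n4"
  shows "(X * Y * Z) *\<^sub>v v = X *\<^sub>v (Y *\<^sub>v (Z *\<^sub>v v))"
proof -
  have "(X * Y * Z) *\<^sub>v v = (X * Y) *\<^sub>v (Z *\<^sub>v v)"
    using assms by (intro assoc_mult_mat_vec[of _ n1 n3 _ n4]) auto
  also have "\<dots> = X *\<^sub>v (Y *\<^sub>v (Z *\<^sub>v v))"
    using assms by (intro assoc_mult_mat_vec[of _ n1 n2 _ n3]) auto
  finally show ?thesis .
qed

text \<open>The convexity gap equals \<open>a * (1 - a)\<close> times the quadratic form of
  \<open>P\<close> at \<open>v - w\<close>; the affine part cancels.\<close>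

lemma convex_quadratic:
  assumes "psd_mat d P" "q \<in> carrier_vec d"
    and f: "\<And>v. v \<in> carrier_vec d \<Longrightarrow> f v = v \<bullet> (P *\<^sub>v v) + q \<bullet> v + r"
  shows "convex_fun d f"
  unfolding convex_fun_def
proof (intro ballI)
  fix v w :: "real vec" and a :: real
  assume v: "v \<in> carrier_vec d" and w: "w \<in> carrier_vec d" and a: "a \<in> {0..1}"
  have P: "P \<in> carrier_mat d d" "transpose_mat P = P" and
    pos: "\<And>v. v \<in> carrier_vec d \<Longrightarrow> 0 \<le> v \<bullet> (P *\<^sub>v v)"
    using assms(1) by (auto simp: psd_mat_def)
  let ?z = "a \<cdot>\<^sub>v v + (1 - a) \<cdot>\<^sub>v w"
  have z: "?z \<in> carrier_vec d" using v w by auto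
  have Pv: "P *\<^sub>v v \<in> carrier_vec d" "P *\<^sub>v w \<in> carrier_vec d" using P v w by auto
  have zz: "?z \<bullet> (P *\<^sub>v ?z) = a * a * (v \<bullet> (P *\<^sub>v v)) + 2 * (1 - a) * a * (w \<bullet> (P *\<^sub>v v))
      + (1 - a) * (1 - a) * (w \<bullet> (P *\<^sub>v w))"
    using quadratic_form_add[OF P, of "a \<cdot>\<^sub>v v" "(1 - a) \<cdot>\<^sub>v w"] v w P(1) Pv
    by (simp add: mult_mat_vec[of _ d d])
  have qz: "q \<bullet> ?z = a * (q \<bullet> v) + (1 - a) * (q \<bullet> w)"
    using v w assms(2) by (simp add: scalar_prod_add_distrib[of _ d])
  have d: "0 \<le> v \<bullet> (P *\<^sub>v v) - 2 * (v \<bullet> (P *\<^sub>v w)) + w \<bullet> (P *\<^sub>v w)"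
    using quadratic_form_diff[OF P v w] pos[of "v - w"] v w by simp
  have sym: "v \<bullet> (P *\<^sub>v w) = w \<bullet> (P *\<^sub>v v)" by (rule symmetric_mat_scalar_prod_commute[OF P v w])
  have "a * f v + (1 - a) * f w - f ?z
      = a * (1 - a) * (v \<bullet> (P *\<^sub>v v) - 2 * (v \<bullet> (P *\<^sub>v w)) + w \<bullet> (P *\<^sub>v w))"
    unfolding f[OF v] f[OF w] f[OF z] zz qz sym by (simp add: algebra_simps)
  also have "\<dots> \<ge> 0" using a d by (intro mult_nonneg_nonneg) auto
  finally show "f ?z \<le> a * f v + (1 - a) * f w" by simp
qed

section \<open>Inverses of positive definite matrices and operations preserving positivity\<close>

lemma pd_mat_inverse:
  assumes "pd_mat d G"
  shows "invertible_mat G" "mat_inv G \<in> carrier_mat d d" "transpose_mat (mat_inv G) = mat_inv G"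
    "G * mat_inv G = 1\<^sub>m d" "mat_inv G * G = 1\<^sub>m d"
proof -
  have G: "G \<in> carrier_mat d d" "transpose_mat G = G"
    and pos: "\<And>v. v \<in> carrier_vec d \<Longrightarrow> v \<noteq> 0\<^sub>v d \<Longrightarrow> 0 < v \<bullet> (G *\<^sub>v v)"
    using assms by (auto simp: pd_mat_def)
  \<comment> \<open>A kernel vector would give the form the value zero, against strict positivity. A
    nonzero determinant also makes \<open>mat_inverse\<close> return \<open>Some\<close>, so that
    \<open>mat_inv\<close> is the genuine inverse and not an unspecified value.\<close>
  have "det G \<noteq> 0"
  proof
    assume "det G = 0"
    then obtain v where v: "v \<in> carrier_vec d" "v \<noteq> 0\<^sub>v d" "G *\<^sub>v v = 0\<^sub>v d"
      using det_0_iff_vec_prod_zero_field[OF G(1)] by auto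
    then show False using pos[of v] by simp
  qed
  then have "G \<in> Units (ring_mat TYPE(real) d ())"
    by (rule det_non_zero_imp_unit[OF G(1)])
  then obtain X where X: "mat_inverse G = Some X"
    using mat_inverse(1)[OF G(1), of "()"] by (cases "mat_inverse G") auto
  then have inv: "G * X = 1\<^sub>m d" "X * G = 1\<^sub>m d" "X \<in> carrier_mat d d" "mat_inv G = X"
    using mat_inverse(2)[OF G(1)] by (auto simp: mat_inv_def)
  show "mat_inv G \<in> carrier_mat d d" "G * mat_inv G = 1\<^sub>m d" "mat_inv G * G = 1\<^sub>m d"
    using inv by auto
  show "invertible_mat G"
    unfolding invertible_mat_def inverts_mat_def using G inv by auto
  \<comment> \<open>\<open>X\<close> is a right inverse of \<open>G\<close>, and by symmetry of
    \<open>G\<close> its transpose is a left inverse. A left and a right inverse coincide, which is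
    the symmetry of the inverse.\<close>
  have "transpose_mat X * G = 1\<^sub>m d"
    using transpose_mult[of G d d X d] inv G by simp
  then have "transpose_mat X * G * X = X" using inv by simp
  moreover have "transpose_mat X * G * X = transpose_mat X * (G * X)" using inv(3) G(1)
    by (intro assoc_mult_mat[of _ d d _ d _ d]) auto
  ultimately show "transpose_mat (mat_inv G) = mat_inv G" using inv by simp
qed

text \<open>Moving \<open>transpose_mat B\<close> across the scalar product reads the form at
  \<open>v\<close> as the form of \<open>P\<close> at \<open>B v\<close>. \<open>B\<close> may be
  rectangular.\<close>

lemma psd_mat_congruence:
  assumes "psd_mat d P" "B \<in> carrier_mat d m"
  shows "psd_mat m (transpose_mat B * P * B)"
proof -
  have P: "P \<in> carrier_mat d d" "transpose_mat P = P" and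
    pos: "\<And>v. v \<in> carrier_vec d \<Longrightarrow> 0 \<le> v \<bullet> (P *\<^sub>v v)"
    using assms(1) by (auto simp: psd_mat_def)
  note B = assms(2)
  have eq: "v \<bullet> ((transpose_mat B * P * B) *\<^sub>v v) = (B *\<^sub>v v) \<bullet> (P *\<^sub>v (B *\<^sub>v v))"
    if v: "v \<in> carrier_vec m" for v
  proof -
    have "(transpose_mat B * P * B) *\<^sub>v v = transpose_mat B *\<^sub>v (P *\<^sub>v (B *\<^sub>v v))"
      using P(1) B v by (intro mult3_mat_vec[of _ m d _ d _ m]) auto
    then show ?thesis using transpose_scalar_prod[OF B v, of "P *\<^sub>v (B *\<^sub>v v)"] P B v by simp
  qed
  have "transpose_mat (transpose_mat B * P * B) = transpose_mat B * (P * B)"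
    using P B transpose_mult[of "transpose_mat B * P" m d B m] transpose_mult[of "transpose_mat B" m d P d]
    by simp
  also have "\<dots> = transpose_mat B * P * B" using P B by (intro assoc_mult_mat[symmetric, of _ m d _ d]) auto
  finally show ?thesis using P B eq pos by (auto simp: psd_mat_def)
qed

lemma psd_mat_add:
  assumes "psd_mat d M" "psd_mat d L"
  shows "psd_mat d (M + L)"
  using assms
  by (auto simp: psd_mat_def add_mult_distrib_mat_vec[of _ d d] scalar_prod_add_distrib[of _ d]
      transpose_add)

lemma psd_mat_smult:
  assumes "psd_mat d M" "0 \<le> a"
  shows "psd_mat d (a \<cdot>\<^sub>m M)"
proof -
  have "(a \<cdot>\<^sub>m M) *\<^sub>v v = a \<cdot>\<^sub>v (M *\<^sub>v v)" if "v \<in> carrier_vec d" for v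
    using assms that by (intro eq_vecI) (auto simp: psd_mat_def)
  moreover have "transpose_mat (a \<cdot>\<^sub>m M) = a \<cdot>\<^sub>m transpose_mat M" by (intro eq_matI) auto
  ultimately show ?thesis using assms by (auto simp: psd_mat_def)
qed

section \<open>One step of the Riccati recursion\<close>

text \<open>One deterministic stage: the cost v^T R v + y^T P y + s^T y with y = A x + B v, to be
  minimised over v. The dimensions \<open>d\<close> of the current and \<open>e\<close> of the next
  state differ because the augmented state grows until the memory is full. With \<open>s\<close>
  arbitrary the noise can be accounted for outside, and the case of zero \<open>s\<close> yields
  positivity of the Riccati term.\<close>

locale lq_step =
  fixes d e m :: nat and A B P R :: "real mat" and s :: "real vec"
  assumes A: "A \<in> carrier_mat e d" and B: "B \<in> carrier_mat e m"
    and P_psd: "psd_mat e P" and R_pd: "pd_mat m R" and s: "s \<in> carrier_vec e"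
begin

definition "gain = transpose_mat B * P * B + R"
text \<open>The Schur complement of the block \<open>gain\<close> in the matrix of the quadratic
  form that sends (x, v) to v^T R v + (A x + B v)^T P (A x + B v).\<close>

definition "schur = transpose_mat A * P * A
  - transpose_mat A * P * B * mat_inv gain * transpose_mat B * P * A"
definition "feedback = - (mat_inv gain * transpose_mat B * P * A)"
definition "offset = (- 1 / 2) \<cdot>\<^sub>v (mat_inv gain *\<^sub>v (transpose_mat B *\<^sub>v s))"

lemma P: "P \<in> carrier_mat e e" "transpose_mat P = P"
  and P_nonneg: "v \<in> carrier_vec e \<Longrightarrow> 0 \<le> v \<bullet> (P *\<^sub>v v)"
  using P_psd by (auto simp: psd_mat_def)

lemma R: "R \<in> carrier_mat m m" "transpose_mat R = R"
  and R_pos: "v \<in> carrier_vec m \<Longrightarrow> v \<noteq> 0\<^sub>v m \<Longrightarrow> 0 < v \<bullet> (R *\<^sub>v v)"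
  using R_pd by (auto simp: pd_mat_def)

lemma R_nonneg: "v \<in> carrier_vec m \<Longrightarrow> 0 \<le> v \<bullet> (R *\<^sub>v v)"
  using R_pos[of v] R(1) by (cases "v = 0\<^sub>v m") auto

lemma gain_mult: "v \<in> carrier_vec m \<Longrightarrow>
    gain *\<^sub>v v = transpose_mat B *\<^sub>v (P *\<^sub>v (B *\<^sub>v v)) + R *\<^sub>v v"
  unfolding gain_def using P(1) R(1) B
  by (subst add_mult_distrib_mat_vec[of _ m m], auto simp del: assoc_mult_mat
      intro!: mult3_mat_vec[of _ m e _ e _ m] arg_cong2[where f = "(+)"])

lemma gain_form: "v \<in> carrier_vec m \<Longrightarrow>
    v \<bullet> (gain *\<^sub>v v) = v \<bullet> (R *\<^sub>v v) + (B *\<^sub>v v) \<bullet> (P *\<^sub>v (B *\<^sub>v v))"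
  using P(1) R(1) B transpose_scalar_prod[OF B, of v "P *\<^sub>v (B *\<^sub>v v)"]
  by (simp add: gain_mult scalar_prod_add_distrib[of _ m])

text \<open>Strictness comes from \<open>R\<close>; the congruence term is only nonnegative, since
  \<open>B\<close> may have a kernel and \<open>P\<close> may be singular.\<close>

lemma gain_pd: "pd_mat m gain"
proof -
  have c: "psd_mat m (transpose_mat B * P * B)" by (rule psd_mat_congruence[OF P_psd B])
  then have "gain \<in> carrier_mat m m" "transpose_mat gain = gain"
    using R by (auto simp: gain_def psd_mat_def transpose_add)
  moreover have "0 < v \<bullet> (gain *\<^sub>v v)" if "v \<in> carrier_vec m" "v \<noteq> 0\<^sub>v m" for v
    using gain_form[OF that(1)] R_pos[OF that] P_nonneg[of "B *\<^sub>v v"] B that by auto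
  ultimately show ?thesis by (simp add: pd_mat_def)
qed

lemma gain: "gain \<in> carrier_mat m m" "transpose_mat gain = gain"
  and gain_nonneg: "v \<in> carrier_vec m \<Longrightarrow> 0 \<le> v \<bullet> (gain *\<^sub>v v)"
proof -
  show "gain \<in> carrier_mat m m" "transpose_mat gain = gain"
    using gain_pd by (auto simp: pd_mat_def)
  then show "v \<in> carrier_vec m \<Longrightarrow> 0 \<le> v \<bullet> (gain *\<^sub>v v)"
    using gain_pd by (cases "v = 0\<^sub>v m") (auto simp: pd_mat_def intro: less_imp_le)
qed

lemmas gain_inv = pd_mat_inverse[OF gain_pd]

lemma gain_inv_cancel: "v \<in> carrier_vec m \<Longrightarrow> gain *\<^sub>v (mat_inv gain *\<^sub>v v) = v"
  using gain gain_inv by (metis assoc_mult_mat_vec one_mult_mat_vec)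

lemma feedback: "feedback \<in> carrier_mat m d"
  using A B P gain_inv by (auto simp: feedback_def)

lemma offset: "offset \<in> carrier_vec m"
  using B s gain_inv by (auto simp: offset_def)

lemma feedback_mult:
  assumes x: "x \<in> carrier_vec d"
  shows "feedback *\<^sub>v x = - (mat_inv gain *\<^sub>v (transpose_mat B *\<^sub>v (P *\<^sub>v (A *\<^sub>v x))))"
proof -
  have "(mat_inv gain * transpose_mat B * P * A) *\<^sub>v x
      = mat_inv gain *\<^sub>v (transpose_mat B *\<^sub>v (P *\<^sub>v (A *\<^sub>v x)))"
    using A B P gain_inv(2) x
    by (simp add: assoc_mult_mat_vec[of _ m e _ d] assoc_mult_mat_vec[of _ m e _ e]
        assoc_mult_mat_vec[of _ m m _ e])
  then show ?thesis using A x by (simp add: feedback_def)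
qed

lemma schur: "schur \<in> carrier_mat d d" "transpose_mat schur = schur"
proof -
  let ?A = "transpose_mat A" and ?B = "transpose_mat B" and ?G = "mat_inv gain"
  let ?F = "?B * P * A"
  have F: "?F \<in> carrier_mat m d" using A B P by auto
  have FT: "transpose_mat ?F = ?A * P * B"
  proof -
    have "transpose_mat ?F = ?A * (P * B)"
      using A B P transpose_mult[of "?B * P" m e A d] transpose_mult[of "?B" m e P e] by simp
    also have "\<dots> = ?A * P * B" using A B P by (intro assoc_mult_mat[symmetric, of _ d e _ e]) auto
    finally show ?thesis .
  qed
  have G: "?G \<in> carrier_mat m m" "transpose_mat ?G = ?G" using gain_inv by auto
  \<comment> \<open>Regrouped as F^T G F with F = B^T P A, the subtracted product is visibly
    symmetric.\<close>
  have eq: "?A * P * B * ?G * ?B * P * A = transpose_mat ?F * ?G * ?F"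
  proof -
    have "?A * P * B * ?G * ?B * P * A = ?A * P * B * ?G * (?B * P) * A"
      using A B P G by (subst assoc_mult_mat[of _ d m _ e _ e]) auto
    also have "\<dots> = ?A * P * B * ?G * ?F"
      using A B P G by (intro assoc_mult_mat[of _ d m _ e _ d]) auto
    finally show ?thesis using FT by simp
  qed
  have sym1: "transpose_mat (transpose_mat ?F * ?G * ?F) = transpose_mat ?F * ?G * ?F"
    using F G transpose_mult[of "transpose_mat ?F * ?G" d m ?F d] transpose_mult[of "transpose_mat ?F" d m ?G m]
      assoc_mult_mat[of "transpose_mat ?F" d m ?G m ?F d] by simp
  have sym2: "transpose_mat (?A * P * A) = ?A * P * A"
    using psd_mat_congruence[OF P_psd A] by (simp add: psd_mat_def)
  have c: "?A * P * A \<in> carrier_mat d d" "transpose_mat ?F * ?G * ?F \<in> carrier_mat d d"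
    using A F G P by auto
  show "schur \<in> carrier_mat d d" unfolding schur_def eq by (rule minus_carrier_mat[OF c(2)])
  show "transpose_mat schur = schur"
    unfolding schur_def eq transpose_minus[OF c] sym1 sym2 ..
qed

text \<open>Shifting the transposes across the scalar product reduces the subtracted term to the
  form of the inverse gain at \<open>g\<close>, the same vector that is paired with the control in
  the cross term of \<open>completing_the_square\<close>.\<close>

lemma schur_form:
  assumes x: "x \<in> carrier_vec d"
  defines "g \<equiv> transpose_mat B *\<^sub>v (P *\<^sub>v (A *\<^sub>v x))"
  shows "x \<bullet> (schur *\<^sub>v x) = (A *\<^sub>v x) \<bullet> (P *\<^sub>v (A *\<^sub>v x)) - (mat_inv gain *\<^sub>v g) \<bullet> g"
proof -
  let ?A = "transpose_mat A" and ?B = "transpose_mat B" and ?G = "mat_inv gain"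
  have G: "?G \<in> carrier_mat m m" using gain_inv by auto
  have g: "g \<in> carrier_vec m" unfolding g_def using A B P x by auto
  let ?z = "?G *\<^sub>v g"
  have z: "?z \<in> carrier_vec m" using G g by auto
  have ax: "A *\<^sub>v x \<in> carrier_vec e" "B *\<^sub>v ?z \<in> carrier_vec e" using A B x z by auto
  have 1: "(?A * P * A) *\<^sub>v x = ?A *\<^sub>v (P *\<^sub>v (A *\<^sub>v x))"
    using A P x by (intro mult3_mat_vec[of _ d e _ e _ d]) auto
  have 2: "(?A * P * B * ?G * ?B * P * A) *\<^sub>v x = ?A *\<^sub>v (P *\<^sub>v (B *\<^sub>v ?z))"
  proof -
    have "(?A * P * B * ?G * ?B * P * A) *\<^sub>v x = (?A * P * B * ?G * ?B) *\<^sub>v (P *\<^sub>v (A *\<^sub>v x))"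
      using A B P G x by (intro mult3_mat_vec[of _ d e _ e _ d]) auto
    also have "\<dots> = (?A * P * B) *\<^sub>v ?z"
      unfolding g_def using A B P G x by (intro mult3_mat_vec[of _ d m _ m _ e]) auto
    also have "\<dots> = ?A *\<^sub>v (P *\<^sub>v (B *\<^sub>v ?z))"
      using A B P z by (intro mult3_mat_vec[of _ d e _ e _ m]) auto
    finally show ?thesis .
  qed
  have "schur *\<^sub>v x = ?A *\<^sub>v (P *\<^sub>v (A *\<^sub>v x)) - ?A *\<^sub>v (P *\<^sub>v (B *\<^sub>v ?z))"
    unfolding schur_def 1[symmetric] 2[symmetric]
    using A B P G x by (intro minus_mult_distrib_mat_vec[of _ d d]) auto
  then have "x \<bullet> (schur *\<^sub>v x) = (A *\<^sub>v x) \<bullet> (P *\<^sub>v (A *\<^sub>v x)) - (A *\<^sub>v x) \<bullet> (P *\<^sub>v (B *\<^sub>v ?z))"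
    using A B P x ax by (simp add: scalar_prod_minus_distrib[of _ d] transpose_scalar_prod[of A e d])
  moreover have "(A *\<^sub>v x) \<bullet> (P *\<^sub>v (B *\<^sub>v ?z)) = (B *\<^sub>v ?z) \<bullet> (P *\<^sub>v (A *\<^sub>v x))"
    by (rule symmetric_mat_scalar_prod_commute[OF P ax])
  moreover have "\<dots> = ?z \<bullet> g"
    unfolding g_def using z[unfolded g_def] B P A x by (intro transpose_scalar_prod[symmetric]) auto
  ultimately show ?thesis by simp
qed

text \<open>The part of the left side that depends on \<open>v\<close> is v^T gain v + 2 v.g + v.h
  with g = B^T P A x and h = B^T s. If gain z = g and gain w = h, its minimiser is -(z + w/2): z
  gives the feedback and w the offset, whence the factor -1/2 in \<open>offset\<close>.\<close>

theorem completing_the_square: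
  assumes x: "x \<in> carrier_vec d" and v: "v \<in> carrier_vec m"
  defines "y \<equiv> A *\<^sub>v x + B *\<^sub>v v" and "dv \<equiv> v - (feedback *\<^sub>v x + offset)"
  shows "v \<bullet> (R *\<^sub>v v) + y \<bullet> (P *\<^sub>v y) + s \<bullet> y
     = x \<bullet> (schur *\<^sub>v x) + (transpose_mat (A + B * feedback) *\<^sub>v s) \<bullet> x
       - offset \<bullet> (gain *\<^sub>v offset) + dv \<bullet> (gain *\<^sub>v dv)"
proof -
  define g where "g = transpose_mat B *\<^sub>v (P *\<^sub>v (A *\<^sub>v x))"
  define h where "h = transpose_mat B *\<^sub>v s"
  define z where "z = mat_inv gain *\<^sub>v g"
  define w where "w = mat_inv gain *\<^sub>v h"
  define a where "a = A *\<^sub>v x"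
  define b where "b = B *\<^sub>v v"
  have gh: "g \<in> carrier_vec m" "h \<in> carrier_vec m" unfolding g_def h_def using A B P x s by auto
  have zw: "z \<in> carrier_vec m" "w \<in> carrier_vec m" unfolding z_def w_def using gh gain_inv by auto
  have ab: "a \<in> carrier_vec e" "b \<in> carrier_vec e" unfolding a_def b_def using A B x v by auto
  have Gz: "gain *\<^sub>v z = g" "gain *\<^sub>v w = h"
    unfolding z_def w_def using gh by (auto intro: gain_inv_cancel)
  have K: "feedback *\<^sub>v x = - z" unfolding z_def g_def by (rule feedback_mult[OF x])
  have k: "offset = (- 1 / 2) \<cdot>\<^sub>v w" unfolding offset_def w_def h_def ..
  \<comment> \<open>Minus the minimiser, so that the displacement becomes the sum
    \<open>v + u\<close>.\<close>
  define u where "u = z + (1 / 2) \<cdot>\<^sub>v w"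
  have u: "u \<in> carrier_vec m" unfolding u_def using zw by auto
  have dv: "dv = v + u" unfolding dv_def K k u_def using v zw by (intro eq_vecI) auto
  \<comment> \<open>Both sides are the gain form paired at z and w; this merges the two mixed terms
    of \<open>uu\<close> into the single \<open>z \<bullet> h\<close>.\<close>
  have wg: "w \<bullet> g = z \<bullet> h"
    using symmetric_mat_scalar_prod_commute[OF gain zw] Gz by simp
  have Gu: "gain *\<^sub>v u = g + (1 / 2) \<cdot>\<^sub>v h"
    unfolding u_def using zw gain Gz
    by (simp add: mult_add_distrib_mat_vec[of _ m m] mult_mat_vec[of _ m m])
  have uu: "u \<bullet> (gain *\<^sub>v u) = z \<bullet> g + z \<bullet> h + 1 / 4 * (w \<bullet> h)"
    unfolding Gu unfolding u_def using zw gh wg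
    by (simp add: add_scalar_prod_distrib[of _ m] scalar_prod_add_distrib[of _ m] field_simps)
  have vu: "v \<bullet> (gain *\<^sub>v u) = v \<bullet> g + 1 / 2 * (v \<bullet> h)"
    unfolding Gu using v gh by (simp add: scalar_prod_add_distrib[of _ m])
  have dvdv: "dv \<bullet> (gain *\<^sub>v dv) = v \<bullet> (gain *\<^sub>v v) + 2 * (v \<bullet> (gain *\<^sub>v u)) + u \<bullet> (gain *\<^sub>v u)"
    unfolding dv using quadratic_form_add[OF gain v u]
      symmetric_mat_scalar_prod_commute[OF gain v u] by simp
  have kk: "offset \<bullet> (gain *\<^sub>v offset) = 1 / 4 * (w \<bullet> h)"
    unfolding k using zw gain Gz gh by (simp add: mult_mat_vec[of _ m m])
  have bP: "b \<bullet> (P *\<^sub>v a) = v \<bullet> g" unfolding a_def b_def g_def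
    using v B P A x by (intro transpose_scalar_prod[symmetric]) auto
  have yy: "y \<bullet> (P *\<^sub>v y) = a \<bullet> (P *\<^sub>v a) + 2 * (v \<bullet> g) + b \<bullet> (P *\<^sub>v b)"
    unfolding y_def a_def[symmetric] b_def[symmetric] bP[symmetric]
    by (rule quadratic_form_add[OF P ab])
  have sb: "s \<bullet> (B *\<^sub>v t) = t \<bullet> h" if "t \<in> carrier_vec m" for t
    unfolding h_def using that B s transpose_scalar_prod[OF B that s]
      comm_scalar_prod[of s e "B *\<^sub>v t"] by simp
  have sy: "s \<bullet> y = s \<bullet> a + v \<bullet> h"
    unfolding y_def a_def[symmetric] using s ab sb[OF v]
    by (simp add: scalar_prod_add_distrib[of _ e] b_def)
  \<comment> \<open>The closed-loop matrix occurs because A x + B K x = a - B z; pairing with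
    \<open>s\<close> produces the term that cancels the mixed term of \<open>uu\<close>.\<close>
  have lin: "(transpose_mat (A + B * feedback) *\<^sub>v s) \<bullet> x = s \<bullet> a - z \<bullet> h"
  proof -
    have "(transpose_mat (A + B * feedback) *\<^sub>v s) \<bullet> x = s \<bullet> ((A + B * feedback) *\<^sub>v x)"
      using A B feedback x s by (intro transpose_vec_mult_scalar[of _ e d]) auto
    also have "(A + B * feedback) *\<^sub>v x = a - B *\<^sub>v z"
    proof -
      have "(A + B * feedback) *\<^sub>v x = A *\<^sub>v x + B *\<^sub>v (feedback *\<^sub>v x)"
        using A B feedback x by (simp add: add_mult_distrib_mat_vec[of _ e d] assoc_mult_mat_vec[of _ e m])
      also have "B *\<^sub>v (feedback *\<^sub>v x) = - (B *\<^sub>v z)"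
        unfolding K using B zw mult_mat_vec[of B e m z "- 1"]
        by (intro eq_vecI) auto
      finally show ?thesis unfolding a_def using A B zw x by (intro eq_vecI) auto
    qed
    also have "s \<bullet> (a - B *\<^sub>v z) = s \<bullet> a - z \<bullet> h"
      using s ab B zw by (simp add: scalar_prod_minus_distrib[of _ e] sb)
    finally show ?thesis .
  qed
  have sch: "x \<bullet> (schur *\<^sub>v x) = a \<bullet> (P *\<^sub>v a) - z \<bullet> g"
    unfolding a_def z_def g_def by (rule schur_form[OF x])
  show ?thesis
    unfolding yy sy lin sch kk dvdv uu vu gain_form[OF v] b_def[symmetric] by simp
qed

text \<open>With zero linear term the completed square shows that the Riccati form is the cost
  actually incurred by the control \<open>feedback x\<close>, and that cost is a sum of two
  nonnegative terms.\<close>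

lemma schur_nonneg:
  assumes x: "x \<in> carrier_vec d"
  shows "0 \<le> x \<bullet> (schur *\<^sub>v x)"
proof -
  \<comment> \<open>\<open>gain\<close>, \<open>feedback\<close> and \<open>schur\<close> do not
    involve \<open>s\<close>, so this instance shares them; only the offset changes, to
    zero.\<close>
  interpret hom: lq_step d e m A B P R "0\<^sub>v e"
    using A B P_psd R_pd by unfold_locales auto
  have o: "hom.offset = 0\<^sub>v m"
  proof -
    have "transpose_mat B *\<^sub>v 0\<^sub>v e = 0\<^sub>v m" using B by (intro eq_vecI) auto
    moreover have "mat_inv hom.gain *\<^sub>v 0\<^sub>v m = 0\<^sub>v m" using hom.gain_inv(2) by (intro eq_vecI) auto
    ultimately show ?thesis by (auto simp: hom.offset_def intro!: eq_vecI)
  qed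
  let ?v = "feedback *\<^sub>v x" and ?y = "A *\<^sub>v x + B *\<^sub>v (feedback *\<^sub>v x)"
  have v: "?v \<in> carrier_vec m" and y: "?y \<in> carrier_vec e" using A B feedback x by auto
  have l: "transpose_mat (A + B * feedback) *\<^sub>v 0\<^sub>v e = 0\<^sub>v d"
    using A B feedback by (intro eq_vecI) auto
  have "?v \<bullet> (R *\<^sub>v ?v) + ?y \<bullet> (P *\<^sub>v ?y) = x \<bullet> (schur *\<^sub>v x)"
    using hom.completing_the_square[OF x v] v x y gain by (simp add: o l)
  then show ?thesis using R_nonneg[OF v] P_nonneg[OF y] by simp
qed

lemma schur_psd: "psd_mat d schur"
  using schur schur_nonneg by (simp add: psd_mat_def)

end

section \<open>Random vectors\<close>

lemma index_mult_mat_vec_sum: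
  fixes A :: "real mat"
  assumes "A \<in> carrier_mat e d" "v \<in> carrier_vec d" "i < e"
  shows "(A *\<^sub>v v) $ i = (\<Sum>j<d. A $$ (i, j) * v $ j)"
  using assms by (auto simp: scalar_prod_def lessThan_atLeast0 intro!: sum.cong)

lemma scalar_prod_sum:
  assumes "v \<in> carrier_vec d"
  shows "w \<bullet> v = (\<Sum>i<d. w $ i * v $ i)"
  using assms by (auto simp: scalar_prod_def lessThan_atLeast0)

lemma bilinear_form_sum:
  fixes M :: "real mat"
  assumes "M \<in> carrier_mat d e" "v \<in> carrier_vec e"
  shows "w \<bullet> (M *\<^sub>v v) = (\<Sum>i<d. \<Sum>j<e. M $$ (i, j) * (w $ i * v $ j))"
proof -
  have "w \<bullet> (M *\<^sub>v v) = (\<Sum>i<d. w $ i * (M *\<^sub>v v) $ i)"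
    using assms by (intro scalar_prod_sum) auto
  also have "\<dots> = (\<Sum>i<d. \<Sum>j<e. M $$ (i, j) * (w $ i * v $ j))"
    by (intro sum.cong refl) (simp add: index_mult_mat_vec_sum[OF assms] sum_distrib_left algebra_simps)
  finally show ?thesis .
qed

lemma space_vec_borel [simp]: "space (vec_borel d) = carrier_vec d"
  by (simp add: vec_borel_def)

lemma measurable_vec_index: "i < d \<Longrightarrow> (\<lambda>v. v $ i) \<in> vec_borel d \<rightarrow>\<^sub>M borel"
proof -
  assume i: "i < d"
  have "(\<lambda>v. \<lambda>i\<in>{..<d}. v $ i) \<in> vec_borel d \<rightarrow>\<^sub>M PiM {..<d} (\<lambda>_. borel :: real measure)"
    unfolding vec_borel_def by (intro measurable_vimage_algebra1) (auto simp: space_PiM)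
  from measurable_compose[OF this measurable_component_singleton[of i]] i
  show ?thesis by auto
qed

text \<open>The type \<open>real vec\<close> holds vectors of every dimension, so measurability is a
  carrier condition together with measurability of the coordinates.\<close>

lemma measurable_vec_borel_iff:
  "X \<in> F \<rightarrow>\<^sub>M vec_borel d \<longleftrightarrow>
    X \<in> space F \<rightarrow> carrier_vec d \<and> (\<forall>i<d. (\<lambda>\<omega>. X \<omega> $ i) \<in> F \<rightarrow>\<^sub>M borel)"
proof safe
  assume X: "X \<in> F \<rightarrow>\<^sub>M vec_borel d"
  show "X \<omega> \<in> carrier_vec d" if "\<omega> \<in> space F" for \<omega>
    using measurable_space[OF X that] by simp
  show "(\<lambda>\<omega>. X \<omega> $ i) \<in> F \<rightarrow>\<^sub>M borel" if "i < d" for i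
    using measurable_compose[OF X measurable_vec_index[OF that]] .
next
  assume X: "X \<in> space F \<rightarrow> carrier_vec d" "\<forall>i<d. (\<lambda>\<omega>. X \<omega> $ i) \<in> F \<rightarrow>\<^sub>M borel"
  show "X \<in> F \<rightarrow>\<^sub>M vec_borel d"
    unfolding vec_borel_def
    by (rule measurable_vimage_algebra2[OF X(1)]) (use X in \<open>auto intro!: measurable_restrict\<close>)
qed

lemma measurable_vec_borel_carrier:
  "X \<in> F \<rightarrow>\<^sub>M vec_borel d \<Longrightarrow> \<omega> \<in> space F \<Longrightarrow> X \<omega> \<in> carrier_vec d"
  by (auto simp: measurable_vec_borel_iff)

lemma measurable_vec_borel_index:
  "X \<in> F \<rightarrow>\<^sub>M vec_borel d \<Longrightarrow> i < d \<Longrightarrow> (\<lambda>\<omega>. X \<omega> $ i) \<in> F \<rightarrow>\<^sub>M borel"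
  by (auto simp: measurable_vec_borel_iff)

lemma measurable_vec_const: "v \<in> carrier_vec d \<Longrightarrow> (\<lambda>_. v) \<in> F \<rightarrow>\<^sub>M vec_borel d"
  by (auto simp: measurable_vec_borel_iff)

lemma measurable_vec_add:
  assumes "X \<in> F \<rightarrow>\<^sub>M vec_borel d" "Y \<in> F \<rightarrow>\<^sub>M vec_borel d"
  shows "(\<lambda>\<omega>. X \<omega> + Y \<omega>) \<in> F \<rightarrow>\<^sub>M vec_borel d"
  unfolding measurable_vec_borel_iff
proof (intro conjI allI impI)
  show "(\<lambda>\<omega>. X \<omega> + Y \<omega>) \<in> space F \<rightarrow> carrier_vec d"
    using assms by (auto simp: measurable_vec_borel_iff Pi_iff)
  fix i assume i: "i < d"
  have "(\<lambda>\<omega>. X \<omega> $ i + Y \<omega> $ i) \<in> F \<rightarrow>\<^sub>M borel"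
    using assms i by (intro borel_measurable_add measurable_vec_borel_index[of _ _ d])
  then show "(\<lambda>\<omega>. (X \<omega> + Y \<omega>) $ i) \<in> F \<rightarrow>\<^sub>M borel"
    by (rule measurable_cong[THEN iffD1, rotated])
      (use assms i in \<open>auto dest: measurable_vec_borel_carrier\<close>)
qed

lemma measurable_mult_mat_vec:
  assumes A: "A \<in> carrier_mat e d" and X: "X \<in> F \<rightarrow>\<^sub>M vec_borel d"
  shows "(\<lambda>\<omega>. A *\<^sub>v X \<omega>) \<in> F \<rightarrow>\<^sub>M vec_borel e"
  unfolding measurable_vec_borel_iff
proof (intro conjI allI impI)
  show "(\<lambda>\<omega>. A *\<^sub>v X \<omega>) \<in> space F \<rightarrow> carrier_vec e"
    using A measurable_vec_borel_carrier[OF X] by auto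
  fix i assume i: "i < e"
  have "(\<lambda>\<omega>. \<Sum>j<d. A $$ (i, j) * X \<omega> $ j) \<in> F \<rightarrow>\<^sub>M borel"
    using X by (intro borel_measurable_sum borel_measurable_times measurable_vec_borel_index[of _ _ d]) auto
  then show "(\<lambda>\<omega>. (A *\<^sub>v X \<omega>) $ i) \<in> F \<rightarrow>\<^sub>M borel"
    by (rule measurable_cong[THEN iffD1, rotated])
      (auto intro!: index_mult_mat_vec_sum[OF A _ i, symmetric] measurable_vec_borel_carrier[OF X])
qed

text \<open>Coordinates below \<open>d\<close> see only \<open>X\<close>, the others only
  \<open>Y\<close>. An equivalence is wanted: one direction assembles a history from measurable
  pieces, the other recovers the pieces from it.\<close>

lemma measurable_append_vec_iff:
  assumes "X \<in> space F \<rightarrow> carrier_vec d" "Y \<in> space F \<rightarrow> carrier_vec e"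
  shows "(\<lambda>\<omega>. X \<omega> @\<^sub>v Y \<omega>) \<in> F \<rightarrow>\<^sub>M vec_borel (d + e) \<longleftrightarrow>
    X \<in> F \<rightarrow>\<^sub>M vec_borel d \<and> Y \<in> F \<rightarrow>\<^sub>M vec_borel e"
proof -
  have l: "(\<lambda>\<omega>. (X \<omega> @\<^sub>v Y \<omega>) $ i) \<in> F \<rightarrow>\<^sub>M borel \<longleftrightarrow> (\<lambda>\<omega>. X \<omega> $ i) \<in> F \<rightarrow>\<^sub>M borel" if "i < d" for i
    by (rule measurable_cong) (use assms that in \<open>force simp: Pi_iff\<close>)
  have r: "(\<lambda>\<omega>. (X \<omega> @\<^sub>v Y \<omega>) $ (d + i)) \<in> F \<rightarrow>\<^sub>M borel \<longleftrightarrow> (\<lambda>\<omega>. Y \<omega> $ i) \<in> F \<rightarrow>\<^sub>M borel" if "i < e" for i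
    by (rule measurable_cong) (use assms that in \<open>force simp: Pi_iff\<close>)
  have split: "(\<forall>i<d + e. Q i) \<longleftrightarrow> (\<forall>i<d. Q i) \<and> (\<forall>i<e. Q (d + i))" for Q
    by (metis add_less_cancel_left le_add_diff_inverse not_less trans_less_add1)
  have "(\<lambda>\<omega>. X \<omega> @\<^sub>v Y \<omega>) \<in> space F \<rightarrow> carrier_vec (d + e)" using assms by auto
  then show ?thesis
    using assms unfolding measurable_vec_borel_iff split by (auto simp: l r)
qed

section \<open>Histories and the sigma-algebras they generate\<close>

lemma history_carrier:
  assumes "\<And>s. s \<le> t \<Longrightarrow> z s \<in> A \<rightarrow> carrier_vec (dz s)"
    and "\<And>s. s < t \<Longrightarrow> u s \<in> A \<rightarrow> carrier_vec du"
  shows "history z u t \<in> A \<rightarrow> carrier_vec ((\<Sum>s\<le>t. dz s) + t * du)"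
  using assms
proof (induction t)
  case (Suc t)
  have dim: "(\<Sum>s\<le>Suc t. dz s) + Suc t * du = ((\<Sum>s\<le>t. dz s) + t * du) + (du + dz (Suc t))" by simp
  have "history z u t \<in> A \<rightarrow> carrier_vec ((\<Sum>s\<le>t. dz s) + t * du)"
    using Suc.prems by (intro Suc.IH) auto
  then show ?case
    unfolding dim using Suc.prems(1)[of "Suc t"] Suc.prems(2)[of t] by (auto simp: Pi_iff)
qed (simp add: Pi_iff)

text \<open>The block sizes \<open>dz s\<close> may vary with time, so that original states and
  growing augmented states are covered at once.\<close>

lemma measurable_history_iff:
  assumes "\<And>s. s \<le> t \<Longrightarrow> z s \<in> space F \<rightarrow> carrier_vec (dz s)"
    and "\<And>s. s < t \<Longrightarrow> u s \<in> space F \<rightarrow> carrier_vec du"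
  shows "history z u t \<in> F \<rightarrow>\<^sub>M vec_borel ((\<Sum>s\<le>t. dz s) + t * du) \<longleftrightarrow>
    (\<forall>s\<le>t. z s \<in> F \<rightarrow>\<^sub>M vec_borel (dz s)) \<and> (\<forall>s<t. u s \<in> F \<rightarrow>\<^sub>M vec_borel du)"
  using assms
proof (induction t)
  case 0
  have "history z u 0 = z 0" by (rule ext) simp
  then show ?case by simp
next
  case (Suc t)
  let ?D = "(\<Sum>s\<le>t. dz s) + t * du"
  have eq: "history z u (Suc t) = (\<lambda>\<omega>. history z u t \<omega> @\<^sub>v (u t \<omega> @\<^sub>v z (Suc t) \<omega>))"
    by (rule ext) simp
  have dim: "(\<Sum>s\<le>Suc t. dz s) + Suc t * du = ?D + (du + dz (Suc t))" by simp
  have "history z u t \<in> space F \<rightarrow> carrier_vec ?D"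
    using Suc.prems by (intro history_carrier) auto
  note c = this Suc.prems(2)[of t, simplified] Suc.prems(1)[of "Suc t", simplified]
  then have c': "(\<lambda>\<omega>. u t \<omega> @\<^sub>v z (Suc t) \<omega>) \<in> space F \<rightarrow> carrier_vec (du + dz (Suc t))"
    by (auto simp: Pi_iff)
  have IH: "history z u t \<in> F \<rightarrow>\<^sub>M vec_borel ?D \<longleftrightarrow>
    (\<forall>s\<le>t. z s \<in> F \<rightarrow>\<^sub>M vec_borel (dz s)) \<and> (\<forall>s<t. u s \<in> F \<rightarrow>\<^sub>M vec_borel du)"
    using Suc.prems by (intro Suc.IH) auto
  show ?case
    unfolding eq dim measurable_append_vec_iff[OF c(1) c'] measurable_append_vec_iff[OF c(2,3)] IH
    by (auto simp: le_Suc_eq less_Suc_eq)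
qed

text \<open>States can be read off the history that they generate; this is what makes a state
  feedback feasible for its own information structure.\<close>

lemma measurable_history_gen_sigma:
  assumes "\<And>s. s \<le> t \<Longrightarrow> z s \<in> space M \<rightarrow> carrier_vec (dz s)"
    and "\<And>s. s < t \<Longrightarrow> u s \<in> space M \<rightarrow> carrier_vec du"
  defines "F \<equiv> gen_sigma M ((\<Sum>s\<le>t. dz s) + t * du) (history z u t)"
  shows "s \<le> t \<Longrightarrow> z s \<in> F \<rightarrow>\<^sub>M vec_borel (dz s)"
proof -
  have sp: "space F = space M" by (simp add: F_def gen_sigma_def)
  have "history z u t \<in> F \<rightarrow>\<^sub>M vec_borel ((\<Sum>s\<le>t. dz s) + t * du)"
    unfolding F_def gen_sigma_def
    by (rule measurable_vimage_algebra1) (use history_carrier[of t z "space M" dz u du] assms in auto)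
  then show "s \<le> t \<Longrightarrow> z s \<in> F \<rightarrow>\<^sub>M vec_borel (dz s)"
    using measurable_history_iff[of t z F dz u du] assms(1,2) sp by auto
qed

lemma sets_gen_sigma_le:
  assumes "Y \<in> F \<rightarrow>\<^sub>M vec_borel d" "space F = space M"
  shows "sets (gen_sigma M d Y) \<subseteq> sets F"
  unfolding gen_sigma_def by (rule sets_image_in_sets[OF assms(2,1)])

section \<open>Square-integrable random vectors\<close>

context prob_space
begin

abbreviation "sq_int f \<equiv> f \<in> borel_measurable M \<and> integrable M (\<lambda>\<omega>. (f \<omega>)\<^sup>2 :: real)"

lemma sq_int_mult:
  assumes "sq_int f" "sq_int g"
  shows "integrable M (\<lambda>\<omega>. f \<omega> * g \<omega>)"
proof (rule Bochner_Integration.integrable_bound)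
  show "integrable M (\<lambda>\<omega>. (f \<omega>)\<^sup>2 + (g \<omega>)\<^sup>2)" using assms by auto
  show "(\<lambda>\<omega>. f \<omega> * g \<omega>) \<in> borel_measurable M" using assms by auto
  show "AE \<omega> in M. norm (f \<omega> * g \<omega>) \<le> norm ((f \<omega>)\<^sup>2 + (g \<omega>)\<^sup>2)"
  proof (rule AE_I2)
    fix \<omega>
    have "2 * \<bar>f \<omega> * g \<omega>\<bar> \<le> (f \<omega>)\<^sup>2 + (g \<omega>)\<^sup>2"
      using sum_squares_bound[of "\<bar>f \<omega>\<bar>" "\<bar>g \<omega>\<bar>"] by (simp add: abs_mult)
    then show "norm (f \<omega> * g \<omega>) \<le> norm ((f \<omega>)\<^sup>2 + (g \<omega>)\<^sup>2)" by simp
  qed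
qed

text \<open>Multiplication by the constant one, which is square integrable because the total mass is
  finite.\<close>

lemma sq_int_integrable: "sq_int f \<Longrightarrow> integrable M f"
  using sq_int_mult[of f "\<lambda>_. 1"] by simp

lemma sq_int_add:
  assumes "sq_int f" "sq_int g"
  shows "sq_int (\<lambda>\<omega>. f \<omega> + g \<omega>)"
proof -
  have "integrable M (\<lambda>\<omega>. (f \<omega>)\<^sup>2 + (g \<omega>)\<^sup>2 + 2 * (f \<omega> * g \<omega>))"
    using assms sq_int_mult[OF assms] by auto
  moreover have "(\<lambda>\<omega>. (f \<omega> + g \<omega>)\<^sup>2) = (\<lambda>\<omega>. (f \<omega>)\<^sup>2 + (g \<omega>)\<^sup>2 + 2 * (f \<omega> * g \<omega>))"
    by (simp add: power2_sum mult.assoc)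
  ultimately show ?thesis using assms by auto
qed

lemma sq_int_sum: "(\<And>i. i \<in> I \<Longrightarrow> sq_int (f i)) \<Longrightarrow> sq_int (\<lambda>\<omega>. \<Sum>i\<in>I. f i \<omega>)"
proof (induction I rule: infinite_finite_induct)
  case (insert i I)
  then have "sq_int (\<lambda>\<omega>. f i \<omega> + (\<Sum>i\<in>I. f i \<omega>))" by (intro sq_int_add) auto
  with insert show ?case by simp
qed auto

text \<open>The squared norm is a finite sum of squares and dominates each of them, so its
  integrability and that of all coordinate squares are the same.\<close>

lemma L2_vec_iff:
  "X \<in> L2_vec M M d \<longleftrightarrow> X \<in> M \<rightarrow>\<^sub>M vec_borel d \<and> (\<forall>i<d. sq_int (\<lambda>\<omega>. X \<omega> $ i))"
proof -
  have "integrable M (\<lambda>\<omega>. X \<omega> \<bullet> X \<omega>) \<longleftrightarrow> (\<forall>i<d. sq_int (\<lambda>\<omega>. X \<omega> $ i))"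
    if X: "X \<in> M \<rightarrow>\<^sub>M vec_borel d"
  proof -
    have eq: "X \<omega> \<bullet> X \<omega> = (\<Sum>i<d. (X \<omega> $ i)\<^sup>2)" if "\<omega> \<in> space M" for \<omega>
      using scalar_prod_sum[OF measurable_vec_borel_carrier[OF X that]] by (simp add: power2_eq_square)
    have m: "(\<lambda>\<omega>. X \<omega> $ i) \<in> borel_measurable M" if "i < d" for i
      using measurable_vec_borel_index[OF X that] .
    have "integrable M (\<lambda>\<omega>. X \<omega> \<bullet> X \<omega>) \<longleftrightarrow> integrable M (\<lambda>\<omega>. \<Sum>i<d. (X \<omega> $ i)\<^sup>2)"
      by (intro Bochner_Integration.integrable_cong refl eq)
    also have "\<dots> \<longleftrightarrow> (\<forall>i<d. integrable M (\<lambda>\<omega>. (X \<omega> $ i)\<^sup>2))"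
    proof safe
      fix i assume s: "integrable M (\<lambda>\<omega>. \<Sum>i<d. (X \<omega> $ i)\<^sup>2)" and i: "i < d"
      show "integrable M (\<lambda>\<omega>. (X \<omega> $ i)\<^sup>2)"
      proof (rule Bochner_Integration.integrable_bound[OF s])
        show "(\<lambda>\<omega>. (X \<omega> $ i)\<^sup>2) \<in> borel_measurable M" using m[OF i] by simp
        show "AE \<omega> in M. norm ((X \<omega> $ i)\<^sup>2) \<le> norm (\<Sum>i<d. (X \<omega> $ i)\<^sup>2)"
          using i by (auto simp: sum_nonneg intro!: AE_I2 member_le_sum)
      qed
    qed auto
    finally show ?thesis using m by auto
  qed
  then show ?thesis by (auto simp: L2_vec_def)
qed

lemma L2_vec_measurable: "X \<in> L2_vec M M d \<Longrightarrow> X \<in> M \<rightarrow>\<^sub>M vec_borel d"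
  and L2_vec_carrier: "X \<in> L2_vec M M d \<Longrightarrow> \<omega> \<in> space M \<Longrightarrow> X \<omega> \<in> carrier_vec d"
  and L2_vec_index: "X \<in> L2_vec M M d \<Longrightarrow> i < d \<Longrightarrow> sq_int (\<lambda>\<omega>. X \<omega> $ i)"
  by (auto simp: L2_vec_iff measurable_vec_borel_iff)

lemma sq_int_cong: "(\<And>\<omega>. \<omega> \<in> space M \<Longrightarrow> f \<omega> = g \<omega>) \<Longrightarrow> sq_int f \<longleftrightarrow> sq_int g"
  by (intro conj_cong measurable_cong Bochner_Integration.integrable_cong) auto

lemma L2_vec_const: "v \<in> carrier_vec d \<Longrightarrow> (\<lambda>_. v) \<in> L2_vec M M d"
  by (auto simp: L2_vec_iff intro: measurable_vec_const)

lemma L2_vec_add: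
  assumes "X \<in> L2_vec M M d" "Y \<in> L2_vec M M d"
  shows "(\<lambda>\<omega>. X \<omega> + Y \<omega>) \<in> L2_vec M M d"
  unfolding L2_vec_iff
proof (rule conjI[OF _ allI[OF impI]])
  show "(\<lambda>\<omega>. X \<omega> + Y \<omega>) \<in> M \<rightarrow>\<^sub>M vec_borel d"
    using assms by (intro measurable_vec_add L2_vec_measurable)
  fix i assume i: "i < d"
  have "sq_int (\<lambda>\<omega>. X \<omega> $ i + Y \<omega> $ i)" using assms i by (intro sq_int_add L2_vec_index)
  moreover have "(X \<omega> + Y \<omega>) $ i = X \<omega> $ i + Y \<omega> $ i" if "\<omega> \<in> space M" for \<omega>
    using L2_vec_carrier[OF assms(2) that] i by simp
  ultimately show "sq_int (\<lambda>\<omega>. (X \<omega> + Y \<omega>) $ i)"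
    using sq_int_cong[of "\<lambda>\<omega>. (X \<omega> + Y \<omega>) $ i" "\<lambda>\<omega>. X \<omega> $ i + Y \<omega> $ i"] by blast
qed

lemma L2_vec_mult_mat:
  assumes A: "A \<in> carrier_mat e d" and X: "X \<in> L2_vec M M d"
  shows "(\<lambda>\<omega>. A *\<^sub>v X \<omega>) \<in> L2_vec M M e"
  unfolding L2_vec_iff
proof (rule conjI[OF _ allI[OF impI]])
  show "(\<lambda>\<omega>. A *\<^sub>v X \<omega>) \<in> M \<rightarrow>\<^sub>M vec_borel e"
    using assms by (intro measurable_mult_mat_vec L2_vec_measurable)
  fix i assume i: "i < e"
  have "sq_int (\<lambda>\<omega>. A $$ (i, j) * X \<omega> $ j)" if "j < d" for j
    using L2_vec_index[OF X that] by (auto simp: power_mult_distrib)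
  then have "sq_int (\<lambda>\<omega>. \<Sum>j<d. A $$ (i, j) * X \<omega> $ j)" by (intro sq_int_sum) auto
  moreover have "(A *\<^sub>v X \<omega>) $ i = (\<Sum>j<d. A $$ (i, j) * X \<omega> $ j)" if "\<omega> \<in> space M" for \<omega>
    using index_mult_mat_vec_sum[OF A L2_vec_carrier[OF X that] i] .
  ultimately show "sq_int (\<lambda>\<omega>. (A *\<^sub>v X \<omega>) $ i)"
    using sq_int_cong[of "\<lambda>\<omega>. (A *\<^sub>v X \<omega>) $ i" "\<lambda>\<omega>. \<Sum>j<d. A $$ (i, j) * X \<omega> $ j"] by blast
qed

lemma integrable_linear_form:
  assumes X: "X \<in> L2_vec M M d"
  shows "integrable M (\<lambda>\<omega>. q \<bullet> X \<omega>)"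
    and "(\<integral>\<omega>. q \<bullet> X \<omega> \<partial>M) = q \<bullet> mean_vec M d X"
proof -
  have eq: "q \<bullet> X \<omega> = (\<Sum>i<d. q $ i * X \<omega> $ i)" if "\<omega> \<in> space M" for \<omega>
    using scalar_prod_sum[OF L2_vec_carrier[OF X that]] .
  have i: "integrable M (\<lambda>\<omega>. q $ i * X \<omega> $ i)" if "i < d" for i
    using sq_int_integrable[OF L2_vec_index[OF X that]] by simp
  have "integrable M (\<lambda>\<omega>. \<Sum>i<d. q $ i * X \<omega> $ i)" using i by auto
  then show "integrable M (\<lambda>\<omega>. q \<bullet> X \<omega>)"
    using Bochner_Integration.integrable_cong[OF refl eq, of M] by simp
  have "(\<integral>\<omega>. q \<bullet> X \<omega> \<partial>M) = (\<integral>\<omega>. (\<Sum>i<d. q $ i * X \<omega> $ i) \<partial>M)"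
    by (intro Bochner_Integration.integral_cong refl eq)
  also have "\<dots> = (\<Sum>i<d. q $ i * (\<integral>\<omega>. X \<omega> $ i \<partial>M))"
    using i by (simp add: Bochner_Integration.integral_sum)
  also have "\<dots> = q \<bullet> mean_vec M d X"
    by (subst scalar_prod_sum[of _ d]) (auto simp: mean_vec_def)
  finally show "(\<integral>\<omega>. q \<bullet> X \<omega> \<partial>M) = q \<bullet> mean_vec M d X" .
qed

lemma integrable_bilinear_form:
  assumes X: "X \<in> L2_vec M M d" and Y: "Y \<in> L2_vec M M e" and A: "A \<in> carrier_mat d e"
  shows "integrable M (\<lambda>\<omega>. X \<omega> \<bullet> (A *\<^sub>v Y \<omega>))"
    and "(\<integral>\<omega>. X \<omega> \<bullet> (A *\<^sub>v Y \<omega>) \<partial>M) = (\<Sum>i<d. \<Sum>j<e. A $$ (i, j) * (\<integral>\<omega>. X \<omega> $ i * Y \<omega> $ j \<partial>M))"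
proof -
  have eq: "X \<omega> \<bullet> (A *\<^sub>v Y \<omega>) = (\<Sum>i<d. \<Sum>j<e. A $$ (i, j) * (X \<omega> $ i * Y \<omega> $ j))"
    if "\<omega> \<in> space M" for \<omega>
    using bilinear_form_sum[OF A L2_vec_carrier[OF Y that]] .
  have i: "integrable M (\<lambda>\<omega>. A $$ (i, j) * (X \<omega> $ i * Y \<omega> $ j))" if "i < d" "j < e" for i j
    using sq_int_mult[OF L2_vec_index[OF X that(1)] L2_vec_index[OF Y that(2)]] by simp
  have "integrable M (\<lambda>\<omega>. \<Sum>i<d. \<Sum>j<e. A $$ (i, j) * (X \<omega> $ i * Y \<omega> $ j))"
    by (intro Bochner_Integration.integrable_sum i) auto
  then show "integrable M (\<lambda>\<omega>. X \<omega> \<bullet> (A *\<^sub>v Y \<omega>))"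
    using Bochner_Integration.integrable_cong[OF refl eq, of M] by simp
  have "(\<integral>\<omega>. X \<omega> \<bullet> (A *\<^sub>v Y \<omega>) \<partial>M)
      = (\<integral>\<omega>. (\<Sum>i<d. \<Sum>j<e. A $$ (i, j) * (X \<omega> $ i * Y \<omega> $ j)) \<partial>M)"
    by (intro Bochner_Integration.integral_cong refl eq)
  also have "\<dots> = (\<Sum>i<d. \<Sum>j<e. (\<integral>\<omega>. A $$ (i, j) * (X \<omega> $ i * Y \<omega> $ j) \<partial>M))"
    using i by (subst Bochner_Integration.integral_sum) (auto intro!: sum.cong Bochner_Integration.integral_sum)
  finally show "(\<integral>\<omega>. X \<omega> \<bullet> (A *\<^sub>v Y \<omega>) \<partial>M) = (\<Sum>i<d. \<Sum>j<e. A $$ (i, j) * (\<integral>\<omega>. X \<omega> $ i * Y \<omega> $ j \<partial>M))"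
    by simp
qed

section \<open>Second moments and expectations of quadratic functions\<close>

definition second_moment :: "nat \<Rightarrow> ('a \<Rightarrow> real vec) \<Rightarrow> real mat" where
  "second_moment d X = mat d d (\<lambda>(i, j). \<integral>\<omega>. X \<omega> $ i * X \<omega> $ j \<partial>M)"

text \<open>The moment matrix is uncentred, so no mean has to be subtracted. Exchanging the two sums
  brings the entries into the order of a matrix product, whose diagonal the trace adds up.\<close>

lemma integral_quadratic_form:
  assumes X: "X \<in> L2_vec M M d" and A: "A \<in> carrier_mat d d"
  shows "(\<integral>\<omega>. X \<omega> \<bullet> (A *\<^sub>v X \<omega>) \<partial>M) = mat_trace (second_moment d X * A)"
proof -
  have "(\<integral>\<omega>. X \<omega> \<bullet> (A *\<^sub>v X \<omega>) \<partial>M) = (\<Sum>i<d. \<Sum>j<d. A $$ (i, j) * second_moment d X $$ (j, i))"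
    unfolding integrable_bilinear_form(2)[OF X X A]
    by (intro sum.cong refl) (auto simp: second_moment_def mult.commute)
  also have "\<dots> = (\<Sum>j<d. \<Sum>i<d. A $$ (i, j) * second_moment d X $$ (j, i))"
    by (rule sum.swap)
  also have "\<dots> = mat_trace (second_moment d X * A)"
    using A by (auto simp: mat_trace_def second_moment_def scalar_prod_def lessThan_atLeast0 intro!: sum.cong)
  finally show ?thesis .
qed

text \<open>Expanding the quadratic around \<open>a\<close> gives a cross term linear in both
  \<open>w\<close> and \<open>a\<close>. Uncorrelatedness replaces \<open>w\<close> there by its
  mean, so the cross term joins the linear term as 2 P C wb; the terms in \<open>w\<close> alone
  become the trace and the pairing of \<open>q\<close> with C wb.\<close>

theorem expectation_quadratic_shift:
  assumes P: "P \<in> carrier_mat e e" "transpose_mat P = P" and q: "q \<in> carrier_vec e"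
    and C: "C \<in> carrier_mat e n" and a: "a \<in> L2_vec M M e" and w: "w \<in> L2_vec M M n"
    and uncorr: "\<And>i j. i < n \<Longrightarrow> j < e \<Longrightarrow>
      (\<integral>\<omega>. w \<omega> $ i * a \<omega> $ j \<partial>M) = (\<integral>\<omega>. w \<omega> $ i \<partial>M) * (\<integral>\<omega>. a \<omega> $ j \<partial>M)"
  defines "b \<equiv> \<lambda>\<omega>. a \<omega> + C *\<^sub>v w \<omega>" and "wb \<equiv> mean_vec M n w"
  shows "integrable M (\<lambda>\<omega>. b \<omega> \<bullet> (P *\<^sub>v b \<omega>) + q \<bullet> b \<omega> + r)"
    and "(\<integral>\<omega>. b \<omega> \<bullet> (P *\<^sub>v b \<omega>) + q \<bullet> b \<omega> + r \<partial>M)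
      = (\<integral>\<omega>. a \<omega> \<bullet> (P *\<^sub>v a \<omega>) + (q + 2 \<cdot>\<^sub>v (P *\<^sub>v (C *\<^sub>v wb))) \<bullet> a \<omega> \<partial>M)
        + (r + mat_trace (second_moment n w * (transpose_mat C * P * C)) + q \<bullet> (C *\<^sub>v wb))"
proof -
  have Cw: "(\<lambda>\<omega>. C *\<^sub>v w \<omega>) \<in> L2_vec M M e" by (rule L2_vec_mult_mat[OF C w])
  have b: "b \<in> L2_vec M M e" unfolding b_def by (rule L2_vec_add[OF a Cw])
  have wb: "wb \<in> carrier_vec n" by (simp add: wb_def mean_vec_def)
  let ?D = "transpose_mat C * P"
  have D: "?D \<in> carrier_mat n e" using C P by simp
  have DC: "transpose_mat C * P * C \<in> carrier_mat n n" using C P by simp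
  note int = integrable_bilinear_form(1)[OF a a P(1)] integrable_bilinear_form(1)[OF b b P(1)]
    integrable_linear_form(1)[OF a] integrable_linear_form(1)[OF b]
    integrable_bilinear_form(1)[OF w a D] integrable_bilinear_form(1)[OF w w DC]
    integrable_linear_form(1)[OF w]
  show "integrable M (\<lambda>\<omega>. b \<omega> \<bullet> (P *\<^sub>v b \<omega>) + q \<bullet> b \<omega> + r)" using int by auto
  have qC: "q \<bullet> (C *\<^sub>v v) = (transpose_mat C *\<^sub>v q) \<bullet> v" if "v \<in> carrier_vec n" for v
    using transpose_vec_mult_scalar[OF C that q] by simp
  have CP: "(C *\<^sub>v v) \<bullet> (P *\<^sub>v x) = v \<bullet> (?D *\<^sub>v x)" if "v \<in> carrier_vec n" "x \<in> carrier_vec e" for v x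
    using transpose_scalar_prod[OF C that(1), of "P *\<^sub>v x"] P C that
    by (simp add: assoc_mult_mat_vec[of _ n e])
  have pt: "b \<omega> \<bullet> (P *\<^sub>v b \<omega>) + q \<bullet> b \<omega> + r
      = (a \<omega> \<bullet> (P *\<^sub>v a \<omega>) + q \<bullet> a \<omega>) + 2 * (w \<omega> \<bullet> (?D *\<^sub>v a \<omega>))
        + (w \<omega> \<bullet> ((transpose_mat C * P * C) *\<^sub>v w \<omega>) + (transpose_mat C *\<^sub>v q) \<bullet> w \<omega> + r)"
    if "\<omega> \<in> space M" for \<omega>
  proof -
    have c: "a \<omega> \<in> carrier_vec e" "w \<omega> \<in> carrier_vec n"
      using that a w by (auto intro: L2_vec_carrier)
    then have Cw: "C *\<^sub>v w \<omega> \<in> carrier_vec e" using C by simp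
    have "?D *\<^sub>v (C *\<^sub>v w \<omega>) = (transpose_mat C * P * C) *\<^sub>v w \<omega>"
      using D C c by (intro assoc_mult_mat_vec[symmetric, of _ n e _ n]) auto
    then show ?thesis
      unfolding b_def quadratic_form_add[OF P c(1) Cw] CP[OF c(2) c(1)] CP[OF c(2) Cw]
        scalar_prod_add_distrib[OF q c(1) Cw] qC[OF c(2)] by simp
  qed
  \<comment> \<open>The mean of \<open>a\<close> is only an intermediate: the factorised moment is
    folded back into the integral of a linear form in \<open>a\<close>, so that the right side is
    again the mean of a function of \<open>a\<close>.\<close>
  have cross: "(\<integral>\<omega>. w \<omega> \<bullet> (?D *\<^sub>v a \<omega>) \<partial>M) = (\<integral>\<omega>. (P *\<^sub>v (C *\<^sub>v wb)) \<bullet> a \<omega> \<partial>M)"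
  proof -
    have ma: "mean_vec M e a \<in> carrier_vec e" by (simp add: mean_vec_def)
    have "(\<integral>\<omega>. w \<omega> \<bullet> (?D *\<^sub>v a \<omega>) \<partial>M) = wb \<bullet> (?D *\<^sub>v mean_vec M e a)"
      unfolding integrable_bilinear_form(2)[OF w a D] bilinear_form_sum[OF D ma]
      by (intro sum.cong refl) (auto simp: uncorr wb_def mean_vec_def)
    also have "\<dots> = (C *\<^sub>v wb) \<bullet> (P *\<^sub>v mean_vec M e a)" by (rule CP[symmetric, OF wb ma])
    also have "\<dots> = mean_vec M e a \<bullet> (P *\<^sub>v (C *\<^sub>v wb))"
      using C wb ma by (intro symmetric_mat_scalar_prod_commute[OF P]) auto
    also have "\<dots> = (P *\<^sub>v (C *\<^sub>v wb)) \<bullet> mean_vec M e a"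
      using C wb ma P by (intro comm_scalar_prod[of _ e]) auto
    also have "\<dots> = (\<integral>\<omega>. (P *\<^sub>v (C *\<^sub>v wb)) \<bullet> a \<omega> \<partial>M)"
      by (rule integrable_linear_form(2)[OF a, symmetric])
    finally show ?thesis .
  qed
  have "(\<integral>\<omega>. b \<omega> \<bullet> (P *\<^sub>v b \<omega>) + q \<bullet> b \<omega> + r \<partial>M)
      = (\<integral>\<omega>. (a \<omega> \<bullet> (P *\<^sub>v a \<omega>) + q \<bullet> a \<omega>) + 2 * (w \<omega> \<bullet> (?D *\<^sub>v a \<omega>))
        + (w \<omega> \<bullet> ((transpose_mat C * P * C) *\<^sub>v w \<omega>) + (transpose_mat C *\<^sub>v q) \<bullet> w \<omega> + r) \<partial>M)"
    by (intro Bochner_Integration.integral_cong refl pt)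
  also have "\<dots> = (\<integral>\<omega>. a \<omega> \<bullet> (P *\<^sub>v a \<omega>) \<partial>M) + (\<integral>\<omega>. q \<bullet> a \<omega> \<partial>M) + 2 * (\<integral>\<omega>. w \<omega> \<bullet> (?D *\<^sub>v a \<omega>) \<partial>M)
        + (mat_trace (second_moment n w * (transpose_mat C * P * C)) + q \<bullet> (C *\<^sub>v wb) + r)"
    using int integral_quadratic_form[OF w DC] integrable_linear_form(2)[OF w] qC[OF wb]
    by (simp add: prob_space wb_def)
  also have "(\<integral>\<omega>. a \<omega> \<bullet> (P *\<^sub>v a \<omega>) \<partial>M) + (\<integral>\<omega>. q \<bullet> a \<omega> \<partial>M) + 2 * (\<integral>\<omega>. w \<omega> \<bullet> (?D *\<^sub>v a \<omega>) \<partial>M)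
    = (\<integral>\<omega>. a \<omega> \<bullet> (P *\<^sub>v a \<omega>) + (q \<bullet> a \<omega> + 2 * ((P *\<^sub>v (C *\<^sub>v wb)) \<bullet> a \<omega>)) \<partial>M)"
    unfolding cross using int by simp
  also have "\<dots> = (\<integral>\<omega>. a \<omega> \<bullet> (P *\<^sub>v a \<omega>) + (q + 2 \<cdot>\<^sub>v (P *\<^sub>v (C *\<^sub>v wb))) \<bullet> a \<omega> \<partial>M)"
  proof (intro Bochner_Integration.integral_cong refl)
    fix \<omega> assume "\<omega> \<in> space M"
    then have "a \<omega> \<in> carrier_vec e" using a by (auto intro: L2_vec_carrier)
    moreover have "P *\<^sub>v (C *\<^sub>v wb) \<in> carrier_vec e" using P C wb by auto
    ultimately show "a \<omega> \<bullet> (P *\<^sub>v a \<omega>) + (q \<bullet> a \<omega> + 2 * ((P *\<^sub>v (C *\<^sub>v wb)) \<bullet> a \<omega>))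
      = a \<omega> \<bullet> (P *\<^sub>v a \<omega>) + (q + 2 \<cdot>\<^sub>v (P *\<^sub>v (C *\<^sub>v wb))) \<bullet> a \<omega>"
      using q by (simp add: add_scalar_prod_distrib[of _ e])
  qed
  finally show "(\<integral>\<omega>. b \<omega> \<bullet> (P *\<^sub>v b \<omega>) + q \<bullet> b \<omega> + r \<partial>M)
      = (\<integral>\<omega>. a \<omega> \<bullet> (P *\<^sub>v a \<omega>) + (q + 2 \<cdot>\<^sub>v (P *\<^sub>v (C *\<^sub>v wb))) \<bullet> a \<omega> \<partial>M)
        + (r + mat_trace (second_moment n w * (transpose_mat C * P * C)) + q \<bullet> (C *\<^sub>v wb))"
    by simp
qed

text \<open>Stated for functions measurable with respect to the generated sigma-algebras rather than
  for compositions with \<open>X\<close> and \<open>Y\<close>: a vector determined by the past is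
  then covered without being factored through the past.\<close>

lemma indep_var_vimage_algebra:
  assumes XY: "indep_var S X T Y"
    and f: "f \<in> vimage_algebra (space M) X S \<rightarrow>\<^sub>M S'"
    and g: "g \<in> vimage_algebra (space M) Y T \<rightarrow>\<^sub>M T'"
  shows "indep_var S' f T' g"
proof -
  have sub: "sigma_sets (space M) {h -` A \<inter> space M |A. A \<in> sets N'} \<subseteq>
      sigma_sets (space M) {Z -` A \<inter> space M |A. A \<in> sets N}"
    if "h \<in> vimage_algebra (space M) Z N \<rightarrow>\<^sub>M N'" for h Z N N'
  proof -
    have "{h -` A \<inter> space M |A. A \<in> sets N'} \<subseteq> sets (vimage_algebra (space M) Z N)"
      using measurable_sets[OF that] by auto
    from sets.sigma_sets_subset[OF this] show ?thesis by (simp add: sets_vimage_algebra)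
  qed
  have meas: "h \<in> M \<rightarrow>\<^sub>M N'" if "h \<in> vimage_algebra (space M) Z N \<rightarrow>\<^sub>M N'" "Z \<in> M \<rightarrow>\<^sub>M N" for h Z N N'
    using that(1) sets_image_in_sets[OF refl that(2)] by (auto simp: measurable_def)
  have "indep_set (sigma_sets (space M) {f -` A \<inter> space M |A. A \<in> sets S'})
     (sigma_sets (space M) {g -` A \<inter> space M |A. A \<in> sets T'})"
    using XY[unfolded indep_var_eq, THEN conjunct2] unfolding indep_set_def
    by (rule indep_sets_mono_sets) (use sub[OF f] sub[OF g] in \<open>auto split: bool.split\<close>)
  then show ?thesis using XY f g meas by (auto simp: indep_var_eq)
qed

end

section \<open>The augmented system\<close>

lemma append_cols_carrier:
  "M \<in> carrier_mat e d1 \<Longrightarrow> L \<in> carrier_mat e d2 \<Longrightarrow> M @\<^sub>c L \<in> carrier_mat e (d1 + d2)"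
  by (simp add: append_cols_def)

lemma append_cols_zero_mult:
  fixes M :: "real mat"
  assumes M: "M \<in> carrier_mat e d1" and v: "v \<in> carrier_vec (d1 + d2)"
  shows "(M @\<^sub>c 0\<^sub>m e d2) *\<^sub>v v = M *\<^sub>v vec_first v d1"
proof (rule eq_vecI)
  show "dim_vec ((M @\<^sub>c 0\<^sub>m e d2) *\<^sub>v v) = dim_vec (M *\<^sub>v vec_first v d1)"
    using M append_cols_carrier[OF M zero_carrier_mat[of e d2]] by auto
  fix i assume "i < dim_vec (M *\<^sub>v vec_first v d1)"
  then have i: "i < e" using M by simp
  have ent: "(M @\<^sub>c 0\<^sub>m e d2) $$ (i, j) = (if j < d1 then M $$ (i, j) else 0)" if "j < d1 + d2" for j
    using M i that by (auto simp: append_cols_def append_rows_def)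
  have "((M @\<^sub>c 0\<^sub>m e d2) *\<^sub>v v) $ i = (\<Sum>j<d1 + d2. (if j < d1 then M $$ (i, j) else 0) * v $ j)"
    by (subst index_mult_mat_vec_sum[OF append_cols_carrier[OF M zero_carrier_mat] v i])
      (auto simp: ent intro!: sum.cong)
  also have "\<dots> = (\<Sum>j<d1. M $$ (i, j) * v $ j)"
    by (rule sum.mono_neutral_cong_right) auto
  also have "\<dots> = (M *\<^sub>v vec_first v d1) $ i"
    by (subst index_mult_mat_vec_sum[OF M _ i]) (auto simp: vec_first_def intro!: sum.cong)
  finally show "((M @\<^sub>c 0\<^sub>m e d2) *\<^sub>v v) $ i = (M *\<^sub>v vec_first v d1) $ i" .
qed

text \<open>\<open>case_nat\<close> puts \<open>x_init\<close> at index 0 and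
  \<open>noise S t\<close> at index \<open>Suc t\<close>, so the index set \<open>{..hor S}\<close>
  is exactly the initial state and the \<open>hor S\<close> noise vectors.\<close>

locale lq_problem = prob_space "pr S" for S :: "'w lq_data" +
  fixes x0 :: "real vec"
  assumes nx_pos: "1 \<le> nx S" and hor_pos: "1 \<le> hor S"
    and sysA: "sysA S \<in> carrier_mat (nx S) (nx S)"
    and sysB: "sysB S \<in> carrier_mat (nx S) (nu S)"
    and wtQ_psd: "psd_mat (nx S * (mem S + 1)) (wtQ S)"
    and wtR_pd: "pd_mat (nu S) (wtR S)"
    and lam_nonneg: "0 \<le> lam S"
    and indep: "indep_vars (\<lambda>_. vec_borel (nx S)) (case_nat (x_init S) (noise S)) {..hor S}"
    and ident: "\<And>s t. s < hor S \<Longrightarrow> t < hor S \<Longrightarrow>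
           distr (pr S) (vec_borel (nx S)) (noise S s) = distr (pr S) (vec_borel (nx S)) (noise S t)"
    and fourth_moment: "\<And>t. t < hor S \<Longrightarrow> integrable (pr S) (\<lambda>\<omega>. (noise S t \<omega> \<bullet> noise S t \<omega>)\<^sup>2)"
    and x0: "x0 \<in> carrier_vec (nx S)" and x_init_AE: "AE \<omega> in pr S. x_init S \<omega> = x0"
begin

lemma naug_0: "naug S 0 = nx S" and naug_ge: "nx S \<le> naug S t"
  by (auto simp: naug_def mem_at_def)

lemma Arow_carrier: "Arow S t \<in> carrier_mat (nx S) (naug S t)"
  using sysA append_cols_carrier[OF sysA zero_carrier_mat[of "nx S" "nx S * mem_at S t"]]
  by (auto simp: Arow_def naug_def)

lemma Dshift_carrier: "Dshift S t \<in> carrier_mat (nx S * mem_at S (Suc t)) (naug S t)"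
  if "mem S \<noteq> 0"
proof (cases "mem S \<le> t")
  case True
  then show ?thesis
    using append_cols_carrier[OF one_carrier_mat zero_carrier_mat, of "nx S * mem S" "nx S"]
    by (auto simp: Dshift_def naug_def mem_at_def add.commute)
next
  case False
  then have "mem_at S t = t" "mem_at S (Suc t) = Suc t" by (auto simp: mem_at_def)
  then show ?thesis using False by (auto simp: Dshift_def naug_def)
qed

lemma naug_Suc: "naug S (Suc t) = nx S + nx S * mem_at S (Suc t)"
  by (simp add: naug_def)

lemma Aaug: "Aaug S t \<in> carrier_mat (naug S (Suc t)) (naug S t)"
  using sysA carrier_append_rows[OF Arow_carrier Dshift_carrier]
  by (auto simp: Aaug_def naug_Suc) (simp_all add: naug_def mem_at_def)

lemma Baug: "Baug S t \<in> carrier_mat (naug S (Suc t)) (nu S)"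
  using sysB carrier_append_rows[OF sysB zero_carrier_mat]
  by (auto simp: Baug_def naug_Suc) (simp_all add: mem_at_def)

lemma Caug: "Caug S t \<in> carrier_mat (naug S (Suc t)) (nx S)"
  using carrier_append_rows[OF one_carrier_mat zero_carrier_mat]
  by (auto simp: Caug_def naug_Suc) (simp_all add: mem_at_def)

lemma aug_dyn_carrier:
  "\<eta> \<in> carrier_vec (naug S t) \<Longrightarrow> v \<in> carrier_vec (nu S) \<Longrightarrow> w \<in> carrier_vec (nx S) \<Longrightarrow>
    aug_dyn S t \<eta> v w \<in> carrier_vec (naug S (Suc t))"
  using Aaug[of t] Baug[of t] Caug[of t] by (auto simp: aug_dyn_def)

lemma aug_dyn_mem0:
  assumes "mem S = 0" "w \<in> carrier_vec (nx S)"
  shows "aug_dyn S t \<eta> v w = sysA S *\<^sub>v \<eta> + sysB S *\<^sub>v v + w"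
  using assms by (simp add: aug_dyn_def Aaug_def Baug_def Caug_def)

text \<open>The new state is put on top of the leading \<open>mem_at S (Suc t)\<close> blocks of
  \<eta>. While the memory is filling, these are all the blocks of \<eta>; once it is full, the
  oldest block drops out. Both cases of \<open>Dshift\<close> are thus one truncation.\<close>

lemma aug_dyn_append:
  assumes "mem S \<noteq> 0" "\<eta> \<in> carrier_vec (naug S t)" "v \<in> carrier_vec (nu S)" "w \<in> carrier_vec (nx S)"
  shows "aug_dyn S t \<eta> v w =
    (sysA S *\<^sub>v vec_first \<eta> (nx S) + sysB S *\<^sub>v v + w) @\<^sub>v vec_first \<eta> (nx S * mem_at S (Suc t))"
proof -
  let ?k = "nx S * mem_at S (Suc t)"
  have A: "Arow S t *\<^sub>v \<eta> = sysA S *\<^sub>v vec_first \<eta> (nx S)"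
  proof (cases "mem_at S t \<ge> 1")
    case True
    then show ?thesis
      using append_cols_zero_mult[OF sysA, of \<eta> "nx S * mem_at S t"] assms(2)
      by (simp add: Arow_def naug_def)
  next
    case False
    then have "naug S t = nx S" by (simp add: naug_def)
    then have "vec_first \<eta> (nx S) = \<eta>" using assms(2) by (auto simp: vec_first_def intro!: eq_vecI)
    then show ?thesis using False by (simp add: Arow_def)
  qed
  have D: "Dshift S t *\<^sub>v \<eta> = vec_first \<eta> ?k"
  proof (cases "mem S \<le> t")
    case True
    then have k: "mem_at S (Suc t) = mem S" "mem_at S t = mem S" by (auto simp: mem_at_def)
    have "\<eta> \<in> carrier_vec (nx S * mem S + nx S)" using assms(2) k by (simp add: naug_def add.commute)
    from append_cols_zero_mult[OF one_carrier_mat this] show ?thesis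
      using True k by (simp add: Dshift_def)
  next
    case False
    then have k: "mem_at S (Suc t) = Suc t" "mem_at S t = t" by (auto simp: mem_at_def)
    then have "\<eta> \<in> carrier_vec (nx S * Suc t)" using assms(2) by (simp add: naug_def)
    then have "vec_first \<eta> ?k = \<eta>" "1\<^sub>m (nx S * Suc t) *\<^sub>v \<eta> = \<eta>"
      using k by (auto simp: vec_first_def intro!: eq_vecI)
    then show ?thesis using False by (simp add: Dshift_def)
  qed
  have "Aaug S t *\<^sub>v \<eta> = (sysA S *\<^sub>v vec_first \<eta> (nx S)) @\<^sub>v vec_first \<eta> ?k"
    using assms(1) mat_mult_append[OF Arow_carrier Dshift_carrier[OF assms(1)] assms(2)]
    by (simp add: Aaug_def A D)
  moreover have "0\<^sub>m ?k (nu S) *\<^sub>v v = 0\<^sub>v ?k" "0\<^sub>m ?k (nx S) *\<^sub>v w = 0\<^sub>v ?k"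
    using assms(3,4) by (auto intro!: eq_vecI)
  moreover from this have "Baug S t *\<^sub>v v = (sysB S *\<^sub>v v) @\<^sub>v 0\<^sub>v ?k"
    using assms(1) mat_mult_append[OF sysB zero_carrier_mat assms(3), of ?k] assms(3)
    by (simp add: Baug_def)
  moreover from calculation have "Caug S t *\<^sub>v w = w @\<^sub>v 0\<^sub>v ?k"
    using assms(1) mat_mult_append[OF one_carrier_mat zero_carrier_mat assms(4), of ?k] assms(4)
    by (simp add: Caug_def)
  ultimately show ?thesis
    unfolding aug_dyn_def using sysA sysB assms by (intro eq_vecI) auto
qed

text \<open>A pointwise identity for each outcome at which the data have the right dimensions; it
  lets the two descriptions of the state be exchanged inside integrals and measurability
  statements.\<close>

lemma stacked_state_eq_aug_state:
  assumes x: "x_init S \<omega> \<in> carrier_vec (nx S)"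
    and w: "\<And>s. s < t \<Longrightarrow> noise S s \<omega> \<in> carrier_vec (nx S)"
    and u: "\<And>s. s < t \<Longrightarrow> u s \<omega> \<in> carrier_vec (nu S)"
  shows "stacked_state S u t \<omega> = aug_state S u t \<omega>"
  using w u
proof (induction t)
  case 0
  show ?case using x by (auto simp: stacked_state_def naug_0 intro!: eq_vecI)
next
  case (Suc t)
  have n: "0 < nx S" using nx_pos by simp
  note w' = Suc.prems(1)
  have st: "state S u s \<omega> \<in> carrier_vec (nx S)" if "s \<le> Suc t" for s
    using that
  proof (induction s)
    case 0 show ?case using x by simp
  next
    case (Suc s)
    then have "noise S s \<omega> \<in> carrier_vec (nx S)" using w' by simp
    then show ?case by (intro carrier_vecI) simp
  qed
  let ?\<eta> = "stacked_state S u t \<omega>"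
  have IH: "aug_state S u t \<omega> = ?\<eta>" using Suc by simp
  have \<eta>: "?\<eta> \<in> carrier_vec (naug S t)" by (simp add: stacked_state_def)
  have ut: "u t \<omega> \<in> carrier_vec (nu S)" and wt: "noise S t \<omega> \<in> carrier_vec (nx S)"
    using Suc.prems by auto
  have first: "vec_first ?\<eta> (nx S) = state S u t \<omega>"
    using st[of t] naug_ge[of t] by (auto simp: vec_first_def stacked_state_def intro!: eq_vecI)
  show ?case
  proof (cases "mem S = 0")
    case True
    then have k: "naug S t = nx S" "naug S (Suc t) = nx S" by (auto simp: naug_def mem_at_def)
    have "vec_first ?\<eta> (nx S) = ?\<eta>" using \<eta> k by (intro eq_vecI) (auto simp: vec_first_def)
    with first have "?\<eta> = state S u t \<omega>" by simp
    moreover have "stacked_state S u (Suc t) \<omega> = state S u (Suc t) \<omega>"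
      using carrier_vecD[OF st[of "Suc t"]] k
      by (auto simp: stacked_state_def simp del: state.simps intro!: eq_vecI)
    ultimately show ?thesis using aug_dyn_mem0[OF True wt] IH by simp
  next
    case False
    let ?k = "nx S * mem_at S (Suc t)"
    \<comment> \<open>The memory grows by at most one block per step, so the retained blocks are all
      present in the previous augmented state.\<close>
    have kn: "?k \<le> naug S t" by (simp add: naug_def mem_at_def)
      (metis Suc_eq_plus1 mult_Suc_right mult_le_mono2 min_le_iff_disj min_Suc_Suc le_SucI order_refl min.bounded_iff min.mono)
    have dim: "dim_vec (state S u (Suc t) \<omega>) = nx S" by (rule carrier_vecD[OF st[OF order_refl]])
    have "stacked_state S u (Suc t) \<omega> = state S u (Suc t) \<omega> @\<^sub>v vec_first ?\<eta> ?k"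
    proof (rule eq_vecI)
      show "dim_vec (stacked_state S u (Suc t) \<omega>) = dim_vec (state S u (Suc t) \<omega> @\<^sub>v vec_first ?\<eta> ?k)"
        using dim by (simp add: stacked_state_def naug_Suc del: state.simps)
      fix a assume "a < dim_vec (state S u (Suc t) \<omega> @\<^sub>v vec_first ?\<eta> ?k)"
      then have a: "a < nx S + ?k" using dim by (simp del: state.simps)
      show "stacked_state S u (Suc t) \<omega> $ a = (state S u (Suc t) \<omega> @\<^sub>v vec_first ?\<eta> ?k) $ a"
      proof (cases "a < nx S")
        case True
        then show ?thesis using a dim by (simp add: stacked_state_def naug_Suc del: state.simps)
      next
        case False
        then obtain b where b: "a = nx S + b" by (metis le_iff_add not_less)
        \<comment> \<open>Position \<open>nx S + b\<close> lies one block after position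
          \<open>b\<close>; this shift compensates the advance from \<open>t\<close> to
          \<open>Suc t\<close>, so both refer to the state at time
          \<open>t - b div nx S\<close>.\<close>
        have "a div nx S = Suc (b div nx S)" "a mod nx S = b mod nx S"
          unfolding b using n by auto
        then show ?thesis using a dim b kn
          by (simp add: stacked_state_def naug_Suc vec_first_def del: state.simps)
      qed
    qed
    then show ?thesis using aug_dyn_append[OF False \<eta> ut wt] first IH by simp
  qed
qed

section \<open>Noise statistics\<close>

lemma noise_measurable: "t < hor S \<Longrightarrow> noise S t \<in> pr S \<rightarrow>\<^sub>M vec_borel (nx S)"
  and x_init_measurable: "x_init S \<in> pr S \<rightarrow>\<^sub>M vec_borel (nx S)"
proof -
  have rv: "i \<le> hor S \<Longrightarrow> case_nat (x_init S) (noise S) i \<in> pr S \<rightarrow>\<^sub>M vec_borel (nx S)" for i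
    using indep by (auto simp: indep_vars_def)
  show "t < hor S \<Longrightarrow> noise S t \<in> pr S \<rightarrow>\<^sub>M vec_borel (nx S)" using rv[of "Suc t"] by simp
  show "x_init S \<in> pr S \<rightarrow>\<^sub>M vec_borel (nx S)" using rv[of 0] by simp
qed

text \<open>The fourth moment is the second moment of the squared norm, and on a probability space
  square integrability implies integrability.\<close>

lemma noise_L2:
  assumes t: "t < hor S" shows "noise S t \<in> L2_vec (pr S) (pr S) (nx S)"
proof -
  let ?f = "\<lambda>\<omega>. noise S t \<omega> \<bullet> noise S t \<omega>"
  have "(\<lambda>\<omega>. \<Sum>i<nx S. noise S t \<omega> $ i * noise S t \<omega> $ i) \<in> borel_measurable (pr S)"
    using measurable_vec_borel_index[OF noise_measurable[OF t]] by auto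
  then have "?f \<in> borel_measurable (pr S)"
    by (rule measurable_cong[THEN iffD1, rotated])
      (auto intro!: scalar_prod_sum[symmetric] measurable_vec_borel_carrier[OF noise_measurable[OF t]])
  then have "integrable (pr S) ?f"
    using fourth_moment[OF t] by (intro sq_int_integrable) auto
  then show ?thesis using noise_measurable[OF t] by (simp add: L2_vec_def)
qed

text \<open>Equality in law becomes equality of expectations; hence statistics computed at time 0
  are valid at every stage.\<close>

lemma noise_expectation:
  assumes "s < hor S" "t < hor S" "f \<in> vec_borel (nx S) \<rightarrow>\<^sub>M (borel :: real measure)"
  shows "(\<integral>\<omega>. f (noise S s \<omega>) \<partial>pr S) = (\<integral>\<omega>. f (noise S t \<omega>) \<partial>pr S)"
  using integral_distr[OF noise_measurable[OF assms(1)] assms(3)]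
    integral_distr[OF noise_measurable[OF assms(2)] assms(3)] ident[OF assms(1,2)] by simp

lemma mean_noise: "t < hor S \<Longrightarrow> mean_vec (pr S) (nx S) (noise S t) = wbar S"
  using noise_expectation[of t 0, OF _ _ measurable_vec_index] hor_pos
  by (auto simp: wbar_def mean_vec_def)

text \<open>Second moment is covariance plus outer product of the mean. The stage-dependent moment
  that comes out of the expectation of \<open>V\<close> is thereby expressed by the fixed statistics
  of the recursion.\<close>

lemma second_moment_noise:
  assumes "t < hor S"
  shows "second_moment (nx S) (noise S t) = Sig S + mat (nx S) (nx S) (\<lambda>(i, j). wbar S $ i * wbar S $ j)"
proof (rule eq_matI)
  fix i j
  assume "i < dim_row (Sig S + mat (nx S) (nx S) (\<lambda>(i, j). wbar S $ i * wbar S $ j))"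
    "j < dim_col (Sig S + mat (nx S) (nx S) (\<lambda>(i, j). wbar S $ i * wbar S $ j))"
  then have ij: "i < nx S" "j < nx S" by auto
  have h: "0 < hor S" using hor_pos by simp
  let ?w = "\<lambda>i \<omega>. noise S 0 \<omega> $ i"
  have L2: "noise S 0 \<in> L2_vec (pr S) (pr S) (nx S)" by (rule noise_L2[OF h])
  have wb: "(\<integral>\<omega>. ?w i \<omega> \<partial>pr S) = wbar S $ i" if "i < nx S" for i
    using that by (simp add: wbar_def mean_vec_def)
  have int: "integrable (pr S) (?w i)" "integrable (pr S) (?w j)" "integrable (pr S) (\<lambda>\<omega>. ?w i \<omega> * ?w j \<omega>)"
    by (rule sq_int_integrable[OF L2_vec_index[OF L2 ij(1)]] sq_int_integrable[OF L2_vec_index[OF L2 ij(2)]]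
        sq_int_mult[OF L2_vec_index[OF L2 ij(1)] L2_vec_index[OF L2 ij(2)]])+
  have "Sig S $$ (i, j) = (\<integral>\<omega>. ?w i \<omega> * ?w j \<omega> - wbar S $ j * ?w i \<omega> - wbar S $ i * ?w j \<omega>
      + wbar S $ i * wbar S $ j \<partial>pr S)"
    using ij by (auto simp: Sig_def dev_def wbar_def mean_vec_def algebra_simps
        intro!: Bochner_Integration.integral_cong)
  also have "\<dots> = (\<integral>\<omega>. ?w i \<omega> * ?w j \<omega> \<partial>pr S) - wbar S $ i * wbar S $ j"
    using int wb ij prob_space by simp
  finally have "Sig S $$ (i, j) + wbar S $ i * wbar S $ j = (\<integral>\<omega>. ?w i \<omega> * ?w j \<omega> \<partial>pr S)" by simp
  also have "\<dots> = (\<integral>\<omega>. noise S t \<omega> $ i * noise S t \<omega> $ j \<partial>pr S)"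
    using ij by (intro noise_expectation[OF h assms, of "\<lambda>v. v $ i * v $ j"])
      (auto intro!: borel_measurable_times measurable_vec_index)
  finally show "second_moment (nx S) (noise S t) $$ (i, j)
    = (Sig S + mat (nx S) (nx S) (\<lambda>(i, j). wbar S $ i * wbar S $ j)) $$ (i, j)"
    using ij by (simp add: second_moment_def Sig_def)
qed (auto simp: second_moment_def Sig_def)

text \<open>The form of the covariance at \<open>v\<close> is the mean of the squared scalar product
  of the deviation with \<open>v\<close>.\<close>

lemma Sig_psd: "psd_mat (nx S) (Sig S)"
proof -
  have h: "0 < hor S" using hor_pos by simp
  have L2: "noise S 0 \<in> L2_vec (pr S) (pr S) (nx S)" by (rule noise_L2[OF h])
  have wb: "wbar S \<in> carrier_vec (nx S)" by (simp add: wbar_def mean_vec_def)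
  have dev: "dev S \<in> L2_vec (pr S) (pr S) (nx S)"
  proof -
    have "(\<lambda>\<omega>. noise S 0 \<omega> + - wbar S) \<in> L2_vec (pr S) (pr S) (nx S)"
      using wb by (intro L2_vec_add L2 L2_vec_const) auto
    moreover have "noise S 0 \<omega> + - wbar S = dev S \<omega>" for \<omega>
      by (auto simp: dev_def intro!: eq_vecI)
    ultimately show ?thesis by simp
  qed
  have c: "Sig S \<in> carrier_mat (nx S) (nx S)" by (simp add: Sig_def)
  have "0 \<le> v \<bullet> (Sig S *\<^sub>v v)" if v: "v \<in> carrier_vec (nx S)" for v
  proof -
    have int: "integrable (pr S) (\<lambda>\<omega>. dev S \<omega> $ i * dev S \<omega> $ j)" if "i < nx S" "j < nx S" for i j
      using L2_vec_index[OF dev] that by (intro sq_int_mult) auto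
    have "v \<bullet> (Sig S *\<^sub>v v) = (\<Sum>i<nx S. \<Sum>j<nx S. (\<integral>\<omega>. dev S \<omega> $ i * dev S \<omega> $ j * (v $ i * v $ j) \<partial>pr S))"
      unfolding bilinear_form_sum[OF c v] by (intro sum.cong refl) (auto simp: Sig_def)
    also have "\<dots> = (\<integral>\<omega>. (\<Sum>i<nx S. \<Sum>j<nx S. dev S \<omega> $ i * dev S \<omega> $ j * (v $ i * v $ j)) \<partial>pr S)"
      using int by (subst Bochner_Integration.integral_sum)
        (auto intro!: sum.cong Bochner_Integration.integral_sum[symmetric] Bochner_Integration.integrable_sum)
    also have "\<dots> = (\<integral>\<omega>. (\<Sum>i<nx S. dev S \<omega> $ i * v $ i)\<^sup>2 \<partial>pr S)"
      by (simp add: power2_eq_square sum_product mult.assoc mult.left_commute)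
    also have "\<dots> \<ge> 0" by (rule Bochner_Integration.integral_nonneg) simp
    finally show ?thesis .
  qed
  moreover have "transpose_mat (Sig S) = Sig S"
    by (rule eq_matI) (auto simp: Sig_def mult.commute)
  ultimately show ?thesis using c by (simp add: psd_mat_def)
qed

section \<open>Positive semidefiniteness of the state weights\<close>

lemma naug_le: "naug S t \<le> nx S * (mem S + 1)"
  by (simp add: naug_def mem_at_def)

lemma wtQ: "wtQ S \<in> carrier_mat (nx S * (mem S + 1)) (nx S * (mem S + 1))"
    "i < nx S * (mem S + 1) \<Longrightarrow> j < nx S * (mem S + 1) \<Longrightarrow> wtQ S $$ (i, j) = wtQ S $$ (j, i)"
proof -
  show c: "wtQ S \<in> carrier_mat (nx S * (mem S + 1)) (nx S * (mem S + 1))"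
    using wtQ_psd by (simp add: psd_mat_def)
  have "transpose_mat (wtQ S) = wtQ S" using wtQ_psd by (simp add: psd_mat_def)
  then show "i < nx S * (mem S + 1) \<Longrightarrow> j < nx S * (mem S + 1) \<Longrightarrow> wtQ S $$ (i, j) = wtQ S $$ (j, i)"
    using c index_transpose_mat(1)[of i "wtQ S" j] by auto
qed

lemma Qlead_psd: "psd_mat (naug S t) (Qlead S t)"
proof -
  let ?D = "nx S * (mem S + 1)" and ?d = "naug S t"
  have c: "Qlead S t \<in> carrier_mat ?d ?d" by (simp add: Qlead_def)
  have "transpose_mat (Qlead S t) = Qlead S t"
    using naug_le[of t] by (intro eq_matI) (auto simp: Qlead_def intro!: wtQ(2))
  moreover have "0 \<le> v \<bullet> (Qlead S t *\<^sub>v v)" if v: "v \<in> carrier_vec ?d" for v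
  proof -
    \<comment> \<open>A leading principal submatrix inherits positivity: padding the test vector by
      zeros evaluates the full form on it.\<close>
    define z where "z = vec ?D (\<lambda>i. if i < ?d then v $ i else 0)"
    have z: "z \<in> carrier_vec ?D" by (simp add: z_def)
    have "z \<bullet> (wtQ S *\<^sub>v z) = (\<Sum>i<?D. \<Sum>j<?D. wtQ S $$ (i, j) * (z $ i * z $ j))"
      by (rule bilinear_form_sum[OF wtQ(1) z])
    also have "\<dots> = (\<Sum>i<?D. \<Sum>j<?d. wtQ S $$ (i, j) * (z $ i * v $ j))"
      using naug_le[of t] by (intro sum.cong refl sum.mono_neutral_cong_right) (auto simp: z_def)
    also have "\<dots> = (\<Sum>i<?d. \<Sum>j<?d. wtQ S $$ (i, j) * (v $ i * v $ j))"
      using naug_le[of t] by (intro sum.mono_neutral_cong_right) (auto simp: z_def intro!: sum.neutral)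
    also have "\<dots> = v \<bullet> (Qlead S t *\<^sub>v v)"
      unfolding bilinear_form_sum[OF c v] by (intro sum.cong refl) (auto simp: Qlead_def)
    finally show ?thesis using wtQ_psd z by (auto simp: psd_mat_def)
  qed
  ultimately show ?thesis using c by (simp add: psd_mat_def)
qed

text \<open>\<^term>\<open>Hmat S t\<close> is four times the congruence of the noise covariance by the first block row
  of \<^term>\<open>wtQ S\<close>.\<close>
lemma Hmat_eq: "Hmat S t = 4 \<cdot>\<^sub>m (transpose_mat (mat (nx S) (naug S t) (\<lambda>(a, b). wtQ S $$ (a, b))) * Sig S
    * mat (nx S) (naug S t) (\<lambda>(a, b). wtQ S $$ (a, b)))"
proof (rule eq_matI)
  let ?L = "mat (nx S) (naug S t) (\<lambda>(a, b). wtQ S $$ (a, b))"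
  let ?R = "4 \<cdot>\<^sub>m (transpose_mat ?L * Sig S * ?L)"
  have S: "Sig S \<in> carrier_mat (nx S) (nx S)" by (simp add: Sig_def)
  have n: "0 < nx S" using nx_pos by simp
  show "dim_row (Hmat S t) = dim_row ?R" "dim_col (Hmat S t) = dim_col ?R"
    by (auto simp: Hmat_def block_mat_def naug_def)
  fix a b assume "a < dim_row ?R" "b < dim_col ?R"
  then have ab: "a < naug S t" "b < naug S t" by auto
  let ?i = "a div nx S" and ?j = "b div nx S"
  let ?X = "Qblk S ?i 0" and ?Y = "Qblk S 0 ?j"
  have XY: "?X \<in> carrier_mat (nx S) (nx S)" "?Y \<in> carrier_mat (nx S) (nx S)" by (auto simp: Qblk_def)
  have m: "a mod nx S < nx S" "b mod nx S < nx S" using n by auto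
  have "Hmat S t $$ (a, b) = 4 * (?X * Sig S * ?Y) $$ (a mod nx S, b mod nx S)"
    using ab m XY by (simp add: Hmat_def block_mat_def naug_def)
  also have "(?X * Sig S * ?Y) $$ (a mod nx S, b mod nx S) = (transpose_mat ?L * Sig S * ?L) $$ (a, b)"
  proof -
    \<comment> \<open>Entry symmetry of \<open>wtQ\<close> turns row a of the first block column
      into column a of the first block row.\<close>
    have r: "row ?X (a mod nx S) = col ?L a"
      using ab m naug_le[of t] n
      by (auto simp: Qblk_def intro!: eq_vecI wtQ(2))
    have c: "col ?Y (b mod nx S) = col ?L b"
      using ab m by (auto simp: Qblk_def intro!: eq_vecI)
    have "row (?X * Sig S) (a mod nx S) = row (transpose_mat ?L * Sig S) a"
      using ab m XY S r by (auto intro!: eq_vecI)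
    moreover have "(?X * Sig S * ?Y) $$ (a mod nx S, b mod nx S)
        = row (?X * Sig S) (a mod nx S) \<bullet> col ?Y (b mod nx S)"
      using m XY by (intro index_mult_mat(1)) auto
    moreover have "(transpose_mat ?L * Sig S * ?L) $$ (a, b) = row (transpose_mat ?L * Sig S) a \<bullet> col ?L b"
      using ab by (intro index_mult_mat(1)) auto
    ultimately show ?thesis using c by simp
  qed
  finally show "Hmat S t $$ (a, b) = ?R $$ (a, b)" using ab S by simp
qed

text \<open>A principal submatrix of the weight plus a nonnegative multiple of a congruence of the
  covariance. Positivity of every \<open>P t\<close> rests on this.\<close>

lemma Qlam_psd: "psd_mat (naug S t) (Qlam S t)"
  unfolding Qlam_def Hmat_eq
  by (intro psd_mat_add Qlead_psd psd_mat_smult psd_mat_congruence[OF Sig_psd] lam_nonneg) auto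

lemma zeta_carrier: "zeta S t \<in> carrier_vec (naug S t)"
  by (simp add: zeta_def block_mat_def naug_def carrier_vecI)

end

lemma (in prob_space) L2_vec_mono:
  assumes "sets F \<subseteq> sets M" "space F = space M"
  shows "L2_vec M F d \<subseteq> L2_vec M M d"
  using assms by (auto simp: L2_vec_def measurable_def)

lemma measurable_mono_sets:
  "X \<in> F \<rightarrow>\<^sub>M N \<Longrightarrow> sets F \<subseteq> sets G \<Longrightarrow> space F = space G \<Longrightarrow> X \<in> G \<rightarrow>\<^sub>M N"
  by (auto simp: measurable_def)

context lq_problem
begin

section \<open>Admissible controls\<close>

text \<open>For positive \<open>t\<close> the last index, \<open>t\<close>, stands for
  \<open>noise S (t - 1)\<close>, so \<open>{..t}\<close> stops just short of
  \<open>noise S t\<close>. No control enters, in contrast to the filtrations of the two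
  problems.\<close>

definition past :: "nat \<Rightarrow> 'w measure" where
  "past t = vimage_algebra (space (pr S))
     (\<lambda>\<omega>. restrict (\<lambda>i. case_nat (x_init S) (noise S) i \<omega>) {..t}) (PiM {..t} (\<lambda>_. vec_borel (nx S)))"

lemma space_past [simp]: "space (past t) = space (pr S)"
  by (simp add: past_def)

lemma past_component:
  assumes "t \<le> hor S" "i \<le> t"
  shows "case_nat (x_init S) (noise S) i \<in> past t \<rightarrow>\<^sub>M vec_borel (nx S)"
proof -
  let ?X = "case_nat (x_init S) (noise S)"
  have X: "j \<le> hor S \<Longrightarrow> ?X j \<in> pr S \<rightarrow>\<^sub>M vec_borel (nx S)" for j
    using noise_measurable x_init_measurable by (cases j) auto
  have "(\<lambda>\<omega>. restrict (\<lambda>i. ?X i \<omega>) {..t}) \<in> space (pr S) \<rightarrow> space (PiM {..t} (\<lambda>_. vec_borel (nx S)))"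
    using measurable_vec_borel_carrier[OF X] assms(1) by (auto simp: space_PiM)
  then have "(\<lambda>\<omega>. restrict (\<lambda>i. ?X i \<omega>) {..t}) \<in> past t \<rightarrow>\<^sub>M PiM {..t} (\<lambda>_. vec_borel (nx S))"
    unfolding past_def by (rule measurable_vimage_algebra1)
  from measurable_compose[OF this measurable_component_singleton[of i]] assms(2)
  show ?thesis by simp
qed

lemma x_init_past: "t \<le> hor S \<Longrightarrow> x_init S \<in> past t \<rightarrow>\<^sub>M vec_borel (nx S)"
  and noise_past: "t \<le> hor S \<Longrightarrow> s < t \<Longrightarrow> noise S s \<in> past t \<rightarrow>\<^sub>M vec_borel (nx S)"
  using past_component[of t 0] past_component[of t "Suc s"] by auto

text \<open>Minimality of the generated sigma-algebra; monotonicity in time and inclusion in the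
  underlying sigma-algebra are instances.\<close>

lemma past_le:
  assumes "t \<le> hor S" "space F = space (pr S)"
    and "\<And>i. i \<le> t \<Longrightarrow> case_nat (x_init S) (noise S) i \<in> F \<rightarrow>\<^sub>M vec_borel (nx S)"
  shows "sets (past t) \<subseteq> sets F"
  unfolding past_def using assms by (intro sets_image_in_sets measurable_restrict) auto

lemma past_mono: "s \<le> t \<Longrightarrow> t \<le> hor S \<Longrightarrow> sets (past s) \<subseteq> sets (past t)"
  by (rule past_le) (auto intro: past_component)

lemma past_sub: "t \<le> hor S \<Longrightarrow> sets (past t) \<subseteq> sets (pr S)"
  by (rule past_le) (use noise_measurable x_init_measurable in \<open>auto split: nat.split\<close>)

lemma L2_past: "t \<le> hor S \<Longrightarrow> X \<in> L2_vec (pr S) (past t) d \<Longrightarrow> X \<in> L2_vec (pr S) (pr S) d"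
  using L2_vec_mono[OF past_sub space_past] by auto

lemma past_measurable_mono:
  "X \<in> past s \<rightarrow>\<^sub>M N \<Longrightarrow> s \<le> t \<Longrightarrow> t \<le> hor S \<Longrightarrow> X \<in> past t \<rightarrow>\<^sub>M N"
  by (erule measurable_mono_sets[OF _ past_mono]) auto

text \<open>\<open>noise S t\<close> sits at index \<open>Suc t\<close>, outside
  \<open>{..t}\<close>, so the two restrictions of the family are independent; independence passes
  to the coordinate of \<open>a\<close>, which is measurable for the past.\<close>

lemma noise_uncorrelated:
  assumes t: "t < hor S" and a: "a \<in> L2_vec (pr S) (past t) e" and i: "i < nx S" and j: "j < e"
  shows "(\<integral>\<omega>. noise S t \<omega> $ i * a \<omega> $ j \<partial>pr S) = (\<integral>\<omega>. noise S t \<omega> $ i \<partial>pr S) * (\<integral>\<omega>. a \<omega> $ j \<partial>pr S)"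
proof -
  let ?X = "case_nat (x_init S) (noise S)" and ?N = "\<lambda>_::nat. vec_borel (nx S)"
  let ?Y = "\<lambda>\<omega>. restrict (\<lambda>i. ?X i \<omega>) {Suc t}"
  have iv: "indep_var (PiM {..t} ?N) (\<lambda>\<omega>. restrict (\<lambda>i. ?X i \<omega>) {..t}) (PiM {Suc t} ?N) ?Y"
    using t by (intro indep_var_restrict[OF indep]) auto
  have f: "(\<lambda>\<omega>. a \<omega> $ j) \<in> past t \<rightarrow>\<^sub>M borel"
    using a j by (intro measurable_vec_borel_index[of _ _ e]) (auto simp: L2_vec_def)
  have "?Y \<in> space (pr S) \<rightarrow> space (PiM {Suc t} ?N)"
    using measurable_vec_borel_carrier[OF noise_measurable[OF t]] by (auto simp: space_PiM)
  then have Y: "?Y \<in> vimage_algebra (space (pr S)) ?Y (PiM {Suc t} ?N) \<rightarrow>\<^sub>M PiM {Suc t} ?N"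
    by (rule measurable_vimage_algebra1)
  have "(\<lambda>y. y (Suc t) $ i) \<in> PiM {Suc t} ?N \<rightarrow>\<^sub>M borel"
    by (rule measurable_compose[OF measurable_component_singleton[of "Suc t" "{Suc t}" ?N]
        measurable_vec_index[OF i]]) simp
  from measurable_compose[OF Y this]
  have g: "(\<lambda>\<omega>. noise S t \<omega> $ i) \<in> vimage_algebra (space (pr S)) ?Y (PiM {Suc t} ?N) \<rightarrow>\<^sub>M borel"
    by simp
  have "indep_var borel (\<lambda>\<omega>. a \<omega> $ j) borel (\<lambda>\<omega>. noise S t \<omega> $ i)"
    by (rule indep_var_vimage_algebra[OF iv f[unfolded past_def] g])
  then have "(\<integral>\<omega>. a \<omega> $ j * noise S t \<omega> $ i \<partial>pr S) = (\<integral>\<omega>. a \<omega> $ j \<partial>pr S) * (\<integral>\<omega>. noise S t \<omega> $ i \<partial>pr S)"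
    using L2_vec_index[OF noise_L2[OF t] i] L2_vec_index[OF L2_past[OF less_imp_le[OF t] a] j]
    by (intro indep_var_lebesgue_integral sq_int_integrable) auto
  then show ?thesis by (simp add: mult.commute)
qed

text \<open>A common enlargement of both feasible sets: only square integrability and dependence on
  past exogenous randomness are retained. Lower bounds on the cost are proved here and hold for
  either problem.\<close>

definition admissible :: "(nat \<Rightarrow> 'w \<Rightarrow> real vec) \<Rightarrow> bool" where
  "admissible u \<longleftrightarrow> (\<forall>t<hor S. u t \<in> L2_vec (pr S) (past t) (nu S))"

text \<open>Only controls before \<open>t\<close> are assumed determined by the past, so the
  statement can be applied while this is still being established for \<open>u t\<close>
  itself.\<close>

lemma state_past:
  assumes "\<And>s. s < t \<Longrightarrow> u s \<in> past s \<rightarrow>\<^sub>M vec_borel (nu S)" "t \<le> hor S"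
  shows "state S u t \<in> past t \<rightarrow>\<^sub>M vec_borel (nx S)"
  using assms
proof (induction t)
  case 0
  have "state S u 0 = x_init S" by (rule ext) simp
  then show ?case using x_init_past[of 0] by simp
next
  case (Suc t)
  have eq: "state S u (Suc t) = (\<lambda>\<omega>. sysA S *\<^sub>v state S u t \<omega> + sysB S *\<^sub>v u t \<omega> + noise S t \<omega>)"
    by (rule ext) simp
  have "state S u t \<in> past (Suc t) \<rightarrow>\<^sub>M vec_borel (nx S)"
    using Suc.prems by (intro past_measurable_mono[OF Suc.IH]) auto
  moreover have "u t \<in> past (Suc t) \<rightarrow>\<^sub>M vec_borel (nu S)"
    using Suc.prems by (intro past_measurable_mono[OF Suc.prems(1)]) auto
  ultimately show ?case
    unfolding eq using Suc.prems(2)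
    by (intro measurable_vec_add measurable_mult_mat_vec[OF sysA] measurable_mult_mat_vec[OF sysB]
        noise_past) simp_all
qed

lemma aug_state_past:
  assumes "\<And>s. s < t \<Longrightarrow> u s \<in> past s \<rightarrow>\<^sub>M vec_borel (nu S)" "t \<le> hor S"
  shows "aug_state S u t \<in> past t \<rightarrow>\<^sub>M vec_borel (naug S t)"
  using assms
proof (induction t)
  case 0
  have "aug_state S u 0 = x_init S" by (rule ext) simp
  then show ?case using x_init_past[of 0] by (simp add: naug_0)
next
  case (Suc t)
  have eq: "aug_state S u (Suc t) = (\<lambda>\<omega>. Aaug S t *\<^sub>v aug_state S u t \<omega> + Baug S t *\<^sub>v u t \<omega> + Caug S t *\<^sub>v noise S t \<omega>)"
    by (rule ext) (simp add: aug_dyn_def)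
  have "aug_state S u t \<in> past (Suc t) \<rightarrow>\<^sub>M vec_borel (naug S t)"
    using Suc.prems by (intro past_measurable_mono[OF Suc.IH]) auto
  moreover have "u t \<in> past (Suc t) \<rightarrow>\<^sub>M vec_borel (nu S)"
    using Suc.prems by (intro past_measurable_mono[OF Suc.prems(1)]) auto
  ultimately show ?case
    unfolding eq using Suc.prems(2)
    by (intro measurable_vec_add measurable_mult_mat_vec[OF Aaug] measurable_mult_mat_vec[OF Baug]
        measurable_mult_mat_vec[OF Caug] noise_past) simp_all
qed

lemma x_init_L2: "x_init S \<in> L2_vec (pr S) (pr S) (nx S)"
  unfolding L2_vec_def
proof (intro CollectI conjI x_init_measurable)
  have "(\<lambda>\<omega>. \<Sum>i<nx S. x_init S \<omega> $ i * x_init S \<omega> $ i) \<in> borel_measurable (pr S)"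
    using measurable_vec_borel_index[OF x_init_measurable] by auto
  then have m: "(\<lambda>\<omega>. x_init S \<omega> \<bullet> x_init S \<omega>) \<in> borel_measurable (pr S)"
    by (rule measurable_cong[THEN iffD1, rotated])
      (auto intro!: scalar_prod_sum[symmetric] measurable_vec_borel_carrier[OF x_init_measurable])
  have "integrable (pr S) (\<lambda>\<omega>. x0 \<bullet> x0)" by simp
  then show "integrable (pr S) (\<lambda>\<omega>. x_init S \<omega> \<bullet> x_init S \<omega>)"
    by (rule integrable_cong_AE_imp[OF _ m]) (use x_init_AE in auto)
qed

lemma aug_state_L2:
  assumes "\<And>s. s < t \<Longrightarrow> u s \<in> L2_vec (pr S) (pr S) (nu S)" "t \<le> hor S"
  shows "aug_state S u t \<in> L2_vec (pr S) (pr S) (naug S t)"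
  using assms
proof (induction t)
  case 0
  have "aug_state S u 0 = x_init S" by (rule ext) simp
  then show ?case using x_init_L2 by (simp add: naug_0)
next
  case (Suc t)
  have eq: "aug_state S u (Suc t) = (\<lambda>\<omega>. Aaug S t *\<^sub>v aug_state S u t \<omega> + Baug S t *\<^sub>v u t \<omega> + Caug S t *\<^sub>v noise S t \<omega>)"
    by (rule ext) (simp add: aug_dyn_def)
  have "aug_state S u t \<in> L2_vec (pr S) (pr S) (naug S t)"
    using Suc.prems by (intro Suc.IH) auto
  moreover have "u t \<in> L2_vec (pr S) (pr S) (nu S)" "t < hor S" using Suc.prems by auto
  ultimately show ?case
    unfolding eq by (intro L2_vec_add L2_vec_mult_mat[OF Aaug] L2_vec_mult_mat[OF Baug]
      L2_vec_mult_mat[OF Caug] noise_L2)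
qed

lemma admissible_past: "admissible u \<Longrightarrow> s < hor S \<Longrightarrow> u s \<in> past s \<rightarrow>\<^sub>M vec_borel (nu S)"
  and admissible_L2: "admissible u \<Longrightarrow> s < hor S \<Longrightarrow> u s \<in> L2_vec (pr S) (pr S) (nu S)"
  using L2_past[of s "u s" "nu S"] by (auto simp: admissible_def L2_vec_def)

text \<open>A control generated by a history that is itself determined by the past noise is, by induction
  on time, determined by the past noise.\<close>
lemma admissible_if_history:
  assumes z: "\<And>t s. t < hor S \<Longrightarrow> (\<And>s. s < t \<Longrightarrow> u s \<in> past s \<rightarrow>\<^sub>M vec_borel (nu S)) \<Longrightarrow> s \<le> t \<Longrightarrow>
      z s \<in> past s \<rightarrow>\<^sub>M vec_borel (dz s)"
    and u: "\<And>t. t < hor S \<Longrightarrow>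
      u t \<in> L2_vec (pr S) (gen_sigma (pr S) ((\<Sum>s\<le>t. dz s) + t * nu S) (history z u t)) (nu S)"
  shows "admissible u"
proof -
  have "u t \<in> past t \<rightarrow>\<^sub>M vec_borel (nu S)" if "t < hor S" for t
    using that
  proof (induction t rule: less_induct)
    case (less t)
    have u_past: "u s \<in> past s \<rightarrow>\<^sub>M vec_borel (nu S)" if "s < t" for s
      using less that by simp
    have zp: "z s \<in> past t \<rightarrow>\<^sub>M vec_borel (dz s)" if "s \<le> t" for s
      by (rule past_measurable_mono[OF z[OF less.prems u_past that]]) (use that less.prems in auto)
    have up: "u s \<in> past t \<rightarrow>\<^sub>M vec_borel (nu S)" if "s < t" for s
      by (rule past_measurable_mono[OF u_past[OF that]]) (use that less.prems in auto)
    have "history z u t \<in> past t \<rightarrow>\<^sub>M vec_borel ((\<Sum>s\<le>t. dz s) + t * nu S)"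
      using zp up measurable_space[OF zp] measurable_space[OF up]
      by (subst measurable_history_iff) auto
    then have le: "sets (gen_sigma (pr S) ((\<Sum>s\<le>t. dz s) + t * nu S) (history z u t)) \<subseteq> sets (past t)"
      using space_past by (rule sets_gen_sigma_le)
    show ?case
      by (rule measurable_mono_sets[where F = "gen_sigma (pr S) ((\<Sum>s\<le>t. dz s) + t * nu S) (history z u t)" and G = "past t"])
        (use u[OF less.prems] le in \<open>auto simp: L2_vec_def gen_sigma_def\<close>)
  qed
  then show ?thesis using u by (auto simp: admissible_def L2_vec_def)
qed

text \<open>Writing the dimension as a sum of block sizes brings the original history under the
  statements with time-dependent blocks.\<close>

lemma filtF_eq: "filtF S u t = gen_sigma (pr S) ((\<Sum>s\<le>t. nx S) + t * nu S) (history (state S u) u t)"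
  by (simp add: filtF_def)

lemma feasible2_admissible: "u \<in> feasible2 S x0 \<Longrightarrow> admissible u"
  by (rule admissible_if_history[where z = "state S u" and dz = "\<lambda>_. nx S"])
    (auto simp: feasible2_def filtF_eq intro: state_past)

lemma feasible3_admissible: "u \<in> feasible3 S x0 \<Longrightarrow> admissible u"
  by (rule admissible_if_history[where z = "aug_state S u" and dz = "naug S"])
    (auto simp: feasible3_def filtG_def intro: aug_state_past)

lemma stacked_state_admissible:
  assumes "admissible u" "t \<le> hor S" "\<omega> \<in> space (pr S)"
  shows "stacked_state S u t \<omega> = aug_state S u t \<omega>"
proof (rule stacked_state_eq_aug_state)
  show "x_init S \<omega> \<in> carrier_vec (nx S)"
    by (rule measurable_vec_borel_carrier[OF x_init_measurable assms(3)])
  show "noise S s \<omega> \<in> carrier_vec (nx S)" if "s < t" for s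
    using that assms by (intro measurable_vec_borel_carrier[OF noise_measurable]) auto
  show "u s \<omega> \<in> carrier_vec (nu S)" if "s < t" for s
    using that assms by (intro L2_vec_carrier[OF admissible_L2]) auto
qed

lemma total_cost_stacked_state:
  assumes "admissible u"
  shows "total_cost S (stacked_state S u) u = total_cost S (aug_state S u) u"
  unfolding total_cost_def
  by (intro Bochner_Integration.integral_cong refl) (simp add: stacked_state_admissible[OF assms])

end

section \<open>Dynamic programming\<close>

text \<open>Sequences satisfying the recursion are assumed here and constructed only in the final
  proof. The constants of \<open>lq_step\<close> are used before its hypotheses are known, since
  positivity of \<open>P (Suc t)\<close> is a consequence of the recursion and not an assumption.
  \<open>s t\<close> is the linear coefficient after averaging the noise.\<close>

locale lq_solution = lq_problem S x0 for S :: "'w lq_data" and x0 +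
  fixes P :: "nat \<Rightarrow> real mat" and q :: "nat \<Rightarrow> real vec" and r :: "nat \<Rightarrow> real"
    and s :: "nat \<Rightarrow> real vec" and K :: "nat \<Rightarrow> real mat" and \<kappa> :: "nat \<Rightarrow> real vec"
  assumes P_hor: "P (hor S) = Qlam S (hor S)"
    and q_hor: "q (hor S) = lam S \<cdot>\<^sub>v zeta S (hor S)"
    and r_hor: "r (hor S) = 0"
    and s_def: "s t = q (Suc t) + 2 \<cdot>\<^sub>v (P (Suc t) *\<^sub>v (Caug S t *\<^sub>v wbar S))"
    and K_def: "K t = lq_step.feedback (Aaug S t) (Baug S t) (P (Suc t)) (wtR S)"
    and \<kappa>_def: "\<kappa> t = lq_step.offset (Baug S t) (P (Suc t)) (wtR S) (s t)"
    and P_rec: "t < hor S \<Longrightarrow>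
      P t = Qlam S t + lq_step.schur (Aaug S t) (Baug S t) (P (Suc t)) (wtR S)"
    and q_rec: "t < hor S \<Longrightarrow>
      q t = lam S \<cdot>\<^sub>v zeta S t + transpose_mat (Aaug S t + Baug S t * K t) *\<^sub>v s t"
    and r_rec: "t < hor S \<Longrightarrow> r t = r (Suc t)
      + mat_trace (second_moment (nx S) (noise S t) * (transpose_mat (Caug S t) * P (Suc t) * Caug S t))
      + q (Suc t) \<bullet> (Caug S t *\<^sub>v wbar S) - \<kappa> t \<bullet> (gain_mat S t (P (Suc t)) *\<^sub>v \<kappa> t)"
begin

lemma wbar_carrier: "wbar S \<in> carrier_vec (nx S)"
  by (simp add: wbar_def mean_vec_def)

lemma stepI:
  assumes "psd_mat (naug S (Suc t)) (P (Suc t))" "q (Suc t) \<in> carrier_vec (naug S (Suc t))"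
  shows "lq_step (naug S t) (naug S (Suc t)) (nu S) (Aaug S t) (Baug S t) (P (Suc t)) (wtR S) (s t)"
  using assms Caug[of t] wbar_carrier
  by unfold_locales (auto simp: Aaug Baug wtR_pd s_def psd_mat_def)

text \<open>Positivity of \<open>P (Suc t)\<close> and the dimension of \<open>q (Suc t)\<close> are
  what the step at \<open>t\<close> needs, and the step returns both at \<open>t\<close>; hence one
  joint induction, backward from the horizon.\<close>

lemma P_psd: "t \<le> hor S \<Longrightarrow> psd_mat (naug S t) (P t)"
  and q_carrier: "t \<le> hor S \<Longrightarrow> q t \<in> carrier_vec (naug S t)"
proof -
  have "psd_mat (naug S t) (P t) \<and> q t \<in> carrier_vec (naug S t)" if "t \<le> hor S"
    using that
  proof (induction t rule: inc_induct)
    case base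
    then show ?case using Qlam_psd zeta_carrier by (simp add: P_hor q_hor)
  next
    case (step t)
    interpret st: lq_step "naug S t" "naug S (Suc t)" "nu S" "Aaug S t" "Baug S t" "P (Suc t)" "wtR S" "s t"
      using step.IH by (intro stepI) auto
    have "K t \<in> carrier_mat (nu S) (naug S t)" using st.feedback by (simp add: K_def)
    then have "transpose_mat (Aaug S t + Baug S t * K t) *\<^sub>v s t \<in> carrier_vec (naug S t)"
      using Aaug Baug st.s
      by (intro mult_mat_vec_carrier[of _ _ "naug S (Suc t)"] transpose_carrier_mat[THEN iffD2]
          add_carrier_mat mult_carrier_mat)
    then show ?case
      using st.schur_psd Qlam_psd zeta_carrier step.hyps
      by (auto simp: P_rec q_rec intro!: psd_mat_add)
  qed
  then show "t \<le> hor S \<Longrightarrow> psd_mat (naug S t) (P t)" "t \<le> hor S \<Longrightarrow> q t \<in> carrier_vec (naug S t)"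
    by auto
qed

lemma step: "t < hor S \<Longrightarrow>
    lq_step (naug S t) (naug S (Suc t)) (nu S) (Aaug S t) (Baug S t) (P (Suc t)) (wtR S) (s t)"
  by (intro stepI P_psd q_carrier) auto

abbreviation "G t \<equiv> gain_mat S t (P (Suc t))"

lemma gain_eq: "t < hor S \<Longrightarrow> lq_step.gain (Baug S t) (P (Suc t)) (wtR S) = G t"
  using lq_step.gain_def[OF step] by (simp add: gain_mat_def)

lemma P_carrier: "t \<le> hor S \<Longrightarrow> P t \<in> carrier_mat (naug S t) (naug S t)"
  and P_sym: "t \<le> hor S \<Longrightarrow> transpose_mat (P t) = P t"
  using P_psd by (auto simp: psd_mat_def)

lemma K_carrier: "t < hor S \<Longrightarrow> K t \<in> carrier_mat (nu S) (naug S t)"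
  and \<kappa>_carrier: "t < hor S \<Longrightarrow> \<kappa> t \<in> carrier_vec (nu S)"
  and G_pd: "t < hor S \<Longrightarrow> pd_mat (nu S) (G t)"
  and G_carrier: "t < hor S \<Longrightarrow> G t \<in> carrier_mat (nu S) (nu S)"
  and G_nonneg: "t < hor S \<Longrightarrow> v \<in> carrier_vec (nu S) \<Longrightarrow> 0 \<le> v \<bullet> (G t *\<^sub>v v)"
  using lq_step.feedback[OF step] lq_step.offset[OF step]
    lq_step.gain_pd[OF step] lq_step.gain[OF step] lq_step.gain_nonneg[OF step] gain_eq
  by (auto simp: K_def \<kappa>_def)

section \<open>Value function, policy and regret\<close>

definition V :: "nat \<Rightarrow> real vec \<Rightarrow> real" where
  "V t x = x \<bullet> (P t *\<^sub>v x) + q t \<bullet> x + r t"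

definition policy :: "nat \<Rightarrow> real vec \<Rightarrow> real vec" where
  "policy t x = K t *\<^sub>v x + \<kappa> t"

text \<open>The constant left by averaging \<open>V (Suc t)\<close> over the noise;
  \<open>r t\<close> is this constant minus the gain form at the offset.\<close>

definition shift :: "nat \<Rightarrow> real" where
  "shift t = r (Suc t)
      + mat_trace (second_moment (nx S) (noise S t) * (transpose_mat (Caug S t) * P (Suc t) * Caug S t))
      + q (Suc t) \<bullet> (Caug S t *\<^sub>v wbar S)"

text \<open>The excess of the cost of \<open>v\<close> over that of the optimal control, as
  \<open>bellman_V\<close> confirms; it is the integrand in the exact cost identity.\<close>

definition regret :: "nat \<Rightarrow> real vec \<Rightarrow> real vec \<Rightarrow> real" where
  "regret t x v = (v - policy t x) \<bullet> (G t *\<^sub>v (v - policy t x))"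

lemma policy_carrier: "t < hor S \<Longrightarrow> x \<in> carrier_vec (naug S t) \<Longrightarrow> policy t x \<in> carrier_vec (nu S)"
  using K_carrier[of t] \<kappa>_carrier[of t] by (auto simp: policy_def)

lemma regret_nonneg:
  assumes "t < hor S" "x \<in> carrier_vec (naug S t)" "v \<in> carrier_vec (nu S)"
  shows "0 \<le> regret t x v"
  using assms policy_carrier[OF assms(1,2)] by (auto simp: regret_def intro!: G_nonneg)

lemma regret_policy:
  assumes "t < hor S" "x \<in> carrier_vec (naug S t)"
  shows "regret t x (policy t x) = 0"
  using policy_carrier[OF assms] G_carrier[OF assms(1)] by (simp add: regret_def)

text \<open>A purely algebraic identity in which the noise has already been averaged into
  \<open>s t\<close> and \<open>shift t\<close>. It serves twice: at fixed \<open>x\<close> and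
  \<open>v\<close> for the Bellman equation, and outcome by outcome along a trajectory for the total
  cost.\<close>

lemma bellman_completed_square:
  assumes t: "t < hor S" and x: "x \<in> carrier_vec (naug S t)" and v: "v \<in> carrier_vec (nu S)"
  defines "y \<equiv> Aaug S t *\<^sub>v x + Baug S t *\<^sub>v v"
  shows "stage_cost S t x v + (y \<bullet> (P (Suc t) *\<^sub>v y) + s t \<bullet> y) + shift t = V t x + regret t x v"
proof -
  interpret st: lq_step "naug S t" "naug S (Suc t)" "nu S" "Aaug S t" "Baug S t" "P (Suc t)" "wtR S" "s t"
    by (rule step[OF t])
  let ?L = "transpose_mat (Aaug S t + Baug S t * K t) *\<^sub>v s t"
  have L: "?L \<in> carrier_vec (naug S t)"
    using Aaug Baug K_carrier[OF t] st.s
    by (intro mult_mat_vec_carrier[of _ _ "naug S (Suc t)"] transpose_carrier_mat[THEN iffD2]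
        add_carrier_mat mult_carrier_mat)
  have sq: "v \<bullet> (wtR S *\<^sub>v v) + y \<bullet> (P (Suc t) *\<^sub>v y) + s t \<bullet> y
     = x \<bullet> (st.schur *\<^sub>v x) + ?L \<bullet> x - \<kappa> t \<bullet> (G t *\<^sub>v \<kappa> t) + regret t x v"
    using st.completing_the_square[OF x v]
    by (simp add: y_def regret_def policy_def K_def \<kappa>_def gain_eq[OF t])
  have "Qlam S t \<in> carrier_mat (naug S t) (naug S t)" using Qlam_psd by (simp add: psd_mat_def)
  then have "x \<bullet> (P t *\<^sub>v x) = x \<bullet> (Qlam S t *\<^sub>v x) + x \<bullet> (st.schur *\<^sub>v x)"
    using st.schur(1) x
    by (simp add: P_rec[OF t] mult_mat_vec_carrier[of _ "naug S t" "naug S t"] add_mult_distrib_mat_vec[of _ "naug S t" "naug S t"]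
        scalar_prod_add_distrib[of _ "naug S t"])
  moreover have "q t \<bullet> x = lam S * (zeta S t \<bullet> x) + ?L \<bullet> x"
    using zeta_carrier[of t] L x by (simp add: q_rec[OF t] add_scalar_prod_distrib[of _ "naug S t"])
  moreover have "r t = shift t - \<kappa> t \<bullet> (G t *\<^sub>v \<kappa> t)"
    by (simp add: r_rec[OF t] shift_def)
  ultimately show ?thesis using sq by (simp add: V_def stage_cost_def)
qed

text \<open>\<open>a\<close> is the noise-free part of the next state. A constant \<open>a\<close>
  gives the Bellman equation, a random one the cost along a trajectory.\<close>

lemma expectation_V:
  assumes t: "t < hor S" and a: "a \<in> L2_vec (pr S) (past t) (naug S (Suc t))"
  shows "integrable (pr S) (\<lambda>\<omega>. V (Suc t) (a \<omega> + Caug S t *\<^sub>v noise S t \<omega>))"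
    and "(\<integral>\<omega>. V (Suc t) (a \<omega> + Caug S t *\<^sub>v noise S t \<omega>) \<partial>pr S)
      = (\<integral>\<omega>. a \<omega> \<bullet> (P (Suc t) *\<^sub>v a \<omega>) + s t \<bullet> a \<omega> \<partial>pr S) + shift t"
proof -
  have le: "Suc t \<le> hor S" using t by simp
  have a': "a \<in> L2_vec (pr S) (pr S) (naug S (Suc t))" using L2_past[OF less_imp_le[OF t] a] .
  note E = expectation_quadratic_shift[OF P_carrier[OF le] P_sym[OF le] q_carrier[OF le] Caug[of t] a'
      noise_L2[OF t] noise_uncorrelated[OF t a], of "r (Suc t)"]
  show "integrable (pr S) (\<lambda>\<omega>. V (Suc t) (a \<omega> + Caug S t *\<^sub>v noise S t \<omega>))"
    unfolding V_def by (rule E(1))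
  show "(\<integral>\<omega>. V (Suc t) (a \<omega> + Caug S t *\<^sub>v noise S t \<omega>) \<partial>pr S)
      = (\<integral>\<omega>. a \<omega> \<bullet> (P (Suc t) *\<^sub>v a \<omega>) + s t \<bullet> a \<omega> \<partial>pr S) + shift t"
    using E(2) unfolding V_def mean_noise[OF t] shift_def s_def .
qed

lemma bellman_V:
  assumes t: "t < hor S" and x: "x \<in> carrier_vec (naug S t)" and v: "v \<in> carrier_vec (nu S)"
  shows "integrable (pr S) (\<lambda>\<omega>. V (Suc t) (aug_dyn S t x v (noise S t \<omega>)))"
    and "bellman_cost S t (V (Suc t)) x v = V t x + regret t x v"
proof -
  let ?y = "Aaug S t *\<^sub>v x + Baug S t *\<^sub>v v"
  have y: "?y \<in> carrier_vec (naug S (Suc t))" using Aaug[of t] Baug[of t] x v by auto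
  then have "(\<lambda>_. ?y) \<in> L2_vec (pr S) (past t) (naug S (Suc t))"
    by (simp add: L2_vec_def measurable_vec_const)
  note E = expectation_V[OF t this]
  show "integrable (pr S) (\<lambda>\<omega>. V (Suc t) (aug_dyn S t x v (noise S t \<omega>)))"
    unfolding aug_dyn_def by (rule E(1))
  show "bellman_cost S t (V (Suc t)) x v = V t x + regret t x v"
    unfolding bellman_cost_def aug_dyn_def E(2) using bellman_completed_square[OF t x v]
    by (simp add: prob_space)
qed

text \<open>A nonnegative regret that vanishes at the policy makes the infimum an attained minimum,
  so the real \<open>INF\<close> is the intended value. Agreement on vectors of the right dimension
  suffices under the integral, because the noise has that dimension at every outcome.\<close>

lemma J_eq_V: "t \<le> hor S \<Longrightarrow> x \<in> carrier_vec (naug S t) \<Longrightarrow> J S t x = V t x"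
proof (induction t arbitrary: x rule: inc_induct)
  case base
  have "zeta S (hor S) \<in> carrier_vec (naug S (hor S))" by (rule zeta_carrier)
  with base show ?case
    by (simp add: J.simps[of S "hor S"] final_cost_def V_def P_hor q_hor r_hor)
next
  case (step t)
  let ?f = "\<lambda>v. bellman_cost S t (J S (Suc t)) x v"
  have t: "t < hor S" using step.hyps by simp
  have f: "?f v = V t x + regret t x v" if v: "v \<in> carrier_vec (nu S)" for v
  proof -
    have "?f v = bellman_cost S t (V (Suc t)) x v"
      unfolding bellman_cost_def using step.prems v
      by (intro arg_cong2[where f = "(+)"] Bochner_Integration.integral_cong refl step.IH aug_dyn_carrier)
        (auto intro: measurable_vec_borel_carrier[OF noise_measurable[OF t]])
    then show ?thesis using bellman_V(2)[OF t step.prems v] by simp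
  qed
  have p: "policy t x \<in> carrier_vec (nu S)" by (rule policy_carrier[OF t step.prems])
  have "J S t x = (INF v\<in>carrier_vec (nu S). ?f v)" using t by (simp add: J.simps[of S t])
  also have "\<dots> = V t x"
  proof (rule cInf_eq_minimum)
    show "V t x \<in> ?f ` carrier_vec (nu S)"
      using p f[OF p] regret_policy[OF t step.prems] by force
    show "V t x \<le> z" if "z \<in> ?f ` carrier_vec (nu S)" for z
      using that f regret_nonneg[OF t step.prems] by auto
  qed
  finally show ?case .
qed

lemma bellman_J:
  assumes t: "t < hor S" and x: "x \<in> carrier_vec (naug S t)" and v: "v \<in> carrier_vec (nu S)"
  shows "integrable (pr S) (\<lambda>\<omega>. J S (Suc t) (aug_dyn S t x v (noise S t \<omega>)))"
    and "bellman_cost S t (J S (Suc t)) x v = J S t x + regret t x v"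
proof -
  have eq: "J S (Suc t) (aug_dyn S t x v (noise S t \<omega>)) = V (Suc t) (aug_dyn S t x v (noise S t \<omega>))"
    if "\<omega> \<in> space (pr S)" for \<omega>
    using t x v measurable_vec_borel_carrier[OF noise_measurable[OF t] that]
    by (intro J_eq_V aug_dyn_carrier) auto
  show "integrable (pr S) (\<lambda>\<omega>. J S (Suc t) (aug_dyn S t x v (noise S t \<omega>)))"
    using bellman_V(1)[OF assms] Bochner_Integration.integrable_cong[OF refl eq, of "pr S"] by simp
  have "bellman_cost S t (J S (Suc t)) x v = bellman_cost S t (V (Suc t)) x v"
    unfolding bellman_cost_def using Bochner_Integration.integral_cong[OF refl eq, of "pr S"] by simp
  then show "bellman_cost S t (J S (Suc t)) x v = J S t x + regret t x v"
    using bellman_V(2)[OF assms] J_eq_V[OF less_imp_le[OF t] x] by simp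
qed

lemma policy_minimal:
  assumes t: "t < hor S" and x: "x \<in> carrier_vec (naug S t)"
  shows "is_arg_min (bellman_cost S t (J S (Suc t)) x) (\<lambda>v. v \<in> carrier_vec (nu S)) (policy t x)"
  unfolding is_arg_min_def
  using bellman_J(2)[OF t x] policy_carrier[OF t x] regret_policy[OF t x] regret_nonneg[OF t x]
  by (auto simp: not_less)

section \<open>The cost of an admissible control\<close>

lemma integrable_V:
  "t \<le> hor S \<Longrightarrow> X \<in> L2_vec (pr S) (pr S) (naug S t) \<Longrightarrow> integrable (pr S) (\<lambda>\<omega>. V t (X \<omega>))"
  using P_carrier[of t] unfolding V_def
  by (intro Bochner_Integration.integrable_add integrable_bilinear_form(1) integrable_linear_form(1)) auto

lemma integrable_stage_cost:
  assumes "X \<in> L2_vec (pr S) (pr S) (naug S t)" "Y \<in> L2_vec (pr S) (pr S) (nu S)"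
  shows "integrable (pr S) (\<lambda>\<omega>. stage_cost S t (X \<omega>) (Y \<omega>))"
  using Qlam_psd[of t] wtR_pd assms unfolding stage_cost_def psd_mat_def pd_mat_def
  by (intro Bochner_Integration.integrable_add integrable_bilinear_form(1)
      integrable_mult_right integrable_linear_form(1)) auto

text \<open>In mean, a stage pays the decrease of the value function plus the expected regret. The
  pointwise square identity is integrated; the noise enters only through
  \<open>expectation_V\<close>, which applies because state and control at \<open>t\<close> are
  determined by the past.\<close>

lemma expected_regret:
  assumes u: "admissible u" and t: "t < hor S"
  defines "\<eta> \<equiv> aug_state S u"
  shows "(\<integral>\<omega>. stage_cost S t (\<eta> t \<omega>) (u t \<omega>) \<partial>pr S)
    = (\<integral>\<omega>. V t (\<eta> t \<omega>) \<partial>pr S) - (\<integral>\<omega>. V (Suc t) (\<eta> (Suc t) \<omega>) \<partial>pr S)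
      + (\<integral>\<omega>. regret t (\<eta> t \<omega>) (u t \<omega>) \<partial>pr S)"
proof -
  let ?a = "\<lambda>\<omega>. Aaug S t *\<^sub>v \<eta> t \<omega> + Baug S t *\<^sub>v u t \<omega>"
  let ?f = "\<lambda>\<omega>. ?a \<omega> \<bullet> (P (Suc t) *\<^sub>v ?a \<omega>) + s t \<bullet> ?a \<omega>"
  have le: "t \<le> hor S" "Suc t \<le> hor S" using t by auto
  have \<eta>: "\<eta> t \<in> L2_vec (pr S) (pr S) (naug S t)" unfolding \<eta>_def
    using u t by (intro aug_state_L2 admissible_L2) auto
  have \<eta>p: "\<eta> t \<in> past t \<rightarrow>\<^sub>M vec_borel (naug S t)" unfolding \<eta>_def
    using u t by (intro aug_state_past admissible_past) auto
  have ut: "u t \<in> L2_vec (pr S) (pr S) (nu S)" by (rule admissible_L2[OF u t])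
  have a: "?a \<in> L2_vec (pr S) (pr S) (naug S (Suc t))"
    using Aaug Baug \<eta> ut by (intro L2_vec_add L2_vec_mult_mat)
  have "?a \<in> past t \<rightarrow>\<^sub>M vec_borel (naug S (Suc t))"
    using Aaug Baug \<eta>p admissible_past[OF u t] by (intro measurable_vec_add measurable_mult_mat_vec)
  with a have ap: "?a \<in> L2_vec (pr S) (past t) (naug S (Suc t))" by (simp add: L2_vec_def)
  have EV: "(\<integral>\<omega>. V (Suc t) (\<eta> (Suc t) \<omega>) \<partial>pr S) = (\<integral>\<omega>. ?f \<omega> \<partial>pr S) + shift t"
    using expectation_V(2)[OF t ap] by (simp add: \<eta>_def aug_dyn_def)
  have fint: "integrable (pr S) ?f"
    by (intro Bochner_Integration.integrable_add integrable_bilinear_form(1)[OF a a P_carrier[OF le(2)]]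
        integrable_linear_form(1)[OF a])
  have "integrable (pr S) (\<lambda>\<omega>. stage_cost S t (\<eta> t \<omega>) (u t \<omega>))"
    by (rule integrable_stage_cost[OF \<eta> ut])
  note int = this fint integrable_V[OF le(1) \<eta>]
  have pt: "regret t (\<eta> t \<omega>) (u t \<omega>) = stage_cost S t (\<eta> t \<omega>) (u t \<omega>) + ?f \<omega> + shift t - V t (\<eta> t \<omega>)"
    if "\<omega> \<in> space (pr S)" for \<omega>
    using bellman_completed_square[OF t L2_vec_carrier[OF \<eta> that] L2_vec_carrier[OF ut that]] by simp
  have "(\<integral>\<omega>. regret t (\<eta> t \<omega>) (u t \<omega>) \<partial>pr S)
      = (\<integral>\<omega>. stage_cost S t (\<eta> t \<omega>) (u t \<omega>) + ?f \<omega> + shift t - V t (\<eta> t \<omega>) \<partial>pr S)"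
    by (rule Bochner_Integration.integral_cong[OF refl pt])
  also have "\<dots> = (\<integral>\<omega>. stage_cost S t (\<eta> t \<omega>) (u t \<omega>) \<partial>pr S) + (\<integral>\<omega>. ?f \<omega> \<partial>pr S) + shift t
      - (\<integral>\<omega>. V t (\<eta> t \<omega>) \<partial>pr S)"
    using int by (simp add: prob_space)
  finally show ?thesis using EV by simp
qed

text \<open>The decreases of the mean value telescope; the last value is the mean terminal cost and
  the initial one is \<open>J S 0 x0\<close>.\<close>

theorem total_cost_admissible:
  assumes u: "admissible u"
  shows "total_cost S (aug_state S u) u
    = J S 0 x0 + (\<Sum>t<hor S. \<integral>\<omega>. regret t (aug_state S u t \<omega>) (u t \<omega>) \<partial>pr S)"
proof -
  let ?\<eta> = "aug_state S u"
  let ?v = "\<lambda>t. \<integral>\<omega>. V t (?\<eta> t \<omega>) \<partial>pr S"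
  have \<eta>: "?\<eta> t \<in> L2_vec (pr S) (pr S) (naug S t)" if "t \<le> hor S" for t
    using u that by (intro aug_state_L2 admissible_L2) auto
  have final: "final_cost S (?\<eta> (hor S) \<omega>) = V (hor S) (?\<eta> (hor S) \<omega>)" if "\<omega> \<in> space (pr S)" for \<omega>
    using J_eq_V[OF order_refl L2_vec_carrier[OF \<eta>[OF order_refl] that]] by (simp add: J.simps[of S "hor S"])
  have sc: "integrable (pr S) (\<lambda>\<omega>. stage_cost S t (?\<eta> t \<omega>) (u t \<omega>))" if "t < hor S" for t
    using integrable_stage_cost[OF \<eta> admissible_L2[OF u that]] that by simp
  have "total_cost S ?\<eta> u = (\<integral>\<omega>. V (hor S) (?\<eta> (hor S) \<omega>) + (\<Sum>t<hor S. stage_cost S t (?\<eta> t \<omega>) (u t \<omega>)) \<partial>pr S)"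
    unfolding total_cost_def by (intro Bochner_Integration.integral_cong refl) (simp add: final)
  also have "\<dots> = ?v (hor S) + (\<Sum>t<hor S. \<integral>\<omega>. stage_cost S t (?\<eta> t \<omega>) (u t \<omega>) \<partial>pr S)"
    using sc integrable_V[OF order_refl \<eta>[OF order_refl]]
    by (subst Bochner_Integration.integral_add) (auto simp: Bochner_Integration.integral_sum)
  also have "(\<Sum>t<hor S. \<integral>\<omega>. stage_cost S t (?\<eta> t \<omega>) (u t \<omega>) \<partial>pr S)
      = (\<Sum>t<hor S. ?v t - ?v (Suc t)) + (\<Sum>t<hor S. \<integral>\<omega>. regret t (?\<eta> t \<omega>) (u t \<omega>) \<partial>pr S)"
    unfolding sum.distrib[symmetric] by (intro sum.cong refl expected_regret[OF u]) simp
  also have "(\<Sum>t<hor S. ?v t - ?v (Suc t)) = ?v 0 - ?v (hor S)" by (rule sum_lessThan_telescope')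
  also have "?v 0 = V 0 x0"
  proof -
    have m: "(\<lambda>\<omega>. V 0 (?\<eta> 0 \<omega>)) \<in> borel_measurable (pr S)"
      using integrable_V[OF _ \<eta>[of 0]] by auto
    \<comment> \<open>The initial state equals \<open>x0\<close> only almost surely, so the
      integrands are exchanged almost everywhere.\<close>
    have "?v 0 = (\<integral>\<omega>. V 0 x0 \<partial>pr S)"
      by (rule integral_cong_AE[OF m]) (use x_init_AE in \<open>auto elim!: eventually_mono\<close>)
    then show ?thesis by (simp add: prob_space)
  qed
  also have "V 0 x0 = J S 0 x0" by (rule J_eq_V[symmetric]) (simp_all add: x0 naug_0)
  finally show ?thesis by linarith
qed

lemma total_cost_ge:
  assumes u: "admissible u"
  shows "J S 0 x0 \<le> total_cost S (aug_state S u) u"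
proof -
  have "0 \<le> (\<integral>\<omega>. regret t (aug_state S u t \<omega>) (u t \<omega>) \<partial>pr S)" if "t < hor S" for t
  proof (intro Bochner_Integration.integral_nonneg regret_nonneg[OF that])
    fix \<omega> assume \<omega>: "\<omega> \<in> space (pr S)"
    show "u t \<omega> \<in> carrier_vec (nu S)" using L2_vec_carrier[OF admissible_L2[OF u that] \<omega>] .
    show "aug_state S u t \<omega> \<in> carrier_vec (naug S t)"
      using that u by (intro L2_vec_carrier[OF aug_state_L2 \<omega>] admissible_L2) auto
  qed
  then show ?thesis unfolding total_cost_admissible[OF u] by (auto intro!: sum_nonneg)
qed

section \<open>The optimal control\<close>

text \<open>In the closed loop control and state depend on each other, whereas
  \<open>aug_state\<close> expects the control as a finished sequence. The trajectory therefore gets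
  its own recursion, and \<open>aug_state_opt_control\<close> verifies that it is the state
  generated by the resulting control.\<close>

primrec opt_state :: "nat \<Rightarrow> 'w \<Rightarrow> real vec" where
  "opt_state 0 \<omega> = x_init S \<omega>"
| "opt_state (Suc t) \<omega> = aug_dyn S t (opt_state t \<omega>) (policy t (opt_state t \<omega>)) (noise S t \<omega>)"

definition opt_control :: "nat \<Rightarrow> 'w \<Rightarrow> real vec" where
  "opt_control t \<omega> = policy t (opt_state t \<omega>)"

lemma aug_state_opt_control: "aug_state S opt_control t \<omega> = opt_state t \<omega>"
  by (induction t) (auto simp: opt_control_def)

lemma opt_control_eq: "opt_control t \<omega> = policy t (aug_state S opt_control t \<omega>)"
  by (simp add: opt_control_def aug_state_opt_control)

lemma opt_control_affine: "opt_control t = (\<lambda>\<omega>. K t *\<^sub>v aug_state S opt_control t \<omega> + \<kappa> t)"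
  by (rule ext) (simp only: opt_control_eq[of t] policy_def)

text \<open>The sigma-algebra \<open>F\<close> is left open, so that the past and both filtrations
  are served.\<close>

lemma opt_control_measurable:
  assumes "t < hor S" "aug_state S opt_control t \<in> F \<rightarrow>\<^sub>M vec_borel (naug S t)"
  shows "opt_control t \<in> F \<rightarrow>\<^sub>M vec_borel (nu S)"
proof -
  have "(\<lambda>\<omega>. K t *\<^sub>v aug_state S opt_control t \<omega> + \<kappa> t) \<in> F \<rightarrow>\<^sub>M vec_borel (nu S)"
    using assms K_carrier \<kappa>_carrier by (intro measurable_vec_add measurable_mult_mat_vec measurable_vec_const)
  then show ?thesis by (subst opt_control_affine)
qed

text \<open>Complete induction, since the state at \<open>t\<close> involves every earlier
  control.\<close>

lemma opt_control_L2: "t < hor S \<Longrightarrow> opt_control t \<in> L2_vec (pr S) (pr S) (nu S)"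
proof (induction t rule: less_induct)
  case (less t)
  then have "aug_state S opt_control t \<in> L2_vec (pr S) (pr S) (naug S t)"
    by (intro aug_state_L2) auto
  then have "(\<lambda>\<omega>. K t *\<^sub>v aug_state S opt_control t \<omega> + \<kappa> t) \<in> L2_vec (pr S) (pr S) (nu S)"
    using less.prems K_carrier \<kappa>_carrier by (intro L2_vec_add L2_vec_mult_mat L2_vec_const)
  then show ?case by (subst opt_control_affine)
qed

lemma opt_control_past: "t < hor S \<Longrightarrow> opt_control t \<in> past t \<rightarrow>\<^sub>M vec_borel (nu S)"
proof (induction t rule: less_induct)
  case (less t)
  have "opt_control s \<in> past s \<rightarrow>\<^sub>M vec_borel (nu S)" if "s < t" for s
    using less.IH[OF that] less.prems that by simp
  then show ?case
    by (intro opt_control_measurable[OF less.prems aug_state_past[OF _ less_imp_le[OF less.prems]]])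
qed

lemma opt_control_admissible: "admissible opt_control"
  using opt_control_past opt_control_L2 by (auto simp: admissible_def L2_vec_def)

lemma opt_control_carrier: "t < hor S \<Longrightarrow> opt_control t \<in> space (pr S) \<rightarrow> carrier_vec (nu S)"
  using L2_vec_carrier[OF opt_control_L2] by auto

text \<open>The current augmented state is the last component of its own history, and the control is
  an affine function of it.\<close>

lemma opt_control_feasible3: "opt_control \<in> feasible3 S x0"
proof -
  have "opt_control t \<in> L2_vec (pr S) (filtG S opt_control t) (nu S)" if t: "t < hor S" for t
  proof -
    have "aug_state S opt_control s \<in> space (pr S) \<rightarrow> carrier_vec (naug S s)" if "s \<le> t" for s
      using that t L2_vec_carrier[OF aug_state_L2[of s opt_control]] opt_control_L2 by auto
    then have "aug_state S opt_control t \<in> filtG S opt_control t \<rightarrow>\<^sub>M vec_borel (naug S t)"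
      unfolding filtG_def using opt_control_carrier t
      by (intro measurable_history_gen_sigma) auto
    from opt_control_measurable[OF t this] opt_control_L2[OF t]
    show ?thesis by (simp add: L2_vec_def)
  qed
  then show ?thesis using x_init_AE by (simp add: feasible3_def)
qed

text \<open>The original history lists single states, not augmented ones. Each coordinate of the
  augmented state is a coordinate of some state at a time at most \<open>t\<close>, so it can be
  read from that history.\<close>

lemma opt_control_feasible2: "opt_control \<in> feasible2 S x0"
proof -
  have "opt_control t \<in> L2_vec (pr S) (filtF S opt_control t) (nu S)" if t: "t < hor S" for t
  proof -
    let ?F = "filtF S opt_control t"
    have sp: "space ?F = space (pr S)" by (simp add: filtF_def gen_sigma_def)
    have sc: "state S opt_control s \<in> space (pr S) \<rightarrow> carrier_vec (nx S)" if "s \<le> t" for s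
    proof -
      have "state S opt_control s \<in> past s \<rightarrow>\<^sub>M vec_borel (nx S)"
        using that t by (intro state_past opt_control_past) auto
      then show ?thesis by (auto dest: measurable_vec_borel_carrier)
    qed
    have st: "state S opt_control s \<in> ?F \<rightarrow>\<^sub>M vec_borel (nx S)" if "s \<le> t" for s
      unfolding filtF_eq using that t opt_control_carrier sc
      by (intro measurable_history_gen_sigma[where dz = "\<lambda>_. nx S"]) auto
    have "stacked_state S opt_control t \<in> ?F \<rightarrow>\<^sub>M vec_borel (naug S t)"
      unfolding measurable_vec_borel_iff
    proof (intro conjI allI impI)
      show "stacked_state S opt_control t \<in> space ?F \<rightarrow> carrier_vec (naug S t)"
        by (simp add: stacked_state_def)
      fix a assume a: "a < naug S t"
      have "(\<lambda>\<omega>. state S opt_control (t - a div nx S) \<omega> $ (a mod nx S)) \<in> ?F \<rightarrow>\<^sub>M borel"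
        using nx_pos by (intro measurable_vec_borel_index[OF st]) auto
      then show "(\<lambda>\<omega>. stacked_state S opt_control t \<omega> $ a) \<in> ?F \<rightarrow>\<^sub>M borel"
        using a by (simp add: stacked_state_def)
    qed
    \<comment> \<open>Pointwise equality carries measurability from the stacked state to the
      augmented state, on which the policy acts.\<close>
    then have "aug_state S opt_control t \<in> ?F \<rightarrow>\<^sub>M vec_borel (naug S t)"
      by (rule measurable_cong[THEN iffD1, rotated])
        (use t sp in \<open>auto intro!: stacked_state_admissible opt_control_admissible\<close>)
    from opt_control_measurable[OF t this] opt_control_L2[OF t]
    show ?thesis by (simp add: L2_vec_def)
  qed
  then show ?thesis using x_init_AE by (simp add: feasible2_def)
qed

lemma total_cost_opt_control: "total_cost S (aug_state S opt_control) opt_control = J S 0 x0"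
proof -
  have "(\<integral>\<omega>. regret t (aug_state S opt_control t \<omega>) (opt_control t \<omega>) \<partial>pr S) = 0" if t: "t < hor S" for t
  proof -
    have "(\<integral>\<omega>. regret t (aug_state S opt_control t \<omega>) (opt_control t \<omega>) \<partial>pr S) = (\<integral>\<omega>. 0 \<partial>pr S)"
    proof (intro Bochner_Integration.integral_cong refl)
      fix \<omega> assume \<omega>: "\<omega> \<in> space (pr S)"
      have "aug_state S opt_control t \<omega> \<in> carrier_vec (naug S t)"
        using t by (intro L2_vec_carrier[OF aug_state_L2 \<omega>] opt_control_L2) auto
      then show "regret t (aug_state S opt_control t \<omega>) (opt_control t \<omega>) = 0"
        unfolding opt_control_eq[of t \<omega>] by (rule regret_policy[OF t])
    qed
    then show ?thesis by simp
  qed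
  then show ?thesis by (simp add: total_cost_admissible[OF opt_control_admissible])
qed

lemma opt_value3: "opt_value3 S x0 = ereal (J S 0 x0)"
  unfolding opt_value3_def
proof (rule antisym)
  show "(INF u\<in>feasible3 S x0. ereal (total_cost S (aug_state S u) u)) \<le> ereal (J S 0 x0)"
    using INF_lower[OF opt_control_feasible3, of "\<lambda>u. ereal (total_cost S (aug_state S u) u)"]
    by (simp add: total_cost_opt_control)
  show "ereal (J S 0 x0) \<le> (INF u\<in>feasible3 S x0. ereal (total_cost S (aug_state S u) u))"
    by (intro INF_greatest) (simp add: total_cost_ge feasible3_admissible)
qed

text \<open>The control that is optimal for the augmented problem is feasible here as well, and the
  cost of an admissible control does not change when the stacked state replaces the augmented one;
  the same two-sided bound applies.\<close>

lemma opt_value2: "opt_value2 S x0 = ereal (J S 0 x0)"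
  unfolding opt_value2_def
proof (rule antisym)
  show "(INF u\<in>feasible2 S x0. ereal (total_cost S (stacked_state S u) u)) \<le> ereal (J S 0 x0)"
    using INF_lower[OF opt_control_feasible2, of "\<lambda>u. ereal (total_cost S (stacked_state S u) u)"]
    by (simp add: total_cost_opt_control total_cost_stacked_state opt_control_admissible)
  show "ereal (J S 0 x0) \<le> (INF u\<in>feasible2 S x0. ereal (total_cost S (stacked_state S u) u))"
    by (intro INF_greatest) (simp add: total_cost_stacked_state total_cost_ge feasible2_admissible)
qed

lemma opt_control_optimal: "optimal3 S x0 opt_control"
  by (simp add: optimal3_def opt_control_feasible3 opt_value3 total_cost_opt_control)

section \<open>The recursion in its stated form\<close>

lemma P_riccati:
  assumes t: "t < hor S"
  shows "P t = Qlam S t + transpose_mat (Aaug S t) * P (Suc t) * Aaug S t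
          - transpose_mat (Aaug S t) * P (Suc t) * Baug S t
            * mat_inv (G t) * transpose_mat (Baug S t) * P (Suc t) * Aaug S t"
proof -
  \<comment> \<open>Matrices of all sizes share one type, so this regrouping is proved for matching
    dimensions.\<close>
  have assoc: "X + (Y - Z) = X + Y - Z" if "X \<in> carrier_mat d d" "Y \<in> carrier_mat d d" "Z \<in> carrier_mat d d"
    for d and X Y Z :: "real mat"
    using that by (intro eq_matI) auto
  have "Qlam S t \<in> carrier_mat (naug S t) (naug S t)"
    using Qlam_psd by (simp add: psd_mat_def)
  then show ?thesis
    unfolding P_rec[OF t] lq_step.schur_def[OF step[OF t]] gain_eq[OF t]
    using Aaug[of t] by (intro assoc) (auto intro!: carrier_matI)
qed

text \<open>The trace argument arises as the moment matrix times a congruence; associativity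
  flattens it, and the moment is replaced by covariance plus outer product of the mean.\<close>

lemma r_riccati:
  assumes t: "t < hor S"
  shows "r t = r (Suc t)
          + mat_trace ((Sig S + mat (nx S) (nx S) (\<lambda>(i, j). wbar S $ i * wbar S $ j))
              * transpose_mat (Caug S t) * P (Suc t) * Caug S t)
          + q (Suc t) \<bullet> (Caug S t *\<^sub>v wbar S) - \<kappa> t \<bullet> (G t *\<^sub>v \<kappa> t)"
proof -
  let ?W = "Sig S + mat (nx S) (nx S) (\<lambda>(i, j). wbar S $ i * wbar S $ j)"
  let ?C = "Caug S t" and ?n = "nx S" and ?e = "naug S (Suc t)"
  have c: "?W \<in> carrier_mat ?n ?n" "?C \<in> carrier_mat ?e ?n" "P (Suc t) \<in> carrier_mat ?e ?e"
    using Caug[of t] P_carrier[of "Suc t"] t by (auto simp: Sig_def)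
  have "?W * (transpose_mat ?C * P (Suc t) * ?C) = ?W * (transpose_mat ?C * P (Suc t)) * ?C"
    using c by (intro assoc_mult_mat[symmetric, of _ ?n ?n _ ?e _ ?n]) auto
  also have "?W * (transpose_mat ?C * P (Suc t)) = ?W * transpose_mat ?C * P (Suc t)"
    using c by (intro assoc_mult_mat[symmetric, of _ ?n ?n _ ?e _ ?e]) auto
  finally show ?thesis using r_rec[OF t] second_moment_noise[OF t] by simp
qed

lemma K_riccati: "t < hor S \<Longrightarrow> K t = - (mat_inv (G t) * transpose_mat (Baug S t) * P (Suc t) * Aaug S t)"
  by (simp only: K_def lq_step.feedback_def[OF step] gain_eq)

lemma \<kappa>_riccati: "t < hor S \<Longrightarrow>
    \<kappa> t = (- 1 / 2) \<cdot>\<^sub>v (mat_inv (G t) *\<^sub>v (transpose_mat (Baug S t) *\<^sub>v s t))"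
  by (simp only: \<kappa>_def lq_step.offset_def[OF step] gain_eq)

lemma J_convex_quadratic:
  assumes "t \<le> hor S"
  shows "convex_fun (naug S t) (J S t)" "quadratic_fun (naug S t) (J S t)"
proof -
  have J: "J S t x = x \<bullet> (P t *\<^sub>v x) + q t \<bullet> x + r t" if "x \<in> carrier_vec (naug S t)" for x
    using J_eq_V[OF assms that] by (simp add: V_def)
  show "convex_fun (naug S t) (J S t)"
    by (rule convex_quadratic[OF P_psd[OF assms] q_carrier[OF assms] J])
  show "quadratic_fun (naug S t) (J S t)"
    using J P_carrier[OF assms] q_carrier[OF assms] unfolding quadratic_fun_def by blast
qed

lemma policy_affine: "t < hor S \<Longrightarrow> affine_fun (naug S t) (nu S) (policy t)"
  using K_carrier \<kappa>_carrier unfolding affine_fun_def policy_def by blast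

end

lemma backward_recursion: "\<exists>f. f N = z \<and> (\<forall>t<N. f t = g t (f (Suc t)))" for N :: nat
proof -
  \<comment> \<open>Run forward in the number of remaining stages: the value with
    \<open>Suc k\<close> stages left belongs to time \<open>N - Suc k\<close>, which is therefore
    the time passed to \<open>g\<close>.\<close>
  let ?f = "\<lambda>t. rec_nat z (\<lambda>k. g (N - Suc k)) (N - t)"
  have "?f t = g t (?f (Suc t))" if "t < N" for t
  proof -
    have "N - t = Suc (N - Suc t)" "N - Suc (N - Suc t) = t" using that by auto
    then show ?thesis by simp
  qed
  then show ?thesis by (intro exI[of _ ?f]) simp
qed

theorem corollary1:
  fixes S :: "'w lq_data" and x0 :: "real vec"
  assumes "prob_space (pr S)"
    and "1 \<le> nx S" and "1 \<le> nu S" and "1 \<le> hor S"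
    and "sysA S \<in> carrier_mat (nx S) (nx S)"
    and "sysB S \<in> carrier_mat (nx S) (nu S)"
    and "mem S \<le> hor S"
    and "psd_mat (nx S * (mem S + 1)) (wtQ S)"
    and "pd_mat (nu S) (wtR S)"
    and "0 \<le> lam S"
    and "prob_space.indep_vars (pr S) (\<lambda>_. vec_borel (nx S))
           (case_nat (x_init S) (noise S)) {..hor S}"
    and "\<And>s t. s < hor S \<Longrightarrow> t < hor S \<Longrightarrow>
           distr (pr S) (vec_borel (nx S)) (noise S s) = distr (pr S) (vec_borel (nx S)) (noise S t)"
    and "\<And>t. t < hor S \<Longrightarrow> integrable (pr S) (\<lambda>\<omega>. (noise S t \<omega> \<bullet> noise S t \<omega>)\<^sup>2)"
    and "x0 \<in> carrier_vec (nx S)"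
    and "AE \<omega> in pr S. x_init S \<omega> = x0"
  shows "(\<forall>t\<le>hor S. convex_fun (naug S t) (J S t) \<and> quadratic_fun (naug S t) (J S t)) \<and>
    (\<exists>\<mu> P q r K \<kappa>.
      (\<forall>t<hor S. affine_fun (naug S t) (nu S) (\<mu> t) \<and>
        (\<forall>\<eta>\<in>carrier_vec (naug S t).
          (\<forall>v\<in>carrier_vec (nu S).
             integrable (pr S) (\<lambda>\<omega>. J S (Suc t) (aug_dyn S t \<eta> v (noise S t \<omega>)))) \<and>
          is_arg_min (bellman_cost S t (J S (Suc t)) \<eta>) (\<lambda>v. v \<in> carrier_vec (nu S)) (\<mu> t \<eta>))) \<and>
      (\<exists>u. (\<forall>t<hor S. \<forall>\<omega>. u t \<omega> = \<mu> t (aug_state S u t \<omega>)) \<and> optimal3 S x0 u) \<and>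
      opt_value3 S x0 = opt_value2 S x0 \<and>
      opt_value2 S x0 = ereal (J S 0 x0) \<and>
      (\<forall>t<hor S. \<forall>\<eta>\<in>carrier_vec (naug S t).
        J S t \<eta> = \<eta> \<bullet> (P t *\<^sub>v \<eta>) + q t \<bullet> \<eta> + r t \<and>
        \<mu> t \<eta> = K t *\<^sub>v \<eta> + \<kappa> t) \<and>
      P (hor S) = Qlam S (hor S) \<and>
      q (hor S) = lam S \<cdot>\<^sub>v zeta S (hor S) \<and>
      r (hor S) = 0 \<and>
      (\<forall>t\<le>hor S. psd_mat (naug S t) (P t)) \<and>
      (\<forall>t<hor S.
        invertible_mat (gain_mat S t (P (Suc t))) \<and>
        P t = Qlam S t + transpose_mat (Aaug S t) * P (Suc t) * Aaug S t
          - transpose_mat (Aaug S t) * P (Suc t) * Baug S t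
            * mat_inv (gain_mat S t (P (Suc t)))
            * transpose_mat (Baug S t) * P (Suc t) * Aaug S t \<and>
        q t = lam S \<cdot>\<^sub>v zeta S t
          + transpose_mat (Aaug S t + Baug S t * K t)
            *\<^sub>v (q (Suc t) + 2 \<cdot>\<^sub>v (P (Suc t) *\<^sub>v (Caug S t *\<^sub>v wbar S))) \<and>
        r t = r (Suc t)
          + mat_trace ((Sig S + mat (nx S) (nx S) (\<lambda>(i, j). wbar S $ i * wbar S $ j))
              * transpose_mat (Caug S t) * P (Suc t) * Caug S t)
          + q (Suc t) \<bullet> (Caug S t *\<^sub>v wbar S)
          - \<kappa> t \<bullet> (gain_mat S t (P (Suc t)) *\<^sub>v \<kappa> t) \<and>
        K t = - (mat_inv (gain_mat S t (P (Suc t)))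
          * transpose_mat (Baug S t) * P (Suc t) * Aaug S t) \<and>
        \<kappa> t = (- 1 / 2) \<cdot>\<^sub>v (mat_inv (gain_mat S t (P (Suc t)))
          *\<^sub>v (transpose_mat (Baug S t)
            *\<^sub>v (q (Suc t) + 2 \<cdot>\<^sub>v (P (Suc t) *\<^sub>v (Caug S t *\<^sub>v wbar S)))))))"
proof -
  interpret lq_problem S x0
    using assms by (intro lq_problem.intro lq_problem_axioms.intro)
  \<comment> \<open>The recursion is triangular: that for \<open>P\<close> is closed,
    \<open>q\<close> uses \<open>P\<close> and the feedback, \<open>r\<close> uses all of these.
    Hence three separate backward recursions in this order.\<close>
  obtain P where P: "P (hor S) = Qlam S (hor S)"
    "\<forall>t<hor S. P t = Qlam S t + lq_step.schur (Aaug S t) (Baug S t) (P (Suc t)) (wtR S)"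
    using backward_recursion[of "hor S" "Qlam S (hor S)"
        "\<lambda>t X. Qlam S t + lq_step.schur (Aaug S t) (Baug S t) X (wtR S)"] by blast
  define K where "K t = lq_step.feedback (Aaug S t) (Baug S t) (P (Suc t)) (wtR S)" for t
  let ?s = "\<lambda>t y. y + 2 \<cdot>\<^sub>v (P (Suc t) *\<^sub>v (Caug S t *\<^sub>v wbar S))"
  obtain q where q: "q (hor S) = lam S \<cdot>\<^sub>v zeta S (hor S)"
    "\<forall>t<hor S. q t = lam S \<cdot>\<^sub>v zeta S t + transpose_mat (Aaug S t + Baug S t * K t) *\<^sub>v ?s t (q (Suc t))"
    using backward_recursion[of "hor S" "lam S \<cdot>\<^sub>v zeta S (hor S)"
        "\<lambda>t y. lam S \<cdot>\<^sub>v zeta S t + transpose_mat (Aaug S t + Baug S t * K t) *\<^sub>v ?s t y"] by blast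
  define s where "s t = ?s t (q (Suc t))" for t
  define \<kappa> where "\<kappa> t = lq_step.offset (Baug S t) (P (Suc t)) (wtR S) (s t)" for t
  let ?r = "\<lambda>t \<rho>. \<rho>
      + mat_trace (second_moment (nx S) (noise S t) * (transpose_mat (Caug S t) * P (Suc t) * Caug S t))
      + q (Suc t) \<bullet> (Caug S t *\<^sub>v wbar S) - \<kappa> t \<bullet> (gain_mat S t (P (Suc t)) *\<^sub>v \<kappa> t)"
  obtain r where r: "r (hor S) = 0" "\<forall>t<hor S. r t = ?r t (r (Suc t))"
    using backward_recursion[of "hor S" 0 ?r] by blast
  interpret lq_solution S x0 P q r s K \<kappa>
    using P q r by unfold_locales (simp_all add: K_def s_def \<kappa>_def)
  have "\<forall>t<hor S. \<forall>\<omega>. opt_control t \<omega> = policy t (aug_state S opt_control t \<omega>)"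
    using opt_control_eq by blast
  with opt_control_optimal
  have u: "\<exists>u. (\<forall>t<hor S. \<forall>\<omega>. u t \<omega> = policy t (aug_state S u t \<omega>)) \<and> optimal3 S x0 u" by blast
  show ?thesis
    apply (intro conjI)
    subgoal using J_convex_quadratic by blast
    apply (rule exI[of _ policy], rule exI[of _ P], rule exI[of _ q], rule exI[of _ r], rule exI[of _ K], rule exI[of _ \<kappa>])
    apply (intro conjI)
    subgoal using policy_affine bellman_J(1) policy_minimal by blast
    subgoal by (rule u)
    subgoal by (simp add: opt_value2 opt_value3)
    subgoal by (rule opt_value2)
    subgoal using J_eq_V by (simp add: V_def policy_def)
    subgoal by (rule P_hor)
    subgoal by (rule q_hor)
    subgoal by (rule r_hor)
    subgoal using P_psd by blast
    subgoal
      using pd_mat_inverse(1)[OF G_pd] P_riccati q_rec r_riccati K_riccati \<kappa>_riccati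
      unfolding s_def[symmetric] by blast
    done
qed

end
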